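(* Let $G=SU(2)$ in its defining representation, $\lambda\in\mathbb C\setminus\{0\}$, $\beta=\frac1{2\lambda}$, $$a=-\cosh(\sqrt3\,\beta)-\tfrac1{\sqrt3}\sinh(\sqrt3\,\beta),\qquad b=-\cosh(\sqrt3\,\beta)+\tfrac1{\sqrt3}\sinh(\sqrt3\,\beta),$$ assume $ab\neq0$, fix a square root $\sqrt{ab}$, and set $q=\frac{a}{\sqrt{ab}}$, so that $q^{-1}=\frac{b}{\sqrt{ab}}$. Let $K$ be a link diagram in $\mathbb R^2$ with crossings $x_1,\dots,x_k$, let $s:\{1,\dots,k\}\to\{\text{active},\mathrm A,\mathrm B\}$, and let $A$ be a smooth $\mathfrak{su}(2)$-valued one-form on $\mathbb R^2$ (a connection pulled back to $\mathbb R^3$ from the plane). Then the normalized $SU(2)$ Wilson loop expectation $F(K,s,o)(A)$ defined in the context satisfies: 1. $F(K,s,o)(A)$ does not depend on the orientation $o$; denote it $\langle K,s\rangle(A)$. 2. (Kauffman bracket skein relation) For every $i$ with $s(i)=\text{active}$, $$\langle K,s\rangle(A)=q\,\langle K,s_{i\to\mathrm A}\rangle(A)+q^{-1}\,\langle K,s_{i\to\mathrm B}\rangle(A),$$ where $s_{i\to\mathrm A}$ (resp. $s_{i\to \mathrm B}$) agrees with $s$ except that its value at $i$ is $\mathrm A$ (resp. $\mathrm B$).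
   Context: Diagrams. A link diagram $K$ is a finite union of smoothly immersed closed curves in the oriented plane $\mathbb R^2$ whose only multiple points are transverse double points $x_1,\dots,x_k$, with over/under information at each. At $x_i$, rotating the over-strand counterclockwise until it meets the under-strand sweeps out two opposite local regions. The A-smoothing at $x_i$ reconnects the four local half-strands so that these two regions are merged; the B-smoothing is the other planar reconnection. (For the crossing drawn as "/" over "\", the A-smoothing is ")(", the B-smoothing is the one turned by $\pi/2$.) Partially smoothed diagrams. Given $s:\{1,\dots,k\}\to\{\text{active},\mathrm A,\mathrm B\}$, reconnect the half-strands at each $x_i$ with $s(i)\in\{\mathrm A,\mathrm B\}$ accordingly, and let the strands pass straight through at active crossings. The result is a family of closed curves (piecewise smooth, possibly touching at smoothed points); let $j(s)$ be its number of components and $c(s)$ the number of active crossings. Let $o$ be a choice of orientation of each component. Operators. Given $(K,s,o)$, over each active $x_i$ there are two strands. Label them $+$ and $-$ so that (tangent of $+$ strand, tangent of $-$ strand) is a positively oriented basis of $\mathbb R^2$, and put $\epsilon_i=+1$ if the $+$ strand is the over-strand and $\epsilon_i=-1$ otherwise. Let $p_i^\pm$ denote the passages of the components through $x_i$ along the $\pm$ strand. Cutting the oriented components at all $p_i^\pm$ ($i$ active) gives oriented arcs (a component with no such passage counts as one closed arc). For each $p=p_i^\pm$ let $\mathrm{in}(p)$, $\mathrm{out}(p)$ be the arcs ending, resp. starting, at $p$. Assign to each arc $\ell$ an independent matrix variable $h_\ell\in M_2(\mathbb C)$; let $\mathcal P$ be the polynomial functions in these variables, and let $W\in\mathcal P$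 be the product over components of $\operatorname{tr}(h_{\ell_1}\cdots h_{\ell_r})$, with $\ell_1,\dots,\ell_r$ the arcs of the component in cyclic order of traversal. Let $\{e_\alpha\}$ be a basis of $\mathfrak{su}(2)\subset M_2(\mathbb C)$ and $g_{\alpha\beta}=\operatorname{Tr}(e_\alpha e_\beta)$ the trace form. Let $\delta_\alpha^{p}$ be the derivation of $\mathcal P$ with $h_{\mathrm{in}(p)}\mapsto\frac12h_{\mathrm{in}(p)}e_\alpha$, $h_{\mathrm{out}(p)}\mapsto\frac12e_\alpha h_{\mathrm{out}(p)}$ (sum of both if these arcs coincide), other variables $\mapsto0$, and $$D_i=2\epsilon_i\sum_{\alpha,\beta}(g^{-1})_{\alpha\beta}\,\delta_\alpha^{p_i^+}\delta_\beta^{p_i^-}.$$ The $D_i$ commute and preserve degree, so their exponentials are defined on $\mathcal P$. Normalized expectation. $$F(K,s,o)(A)=(-1)^{j(s)}\,(\sqrt{ab})^{-c(s)}\Big(\prod_{i\ \mathrm{active}}e^{\beta D_i}\,W\Big)\Big|_{h_\ell=\operatorname{hol}_\ell(A)},$$ where $\operatorname{hol}_\ell(A)\in SU(2)$ is the holonomy of $A$ along the oriented arc $\ell$, holonomies being multiplied left to right in order of traversal. When all crossings are active, $\prod_i e^{\beta D_i}W$ is the expectation of the product of Wilson loops in axial gauge. *)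

theory Defs
  imports "HOL-Analysis.Analysis"
begin

section \<open>Smooth maps and planar orientation\<close>

primrec times_continuously_differentiable ::
    "nat \<Rightarrow> ('a::real_normed_vector \<Rightarrow> 'b::real_normed_vector) \<Rightarrow> bool" where
  "times_continuously_differentiable 0 f \<longleftrightarrow> continuous_on UNIV f"
| "times_continuously_differentiable (Suc n) f \<longleftrightarrow>
     (\<forall>x. f differentiable (at x)) \<and>
     (\<forall>v. times_continuously_differentiable n (\<lambda>x. frechet_derivative f (at x) v))"

definition smooth :: "('a::real_normed_vector \<Rightarrow> 'b::real_normed_vector) \<Rightarrow> bool" where
  "smooth f \<longleftrightarrow> (\<forall>n. times_continuously_differentiable n f)"

text \<open>\<open>(u, v)\<close> is a positively oriented basis of the plane iff \<open>area u v > 0\<close>.\<close>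

definition area :: "real^2 \<Rightarrow> real^2 \<Rightarrow> real" where
  "area u v = u$1 * v$2 - u$2 * v$1"


section \<open>Link diagrams\<close>

text \<open>Closed curves are 1-periodic maps; a passage \<open>(c, t)\<close> with \<open>0 \<le> t < 1\<close> is a point on
  the parameter circle of the \<open>c\<close>-th curve. Crossing \<open>i\<close> is recorded by its two preimages,
  the passage of the over-strand and that of the under-strand. Curves and crossings are
  numbered from 0.\<close>

type_synonym passage = "nat \<times> real"

record link_diagram =
  ncurves :: nat
  curve :: "nat \<Rightarrow> real \<Rightarrow> real^2"
  ncross :: nat
  over :: "nat \<Rightarrow> passage"
  under :: "nat \<Rightarrow> passage"

definition velocity :: "link_diagram \<Rightarrow> passage \<Rightarrow> real^2" where
  "velocity K p = vector_derivative (curve K (fst p)) (at (snd p))"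

definition position :: "link_diagram \<Rightarrow> passage \<Rightarrow> real^2" where
  "position K p = curve K (fst p) (snd p)"

definition points :: "link_diagram \<Rightarrow> passage set" where
  "points K = {..<ncurves K} \<times> {0..<1}"

definition is_link_diagram :: "link_diagram \<Rightarrow> bool" where
  "is_link_diagram K \<longleftrightarrow>
     (\<forall>c<ncurves K. smooth (curve K c) \<and>
        (\<forall>t. curve K c (t + 1) = curve K c t) \<and> (\<forall>t. velocity K (c, t) \<noteq> 0)) \<and>
     (\<forall>i<ncross K. over K i \<in> points K \<and> under K i \<in> points K \<and> over K i \<noteq> under K i \<and>
        position K (over K i) = position K (under K i) \<and>
        area (velocity K (over K i)) (velocity K (under K i)) \<noteq> 0) \<and>
     (\<forall>i<ncross K. \<forall>j<ncross K. i \<noteq> j \<longrightarrow> position K (over K i) \<noteq> position K (over K j)) \<and>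
     (\<forall>p\<in>points K. \<forall>p'\<in>points K. p \<noteq> p' \<and> position K p = position K p' \<longrightarrow>
        (\<exists>i<ncross K. {p, p'} = {over K i, under K i}))"

definition passages :: "link_diagram \<Rightarrow> passage set" where
  "passages K = over K ` {..<ncross K} \<union> under K ` {..<ncross K}"

text \<open>The curves are cut at the passages; a curve without passages is cut at parameter 0,
  where strands always go straight through.\<close>

definition cut_points :: "link_diagram \<Rightarrow> passage set" where
  "cut_points K = passages K \<union>
     {(c, 0) | c. c < ncurves K \<and> (\<forall>p\<in>passages K. fst p \<noteq> c)}"

text \<open>A half-strand \<open>(p, d)\<close> leaves the cut point \<open>p\<close> in the direction of increasing
  (\<open>d = 1\<close>) or decreasing (\<open>d = -1\<close>) parameter. It also stands for the whole edge it
  begins, running to the next cut point and directed away from \<open>p\<close>.\<close>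

type_synonym half_strand = "passage \<times> real"

definition half_strands :: "link_diagram \<Rightarrow> half_strand set" where
  "half_strands K = cut_points K \<times> {1, -1}"

definition tangent :: "link_diagram \<Rightarrow> half_strand \<Rightarrow> real^2" where
  "tangent K x = snd x *\<^sub>R velocity K (fst x)"

definition edge_length :: "link_diagram \<Rightarrow> half_strand \<Rightarrow> real" where
  "edge_length K = (\<lambda>((c, t), d).
     Inf {L. 0 < L \<and> (\<exists>t'. (c, t') \<in> cut_points K \<and> t + d * L - t' \<in> \<int>)})"

text \<open>The half-strand at the other end of the edge, i.e. the same edge reversed.\<close>

definition far_end :: "link_diagram \<Rightarrow> half_strand \<Rightarrow> half_strand" where
  "far_end K = (\<lambda>((c, t), d). ((c, frac (t + d * edge_length K ((c, t), d))), - d))"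


section \<open>Partially smoothed diagrams\<close>

datatype smoothing = Active | SmoothA | SmoothB

text \<open>The over half-strand \<open>x\<close> and the under half-strand \<open>y\<close> bound one of the two regions
  swept by turning the over-strand counterclockwise iff \<open>area (tangent x) (tangent y) > 0\<close>.
  Merging the swept regions (A-smoothing) therefore joins the half-strands bounding each of
  the other two regions.\<close>

definition joined :: "link_diagram \<Rightarrow> (nat \<Rightarrow> smoothing) \<Rightarrow> half_strand \<Rightarrow> half_strand \<Rightarrow> bool" where
  "joined K s x y \<longleftrightarrow>
     (fst x = fst y \<and> snd x = - snd y \<and>
        \<not> (\<exists>i<ncross K. s i \<noteq> Active \<and> fst x \<in> {over K i, under K i})) \<or>
     (\<exists>i<ncross K. \<exists>x' y'. {x, y} = {x', y'} \<and> fst x' = over K i \<and> fst y' = under K i \<and>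
        (s i = SmoothA \<and> area (tangent K x') (tangent K y') < 0 \<or>
         s i = SmoothB \<and> area (tangent K x') (tangent K y') > 0))"

definition partner :: "link_diagram \<Rightarrow> (nat \<Rightarrow> smoothing) \<Rightarrow> half_strand \<Rightarrow> half_strand" where
  "partner K s x = (THE y. y \<in> half_strands K \<and> joined K s x y)"

text \<open>The directed edge that follows the directed edge \<open>x\<close> in the smoothed diagram.\<close>

definition next_edge :: "link_diagram \<Rightarrow> (nat \<Rightarrow> smoothing) \<Rightarrow> half_strand \<Rightarrow> half_strand" where
  "next_edge K s x = partner K s (far_end K x)"

text \<open>A closed curve of the smoothed diagram is given by the set of half-strands lying on it.\<close>

definition components :: "link_diagram \<Rightarrow> (nat \<Rightarrow> smoothing) \<Rightarrow> half_strand set set" where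
  "components K s = half_strands K //
     {(x, y) \<in> half_strands K \<times> half_strands K.
        (x, y) \<in> ({(z, far_end K z) | z. True} \<union> {(z, partner K s z) | z. True})\<^sup>*}"

definition jnum :: "link_diagram \<Rightarrow> (nat \<Rightarrow> smoothing) \<Rightarrow> nat" where
  "jnum K s = card (components K s)"

definition cnum :: "link_diagram \<Rightarrow> (nat \<Rightarrow> smoothing) \<Rightarrow> nat" where
  "cnum K s = card {i. i < ncross K \<and> s i = Active}"

text \<open>An orientation is the set of edges directed along it: every edge gets one of its
  two directions, consistently along each component.\<close>

definition orientation ::
    "link_diagram \<Rightarrow> (nat \<Rightarrow> smoothing) \<Rightarrow> half_strand set \<Rightarrow> bool" where
  "orientation K s D \<longleftrightarrow> D \<subseteq> half_strands K \<and>
     (\<forall>x\<in>half_strands K. x \<in> D \<longleftrightarrow> far_end K x \<notin> D) \<and>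
     (\<forall>x\<in>D. next_edge K s x \<in> D)"


section \<open>Oriented arcs between active passages\<close>

definition active_passages :: "link_diagram \<Rightarrow> (nat \<Rightarrow> smoothing) \<Rightarrow> passage set" where
  "active_passages K s = (\<Union>i\<in>{i. i < ncross K \<and> s i = Active}. {over K i, under K i})"

text \<open>An arc is represented by the set of its directed edges.\<close>

type_synonym arc = "half_strand set"

definition arc_of ::
    "link_diagram \<Rightarrow> (nat \<Rightarrow> smoothing) \<Rightarrow> half_strand set \<Rightarrow> half_strand \<Rightarrow> arc" where
  "arc_of K s D x =
     (let R = {(y, next_edge K s y) | y. y \<in> D \<and> fst (next_edge K s y) \<notin> active_passages K s}
      in {y. (x, y) \<in> (R \<union> R\<inverse>)\<^sup>*})"

definition arcs :: "link_diagram \<Rightarrow> (nat \<Rightarrow> smoothing) \<Rightarrow> half_strand set \<Rightarrow> arc set" where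
  "arcs K s D = arc_of K s D ` D"

definition out_edge :: "half_strand set \<Rightarrow> passage \<Rightarrow> half_strand" where
  "out_edge D p = (THE x. x \<in> D \<and> fst x = p)"

definition out_arc ::
    "link_diagram \<Rightarrow> (nat \<Rightarrow> smoothing) \<Rightarrow> half_strand set \<Rightarrow> passage \<Rightarrow> arc" where
  "out_arc K s D p = arc_of K s D (out_edge D p)"

definition in_arc ::
    "link_diagram \<Rightarrow> (nat \<Rightarrow> smoothing) \<Rightarrow> half_strand set \<Rightarrow> passage \<Rightarrow> arc" where
  "in_arc K s D p = arc_of K s D (THE x. x \<in> D \<and> fst (next_edge K s x) = p)"

definition next_arc ::
    "link_diagram \<Rightarrow> (nat \<Rightarrow> smoothing) \<Rightarrow> half_strand set \<Rightarrow> arc \<Rightarrow> arc" where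
  "next_arc K s D l =
     (if \<exists>p\<in>active_passages K s. in_arc K s D p = l
      then out_arc K s D (THE p. p \<in> active_passages K s \<and> in_arc K s D p = l)
      else l)"

definition plus_passage ::
    "link_diagram \<Rightarrow> half_strand set \<Rightarrow> nat \<Rightarrow> passage" where
  "plus_passage K D i =
     (if area (tangent K (out_edge D (over K i))) (tangent K (out_edge D (under K i))) > 0
      then over K i else under K i)"

definition minus_passage ::
    "link_diagram \<Rightarrow> half_strand set \<Rightarrow> nat \<Rightarrow> passage" where
  "minus_passage K D i =
     (if plus_passage K D i = over K i then under K i else over K i)"

definition crossing_sign :: "link_diagram \<Rightarrow> half_strand set \<Rightarrow> nat \<Rightarrow> complex" where
  "crossing_sign K D i = (if plus_passage K D i = over K i then 1 else -1)"


section \<open>Holonomy\<close>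

definition su2 :: "(complex^2^2) set" where
  "su2 = {X. trace X = 0 \<and> (\<forall>i j. X$j$i = - cnj (X$i$j))}"

text \<open>\<open>A p v\<close> is the value of the one-form at the point \<open>p\<close> on the tangent vector \<open>v\<close>.\<close>

definition is_connection :: "(real^2 \<Rightarrow> real^2 \<Rightarrow> complex^2^2) \<Rightarrow> bool" where
  "is_connection A \<longleftrightarrow>
     (\<forall>p. linear (A p)) \<and> (\<forall>p v. A p v \<in> su2) \<and> (\<forall>v. smooth (\<lambda>p. A p v))"

text \<open>The path-ordered exponential of \<open>A\<close> along \<open>g\<close> on \<open>[0, L]\<close>; with the derivative term
  on the right, later parts of the path contribute factors further to the right.\<close>

definition path_holonomy ::
    "(real^2 \<Rightarrow> real^2 \<Rightarrow> complex^2^2) \<Rightarrow> (real \<Rightarrow> real^2) \<Rightarrow> real \<Rightarrow> complex^2^2" where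
  "path_holonomy A g L = (THE X. \<exists>U. U 0 = mat 1 \<and> U L = X \<and>
     (\<forall>t\<in>{0..L}. (U has_vector_derivative U t ** A (g t) (vector_derivative g (at t)))
        (at t within {0..L})))"

definition edge_holonomy ::
    "link_diagram \<Rightarrow> (real^2 \<Rightarrow> real^2 \<Rightarrow> complex^2^2) \<Rightarrow> half_strand \<Rightarrow> complex^2^2" where
  "edge_holonomy K A = (\<lambda>((c, t), d).
     path_holonomy A (\<lambda>\<tau>. curve K c (t + d * \<tau>)) (edge_length K ((c, t), d)))"

primrec ordered_prod :: "(nat \<Rightarrow> complex^2^2) \<Rightarrow> nat \<Rightarrow> complex^2^2" where
  "ordered_prod f 0 = mat 1"
| "ordered_prod f (Suc n) = ordered_prod f n ** f n"

text \<open>Only for a closed arc (a component without active passage) is the initial edge a choice;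
  only the trace of its holonomy is used below.\<close>

definition first_edge :: "link_diagram \<Rightarrow> (nat \<Rightarrow> smoothing) \<Rightarrow> arc \<Rightarrow> half_strand" where
  "first_edge K s l = (SOME x. x \<in> l \<and>
     ((\<exists>y\<in>l. fst y \<in> active_passages K s) \<longrightarrow> fst x \<in> active_passages K s))"

definition arc_holonomy ::
    "link_diagram \<Rightarrow> (nat \<Rightarrow> smoothing) \<Rightarrow> (real^2 \<Rightarrow> real^2 \<Rightarrow> complex^2^2) \<Rightarrow> arc \<Rightarrow> complex^2^2" where
  "arc_holonomy K s A l =
     ordered_prod (\<lambda>m. edge_holonomy K A ((next_edge K s ^^ m) (first_edge K s l))) (card l)"


section \<open>Polynomial functions and derivations\<close>

inductive_set polyfun :: "'l set \<Rightarrow> (('l \<Rightarrow> complex^2^2) \<Rightarrow> complex) set"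
  for S :: "'l set" where
  const: "(\<lambda>h. c) \<in> polyfun S"
| var: "l \<in> S \<Longrightarrow> (\<lambda>h. h l $ i $ j) \<in> polyfun S"
| add: "f \<in> polyfun S \<Longrightarrow> g \<in> polyfun S \<Longrightarrow> (\<lambda>h. f h + g h) \<in> polyfun S"
| mult: "f \<in> polyfun S \<Longrightarrow> g \<in> polyfun S \<Longrightarrow> (\<lambda>h. f h * g h) \<in> polyfun S"

definition derivation_on ::
    "('h \<Rightarrow> complex) set \<Rightarrow> (('h \<Rightarrow> complex) \<Rightarrow> ('h \<Rightarrow> complex)) \<Rightarrow> bool" where
  "derivation_on P \<delta> \<longleftrightarrow>
     (\<forall>f\<in>P. \<delta> f \<in> P) \<and>
     (\<forall>f\<in>P. \<forall>g\<in>P. \<delta> (\<lambda>h. f h + g h) = (\<lambda>h. \<delta> f h + \<delta> g h)) \<and>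
     (\<forall>f\<in>P. \<forall>c. \<delta> (\<lambda>h. c * f h) = (\<lambda>h. c * \<delta> f h)) \<and>
     (\<forall>f\<in>P. \<forall>g\<in>P. \<delta> (\<lambda>h. f h * g h) = (\<lambda>h. \<delta> f h * g h + f h * \<delta> g h))"

definition has_values ::
    "'l set \<Rightarrow> ('l \<Rightarrow> ('l \<Rightarrow> complex^2^2) \<Rightarrow> complex^2^2) \<Rightarrow>
     ((('l \<Rightarrow> complex^2^2) \<Rightarrow> complex) \<Rightarrow> (('l \<Rightarrow> complex^2^2) \<Rightarrow> complex)) \<Rightarrow> bool" where
  "has_values S V \<delta> \<longleftrightarrow>
     (\<forall>l\<in>S. \<forall>i j. \<delta> (\<lambda>h. h l $ i $ j) = (\<lambda>h. V l h $ i $ j))"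

text \<open>The derivation of \<open>polyfun S\<close> mapping each matrix variable \<open>h l\<close> to \<open>V l h\<close>. It exists
  and is unique on \<open>polyfun S\<close>, see \<open>derivation_exists\<close> and \<open>derivation_unique\<close>.\<close>

definition derivation_with_values ::
    "'l set \<Rightarrow> ('l \<Rightarrow> ('l \<Rightarrow> complex^2^2) \<Rightarrow> complex^2^2) \<Rightarrow>
     (('l \<Rightarrow> complex^2^2) \<Rightarrow> complex) \<Rightarrow> (('l \<Rightarrow> complex^2^2) \<Rightarrow> complex)" where
  "derivation_with_values S V = (SOME \<delta>. derivation_on (polyfun S) \<delta> \<and> has_values S V \<delta>)"

lemma derivation_unique:
  assumes d: "derivation_on (polyfun S) \<delta>" "has_values S V \<delta>"
    and d': "derivation_on (polyfun S) \<delta>'" "has_values S V \<delta>'"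
    and f: "f \<in> polyfun S"
  shows "\<delta> f = \<delta>' f"
proof -
  have zero: "\<theta> (\<lambda>h. c) = (\<lambda>h. 0)" if \<theta>: "derivation_on (polyfun S) \<theta>" for \<theta> c
  proof -
    have 1: "(\<lambda>h::'a \<Rightarrow> complex^2^2. 1) \<in> polyfun S" by (rule polyfun.const)
    have sq: "\<theta> (\<lambda>h. 1 * 1) = (\<lambda>h. \<theta> (\<lambda>h. 1) h * 1 + 1 * \<theta> (\<lambda>h. 1) h)"
      using bspec[OF bspec[OF conjunct2[OF conjunct2[OF conjunct2[OF \<theta>[unfolded derivation_on_def]]]] 1] 1] .
    have one: "\<theta> (\<lambda>h. 1) = (\<lambda>h. 0)"
      using sq by (auto simp: fun_eq_iff)
    have "\<theta> (\<lambda>h. c * 1) = (\<lambda>h. c * \<theta> (\<lambda>h. 1) h)"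
      using spec[OF bspec[OF conjunct1[OF conjunct2[OF conjunct2[OF \<theta>[unfolded derivation_on_def]]]] 1], of c] .
    then show ?thesis using one by simp
  qed
  show ?thesis
    using f
  proof induction
    case (const c)
    then show ?case using zero d d' by simp
  next
    case (var l i j)
    then show ?case using d d' unfolding has_values_def by simp
  next
    case (add f g)
    then show ?case using d d' unfolding derivation_on_def by simp
  next
    case (mult f g)
    then show ?case using d d' unfolding derivation_on_def by simp
  qed
qed

lemma derivation_exists:
  assumes V: "\<And>l i j. l \<in> S \<Longrightarrow> (\<lambda>h. V l h $ i $ j) \<in> polyfun S"
  shows "\<exists>\<delta>. derivation_on (polyfun S) \<delta> \<and> has_values S V \<delta>"
proof -
  define line where "line h z = (\<lambda>l. \<chi> i j. h l $ i $ j + z * V l h $ i $ j)" for h and z :: complex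
  have line0: "line h 0 = h" for h by (simp add: line_def vec_eq_iff fun_eq_iff)
  define \<delta> where "\<delta> f h = deriv (\<lambda>z. f (line h z)) 0" for f h
  have ex: "\<exists>g\<in>polyfun S. \<forall>h. ((\<lambda>z. f (line h z)) has_field_derivative g h) (at 0)"
    if "f \<in> polyfun S" for f
    using that
  proof induction
    case (const c)
    then show ?case by (intro bexI[of _ "\<lambda>h. 0"] polyfun.const) auto
  next
    case (var l i j)
    then show ?case
      by (intro bexI[OF _ V[OF var]]) (auto simp: line_def intro!: derivative_eq_intros)
  next
    case (add f g)
    then obtain f' g' where f': "f' \<in> polyfun S" "\<And>h. ((\<lambda>z. f (line h z)) has_field_derivative f' h) (at 0)"
      and g': "g' \<in> polyfun S" "\<And>h. ((\<lambda>z. g (line h z)) has_field_derivative g' h) (at 0)" by blast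
    show ?case
      by (rule bexI[OF _ polyfun.add[OF f'(1) g'(1)]]) (auto intro!: DERIV_add f'(2) g'(2))
  next
    case (mult f g)
    then obtain f' g' where f': "f' \<in> polyfun S" "\<And>h. ((\<lambda>z. f (line h z)) has_field_derivative f' h) (at 0)"
      and g': "g' \<in> polyfun S" "\<And>h. ((\<lambda>z. g (line h z)) has_field_derivative g' h) (at 0)" by blast
    have "((\<lambda>z. f (line h z) * g (line h z)) has_field_derivative f' h * g h + g' h * f h) (at 0)" for h
      using DERIV_mult[OF f'(2)[of h] g'(2)[of h]] by (simp add: line0)
    then show ?case
      by (intro bexI[of _ "\<lambda>h. f' h * g h + g' h * f h"] polyfun.add polyfun.mult f'(1) g'(1) mult(1,2)) auto
  qed
  have D: "((\<lambda>z. f (line h z)) has_field_derivative \<delta> f h) (at 0)" if f: "f \<in> polyfun S" for f h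
  proof -
    obtain g where "((\<lambda>z. f (line h z)) has_field_derivative g h) (at 0)" using ex[OF f] by blast
    then show ?thesis unfolding \<delta>_def by (metis DERIV_imp_deriv)
  qed
  have closed: "\<delta> f \<in> polyfun S" if f: "f \<in> polyfun S" for f
  proof -
    obtain g where g: "g \<in> polyfun S" "\<And>h. ((\<lambda>z. f (line h z)) has_field_derivative g h) (at 0)"
      using ex[OF f] by blast
    have "\<delta> f = g" unfolding \<delta>_def using g(2) by (auto simp: fun_eq_iff intro: DERIV_imp_deriv)
    then show ?thesis using g(1) by simp
  qed
  have "\<delta> (\<lambda>h. f h + g h) = (\<lambda>h. \<delta> f h + \<delta> g h)" if "f \<in> polyfun S" "g \<in> polyfun S" for f g
  proof
    fix h show "\<delta> (\<lambda>h. f h + g h) h = \<delta> f h + \<delta> g h"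
      unfolding \<delta>_def[of "\<lambda>h. f h + g h"]
      by (rule DERIV_imp_deriv, rule DERIV_add[OF D[OF that(1)] D[OF that(2)]])
  qed
  moreover have "\<delta> (\<lambda>h. c * f h) = (\<lambda>h. c * \<delta> f h)" if "f \<in> polyfun S" for f c
  proof
    fix h show "\<delta> (\<lambda>h. c * f h) h = c * \<delta> f h"
      unfolding \<delta>_def[of "\<lambda>h. c * f h"]
      by (rule DERIV_imp_deriv, rule DERIV_cmult[OF D[OF that]])
  qed
  moreover have "\<delta> (\<lambda>h. f h * g h) = (\<lambda>h. \<delta> f h * g h + f h * \<delta> g h)"
    if "f \<in> polyfun S" "g \<in> polyfun S" for f g
  proof
    fix h
    have "deriv (\<lambda>z. f (line h z) * g (line h z)) 0
        = \<delta> f h * g (line h 0) + \<delta> g h * f (line h 0)"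
      by (rule DERIV_imp_deriv, rule DERIV_mult[OF D[OF that(1)] D[OF that(2)]])
    then show "\<delta> (\<lambda>h. f h * g h) h = \<delta> f h * g h + f h * \<delta> g h"
      unfolding \<delta>_def[of "\<lambda>h. f h * g h"] by (simp add: line0)
  qed
  moreover have "\<delta> (\<lambda>h. h l $ i $ j) = (\<lambda>h. V l h $ i $ j)" for l i j
  proof
    fix h
    have "((\<lambda>z. line h z l $ i $ j) has_field_derivative V l h $ i $ j) (at 0)"
      by (auto simp: line_def intro!: derivative_eq_intros)
    then show "\<delta> (\<lambda>h. h l $ i $ j) h = V l h $ i $ j"
      unfolding \<delta>_def by (rule DERIV_imp_deriv)
  qed
  ultimately have "derivation_on (polyfun S) \<delta>" "has_values S V \<delta>"
    using closed unfolding derivation_on_def has_values_def by blast+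
  then show ?thesis by blast
qed


section \<open>The normalized expectation\<close>

definition wilson ::
    "link_diagram \<Rightarrow> (nat \<Rightarrow> smoothing) \<Rightarrow> half_strand set \<Rightarrow> (arc \<Rightarrow> complex^2^2) \<Rightarrow> complex" where
  "wilson K s D h = (\<Prod>C\<in>components K s.
     let Ls = {l \<in> arcs K s D. l \<subseteq> C}
     in trace (ordered_prod (\<lambda>m. h ((next_arc K s D ^^ m) (SOME l. l \<in> Ls))) (card Ls)))"

text \<open>The derivation attached to the passage \<open>p\<close> and \<open>X = e\<^sub>\<alpha>\<close>.\<close>

definition insertion ::
    "link_diagram \<Rightarrow> (nat \<Rightarrow> smoothing) \<Rightarrow> half_strand set \<Rightarrow> passage \<Rightarrow> complex^2^2 \<Rightarrow>
     ((arc \<Rightarrow> complex^2^2) \<Rightarrow> complex) \<Rightarrow> ((arc \<Rightarrow> complex^2^2) \<Rightarrow> complex)" where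
  "insertion K s D p X = derivation_with_values (arcs K s D)
     (\<lambda>l h. (if l = in_arc K s D p then (1/2) *\<^sub>R (h l ** X) else 0) +
            (if l = out_arc K s D p then (1/2) *\<^sub>R (X ** h l) else 0))"

definition is_su2_basis :: "('n::finite \<Rightarrow> complex^2^2) \<Rightarrow> bool" where
  "is_su2_basis e \<longleftrightarrow> inj e \<and> independent (range e) \<and> span (range e) = su2"

definition trace_form :: "('n::finite \<Rightarrow> complex^2^2) \<Rightarrow> complex^'n^'n" where
  "trace_form e = (\<chi> \<alpha> \<beta>. trace (e \<alpha> ** e \<beta>))"

definition crossing_operator ::
    "('n::finite \<Rightarrow> complex^2^2) \<Rightarrow> link_diagram \<Rightarrow> (nat \<Rightarrow> smoothing) \<Rightarrow> half_strand set \<Rightarrow> nat \<Rightarrow>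
     ((arc \<Rightarrow> complex^2^2) \<Rightarrow> complex) \<Rightarrow> ((arc \<Rightarrow> complex^2^2) \<Rightarrow> complex)" where
  "crossing_operator e K s D i f = (\<lambda>h. 2 * crossing_sign K D i *
     (\<Sum>\<alpha>\<in>UNIV. \<Sum>\<beta>\<in>UNIV. matrix_inv (trace_form e) $ \<alpha> $ \<beta> *
        insertion K s D (plus_passage K D i) (e \<alpha>)
          (insertion K s D (minus_passage K D i) (e \<beta>) f) h))"

definition exp_operator ::
    "complex \<Rightarrow> (('h \<Rightarrow> complex) \<Rightarrow> ('h \<Rightarrow> complex)) \<Rightarrow> ('h \<Rightarrow> complex) \<Rightarrow> ('h \<Rightarrow> complex)" where
  "exp_operator \<beta> T f = (\<lambda>h. \<Sum>n. \<beta> ^ n / fact n * (T ^^ n) f h)"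

text \<open>The operators commute, so the order in which the exponentials are applied is immaterial.\<close>

definition expectation ::
    "complex \<Rightarrow> ('n::finite \<Rightarrow> complex^2^2) \<Rightarrow> link_diagram \<Rightarrow> (nat \<Rightarrow> smoothing) \<Rightarrow>
     half_strand set \<Rightarrow> (arc \<Rightarrow> complex^2^2) \<Rightarrow> complex" where
  "expectation \<beta> e K s D =
     foldr (\<lambda>i. exp_operator \<beta> (crossing_operator e K s D i))
       (filter (\<lambda>i. s i = Active) [0..<ncross K]) (wilson K s D)"

text \<open>\<open>r\<close> is the chosen square root of \<open>a b\<close>.\<close>

definition normalized_expectation ::
    "complex \<Rightarrow> complex \<Rightarrow> ('n::finite \<Rightarrow> complex^2^2) \<Rightarrow> link_diagram \<Rightarrow> (nat \<Rightarrow> smoothing) \<Rightarrow>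
     half_strand set \<Rightarrow> (real^2 \<Rightarrow> real^2 \<Rightarrow> complex^2^2) \<Rightarrow> complex" where
  "normalized_expectation \<beta> r e K s D A =
     (-1) ^ jnum K s * inverse (r ^ cnum K s) * expectation \<beta> e K s D (arc_holonomy K s A)"

text \<open>The common value of the normalized expectation for all orientations.\<close>

definition bracket ::
    "complex \<Rightarrow> complex \<Rightarrow> ('n::finite \<Rightarrow> complex^2^2) \<Rightarrow> link_diagram \<Rightarrow> (nat \<Rightarrow> smoothing) \<Rightarrow>
     (real^2 \<Rightarrow> real^2 \<Rightarrow> complex^2^2) \<Rightarrow> complex" where
  "bracket \<beta> r e K s A =
     (THE z. \<exists>D. orientation K s D \<and> z = normalized_expectation \<beta> r e K s D A)"

end

(* A crossing operator D with sign \<epsilon> acts on the 2x2 matrices inserted at the two passages of its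
   crossing. Starting from the identity, its square is multiplication by 3, so its exponential is
   cosh + sinh / sqrt 3 * D, and by the Fierz identity for the Casimir element D itself reconnects the two
   strands along their orientations. Cayley-Hamilton, tr(XY) + tr(X adj Y) = tr X * tr Y, expresses the
   crossed strands by the two planar reconnections. With the sign (-1)^j included, the exponential of
   every active crossing becomes a * (A-smoothing) + b * (B-smoothing). Hence the expectation is a state sum
   over all smoothings of the active crossings, which does not mention the orientation and satisfies
   the skein relation term by term.

   The diagram enters only through two perfect matchings of its half-strands: "far end of the edge" and
   "joined at the cut point". Removing a matched pair by fusing the two edges that meet there does not
   change the value of a state, so every local identity reduces to the four half-strands at one crossing. *)

theory Submission
  imports Defs
begin

section \<open>Two-by-two matrices\<close>

text \<open>At a crossing, let V0, V1, V2 be the values, sign (-1)^j included, of the three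
  matchings of its four ends: straight through, compatible with the orientation, against it. Then V0
  + V1 + V2 = 0, and the Casimir insertion has the value - V1 - V0 / 2. Eliminating V0 from y * V0 +
  x * (- V1 - V0 / 2) leaves the weights - y - x / 2 and - y + x / 2; for y = cosh and x = 2 * sign
  * sinh / sqrt 3 these are a and b. Which smoothing is the compatible one depends on the sign of
  the crossing, and so does x: the two dependences cancel. The number 3 is the dimension of su(2): a
  second application of the operator produces anticommutators of basis elements, which are scalars,
  and the contraction counts the basis. This requires identity matrices at both passages beforehand.
  Since each crossing leaves basis elements behind, the induction over the crossings runs over
  Wilson loops with a matrix X p inserted at every passage p. Such matrices need not have
  determinant one; hence the adjugate, here \<open>mat (trace M) - M\<close> by Cayley-Hamilton,
  replaces the inverse when a strand is reversed.\<close>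

definition adjugate :: "complex^2^2 \<Rightarrow> complex^2^2" where
  "adjugate M = mat (trace M) - M"

lemmas matrix2_expand = vec_eq_iff forall_2 matrix_matrix_mult_def sum_2 trace_def mat_def

lemma adjugate_mult: "adjugate (M ** N) = adjugate N ** adjugate M"
  by (simp add: adjugate_def matrix2_expand algebra_simps)

lemma adjugate_adjugate [simp]: "adjugate (adjugate M) = M"
  by (simp add: adjugate_def matrix2_expand)

lemma trace_adjugate [simp]: "trace (adjugate M) = trace M"
  by (simp add: adjugate_def matrix2_expand)

lemma adjugate_mat [simp]: "adjugate (mat c) = mat c"
  by (simp add: adjugate_def matrix2_expand)

lemma adjugate_traceless: "trace M = 0 \<Longrightarrow> adjugate M = - M"
  by (simp add: adjugate_def matrix2_expand)

lemma adjugate_inverse_comm: "M ** adjugate M = mat 1 \<Longrightarrow> adjugate M ** M = mat 1"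
  by (simp add: adjugate_def matrix2_expand algebra_simps)

lemma adjugate_add: "adjugate (M + N) = adjugate M + adjugate N"
  by (simp add: adjugate_def matrix2_expand algebra_simps)

text \<open>Polarised Cayley-Hamilton. Read as a statement about strands, it makes the three ways of
  matching four ends linearly dependent.\<close>

lemma trace_mult_adjugate: "trace (M ** adjugate N) = trace M * trace N - trace (M ** N)"
  by (simp add: adjugate_def matrix2_expand algebra_simps)

lemma trace_adjugate_mult: "trace (adjugate M ** N) = trace M * trace N - trace (M ** N)"
  by (simp add: adjugate_def matrix2_expand algebra_simps)

lemma trace_mult_commute: "trace (M ** N) = trace (N ** (M :: complex^2^2))"
  by (rule trace_mul_sym)

lemma trace_mat2 [simp]: "trace (mat c :: complex^2^2) = 2 * c"
  by (simp add: matrix2_expand)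

lemma trace_zero2 [simp]: "trace (0 :: complex^2^2) = 0"
  by (simp add: trace_def)

lemma trace_mat_mult: "trace (mat c ** M) = c * trace (M :: complex^2^2)"
  by (simp add: matrix2_expand algebra_simps)

lemma ordered_prod_front: "ordered_prod g (Suc n) = g 0 ** ordered_prod (\<lambda>m. g (Suc m)) n"
  by (induction n) (simp_all add: matrix_mul_assoc)

lemma ordered_prod_cong: "(\<And>m. m < n \<Longrightarrow> g m = g' m) \<Longrightarrow> ordered_prod g n = ordered_prod g' n"
  by (induction n) simp_all

lemma ordered_prod_append:
  "ordered_prod g (m + n) = ordered_prod g m ** ordered_prod (\<lambda>k. g (m + k)) n"
  by (induction n) (simp_all add: matrix_mul_assoc)

text \<open>The adjugate reverses products, so reading the factors backwards, each replaced by its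
  adjugate, is traversal in the opposite direction.\<close>

lemma ordered_prod_adjugate:
  "ordered_prod (\<lambda>m. adjugate (g (n - Suc m))) n = adjugate (ordered_prod g n)"
proof (induction n)
  case (Suc n)
  have "ordered_prod (\<lambda>m. adjugate (g (Suc n - Suc m))) (Suc n)
      = adjugate (g n) ** ordered_prod (\<lambda>m. adjugate (g (n - Suc m))) n"
    by (subst ordered_prod_front) simp
  then show ?case using Suc by (simp add: adjugate_mult)
qed simp

text \<open>Cyclicity of the trace; \<open>g n = g 0\<close> says that the sequence of factors
  closes up after n steps.\<close>

lemma trace_ordered_prod_rotate:
  assumes "g n = g 0"
  shows "trace (ordered_prod (\<lambda>m. g (Suc m)) n) = trace (ordered_prod g n)"
proof (cases n)
  case (Suc k)
  have "trace (ordered_prod (\<lambda>m. g (Suc m)) n) = trace (g n ** ordered_prod (\<lambda>m. g (Suc m)) k)"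
    unfolding Suc by (simp add: trace_mult_commute)
  also have "\<dots> = trace (ordered_prod g n)"
    unfolding assms unfolding Suc by (subst ordered_prod_front) (rule refl)
  finally show ?thesis .
qed simp

subsection \<open>The Casimir element of a basis of su(2)\<close>

lemma su2_trace: "X \<in> su2 \<Longrightarrow> trace X = 0"
  by (simp add: su2_def)

lemma su2_expand:
  assumes "X \<in> su2"
  shows "X $ 2 $ 2 = - X $ 1 $ 1" "X $ 2 $ 1 = - cnj (X $ 1 $ 2)" "Re (X $ 1 $ 1) = 0"
proof -
  have tr: "trace X = 0" and h: "\<And>i j. X $ j $ i = - cnj (X $ i $ j)"
    using assms unfolding su2_def by blast+
  from tr have d: "X $ 1 $ 1 + X $ 2 $ 2 = 0" by (simp add: trace_def sum_2)
  show "X $ 2 $ 2 = - X $ 1 $ 1" using d by (simp only: add_eq_0_iff)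
  show "X $ 2 $ 1 = - cnj (X $ 1 $ 2)" by (rule h)
  show "Re (X $ 1 $ 1) = 0" using arg_cong[OF h[of 1 1], of Re] by simp
qed

text \<open>The trace form is negative definite on su(2), which is the source of its
  nondegeneracy.\<close>

lemma trace_square_su2:
  assumes "X \<in> su2"
  shows "trace (X ** X) = - 2 * of_real ((cmod (X $ 1 $ 1))\<^sup>2 + (cmod (X $ 1 $ 2))\<^sup>2)"
proof -
  note su2_expand[OF assms]
  then show ?thesis
    unfolding cmod_power2
    by (simp add: trace_def sum_2 matrix_matrix_mult_def complex_eq_iff algebra_simps power2_eq_square)
qed

lemma su2_eq_0:
  assumes "X \<in> su2" "trace (X ** X) = 0"
  shows "X = 0"
proof -
  have "(cmod (X $ 1 $ 1))\<^sup>2 + (cmod (X $ 1 $ 2))\<^sup>2 = 0"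
    using assms(2) unfolding trace_square_su2[OF assms(1)] by (metis mult_eq_0_iff neg_equal_0_iff_equal of_real_eq_0_iff zero_neq_numeral)
  then have "X $ 1 $ 1 = 0" "X $ 1 $ 2 = 0"
    by (auto simp: sum_power2_eq_zero_iff)
  then show ?thesis using su2_expand[OF assms(1)] by (simp add: vec_eq_iff forall_2)
qed

text \<open>Polarisation of X^2 = - det X for traceless X. Because of it a second insertion at the
  same passage becomes a scalar.\<close>

lemma traceless_anticommutator:
  assumes "trace X = 0" "trace Y = 0"
  shows "X ** Y + Y ** X = mat (trace (X ** (Y :: complex^2^2)))"
proof -
  have "X $ 2 $ 2 = - X $ 1 $ 1" "Y $ 2 $ 2 = - Y $ 1 $ 1"
    using assms by (simp_all only: trace_def sum_2 add_eq_0_iff)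
  then show ?thesis by (simp add: matrix2_expand algebra_simps)
qed

text \<open>A real Gram matrix allows the real and imaginary parts of a complex kernel vector to be
  treated separately.\<close>

lemma su2_trace_real:
  assumes "X \<in> su2" "Y \<in> su2"
  shows "trace (X ** Y) \<in> \<real>"
proof -
  note su2_expand[OF assms(1)] su2_expand[OF assms(2)]
  then show ?thesis
    by (simp add: trace_def sum_2 matrix_matrix_mult_def complex_is_Real_iff algebra_simps)
qed

locale su2_basis =
  fixes e :: "'n::finite \<Rightarrow> complex^2^2"
  assumes basis: "is_su2_basis e"
begin

abbreviation g :: "'n \<Rightarrow> 'n \<Rightarrow> complex" where "g \<alpha> \<beta> \<equiv> trace (e \<alpha> ** e \<beta>)"
abbreviation G :: "'n \<Rightarrow> 'n \<Rightarrow> complex" where "G \<alpha> \<beta> \<equiv> matrix_inv (trace_form e) $ \<alpha> $ \<beta>"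

lemma e_su2: "e \<alpha> \<in> su2"
  using basis span_superset[of "range e"] unfolding is_su2_basis_def by blast

lemma trace_e: "trace (e \<alpha>) = 0"
  by (rule su2_trace[OF e_su2])

lemma su2_subspace: "subspace su2"
  using basis unfolding is_su2_basis_def by (metis subspace_span)

lemma trace_sum_mult: "trace (X ** (\<Sum>\<alpha>\<in>S. Y \<alpha>)) = (\<Sum>\<alpha>\<in>S. trace (X ** (Y \<alpha> :: complex^2^2)))"
  by (induction S rule: infinite_finite_induct)
     (simp_all add: trace_add matrix_add_ldistrib)

lemma real_comb:
  assumes "M \<in> su2"
  obtains m :: "'n \<Rightarrow> real" where "M = (\<Sum>\<alpha>\<in>UNIV. m \<alpha> *\<^sub>R e \<alpha>)"
proof -
  have inj: "inj e" using basis by (simp add: is_su2_basis_def)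
  have "M \<in> span (range e)" using basis assms by (simp add: is_su2_basis_def)
  then obtain u where "M = (\<Sum>v\<in>range e. u v *\<^sub>R v)"
    by (auto simp: span_finite)
  also have "\<dots> = (\<Sum>\<alpha>\<in>UNIV. u (e \<alpha>) *\<^sub>R e \<alpha>)"
    by (simp add: sum.reindex[OF inj])
  finally show ?thesis using that[of "u \<circ> e"] by simp
qed

lemma real_indep:
  assumes "(\<Sum>\<alpha>\<in>UNIV. m \<alpha> *\<^sub>R e \<alpha>) = 0"
  shows "m \<alpha> = 0"
proof -
  have inj: "inj e" and ind: "independent (range e)" using basis by (simp_all add: is_su2_basis_def)
  have "(\<Sum>v\<in>range e. m (inv e v) *\<^sub>R v) = 0"
    using assms by (simp add: sum.reindex[OF inj] inj)
  then have "m (inv e (e \<alpha>)) = 0"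
    using ind independentD[of "range e" "range e" "\<lambda>v. m (inv e v)" "e \<alpha>"] by auto
  then show ?thesis by (simp add: inj)
qed

text \<open>A real kernel vector is the coordinate vector of an element Y of su(2) orthogonal to the
  whole basis. Then \<open>trace (Y ** Y) = 0\<close>, and definiteness gives Y = 0.\<close>

lemma real_kernel:
  assumes "\<And>\<alpha>. (\<Sum>\<beta>\<in>UNIV. g \<alpha> \<beta> * of_real (v \<beta>)) = 0"
  shows "v \<beta> = 0"
proof -
  define Y where "Y = (\<Sum>\<beta>\<in>UNIV. v \<beta> *\<^sub>R e \<beta>)"
  have Y: "Y \<in> su2" unfolding Y_def
    by (intro subspace_sum subspace_scale su2_subspace e_su2)
  have sc: "trace (X ** (c *\<^sub>R Z)) = of_real c * trace (X ** Z)" for X Z :: "complex^2^2" and c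
    by (simp only: trace_def sum_2 matrix_matrix_mult_def vec_lambda_beta vector_scaleR_component)
      (simp add: scaleR_conv_of_real algebra_simps)
  have e0: "trace (e \<alpha> ** Y) = 0" for \<alpha>
    using assms[of \<alpha>] unfolding Y_def trace_sum_mult sc by (simp add: mult.commute)
  have "trace (Y ** Y) = trace (Y ** (\<Sum>\<beta>\<in>UNIV. v \<beta> *\<^sub>R e \<beta>))" by (simp add: Y_def)
  also have "\<dots> = 0" unfolding trace_sum_mult sc using e0 by (simp add: trace_mult_commute[of Y])
  finally have "Y = 0" by (rule su2_eq_0[OF Y])
  then show ?thesis unfolding Y_def by (rule real_indep)
qed

text \<open>Definiteness concerns real combinations only; as the Gram matrix is real, a complex
  kernel vector splits into two real ones.\<close>

lemma trace_form_invertible: "invertible (trace_form e)"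
proof -
  have "x = 0" if x: "trace_form e *v x = 0" for x
  proof -
    have row: "(\<Sum>\<beta>\<in>UNIV. g \<alpha> \<beta> * x $ \<beta>) = 0" for \<alpha>
      using x by (simp add: vec_eq_iff matrix_vector_mult_def trace_form_def)
    have gR: "Im (g \<alpha> \<beta>) = 0" for \<alpha> \<beta>
      using su2_trace_real[OF e_su2 e_su2] by (simp add: complex_is_Real_iff)
    have "(\<Sum>\<beta>\<in>UNIV. g \<alpha> \<beta> * of_real (Re (x $ \<beta>))) = 0" for \<alpha>
      using arg_cong[OF row[of \<alpha>], of Re] by (simp add: complex_eq_iff gR)
    then have 1: "Re (x $ \<beta>) = 0" for \<beta> by (rule real_kernel)
    have "(\<Sum>\<beta>\<in>UNIV. g \<alpha> \<beta> * of_real (Im (x $ \<beta>))) = 0" for \<alpha>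
      using arg_cong[OF row[of \<alpha>], of Im] by (simp add: complex_eq_iff gR)
    then have "Im (x $ \<beta>) = 0" for \<beta> by (rule real_kernel)
    with 1 show ?thesis by (simp add: vec_eq_iff complex_eq_iff)
  qed
  then show ?thesis
    by (simp add: invertible_left_inverse matrix_left_invertible_ker)
qed

lemma G_left: "(\<Sum>\<beta>\<in>UNIV. G \<alpha> \<beta> * g \<beta> \<gamma>) = (if \<alpha> = \<gamma> then 1 else 0)"
proof -
  have "matrix_inv (trace_form e) ** trace_form e = mat 1"
    using trace_form_invertible unfolding invertible_def matrix_inv_def by (rule someI2_ex) simp
  then show ?thesis
    by (simp add: vec_eq_iff matrix_matrix_mult_def mat_def trace_form_def)
qed

lemma G_right: "(\<Sum>\<beta>\<in>UNIV. g \<alpha> \<beta> * G \<beta> \<gamma>) = (if \<alpha> = \<gamma> then 1 else 0)"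
proof -
  have "trace_form e ** matrix_inv (trace_form e) = mat 1"
    using trace_form_invertible unfolding invertible_def matrix_inv_def by (rule someI2_ex) simp
  then show ?thesis
    by (simp add: vec_eq_iff matrix_matrix_mult_def mat_def trace_form_def)
qed

text \<open>Expansion of M in the identity and the basis e, with coefficients read off by the dual
  basis. The claim is complex linear in M, so it suffices to treat the identity and the elements of
  su(2), which together span all matrices over the complex numbers.\<close>

lemma completeness:
  "M $ i $ j = trace M / 2 * (if i = j then 1 else 0)
     + (\<Sum>\<alpha>\<in>UNIV. \<Sum>\<beta>\<in>UNIV. G \<alpha> \<beta> * trace (M ** e \<alpha>) * e \<beta> $ i $ j)" (is "?P M")
proof -
  \<comment> \<open>Complex scalars act as \<open>mat c **\<close>, since \<open>*\<^sub>R\<close>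
    on matrices only takes real ones.\<close>
  have lin: "?P (mat c ** M + mat d ** N)" if M: "?P M" and N: "?P N" for c d M N
  proof -
    have t: "trace ((mat c ** M + mat d ** N) ** X) = c * trace (M ** X) + d * trace (N ** X)"
      for X :: "complex^2^2"
      by (simp add: matrix2_expand algebra_simps)
    have "(mat c ** M + mat d ** N) $ i $ j = c * M $ i $ j + d * N $ i $ j"
      using exhaust_2[of i] by (auto simp: matrix2_expand)
    then show ?thesis
      unfolding t by (subst (asm) M, subst (asm) N)
        (simp add: trace_add trace_mat_mult algebra_simps sum.distrib sum_distrib_left add_divide_distrib)
  qed
  have e: "?P (e \<gamma>)" for \<gamma>
  proof -
    have "(\<Sum>\<alpha>\<in>UNIV. \<Sum>\<beta>\<in>UNIV. G \<alpha> \<beta> * g \<gamma> \<alpha> * e \<beta> $ i $ j)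
        = (\<Sum>\<beta>\<in>UNIV. (\<Sum>\<alpha>\<in>UNIV. g \<gamma> \<alpha> * G \<alpha> \<beta>) * e \<beta> $ i $ j)"
      by (subst sum.swap) (simp add: sum_distrib_left mult_ac)
    also have "\<dots> = e \<gamma> $ i $ j" by (simp add: G_right if_distrib [where f = "\<lambda>x. x * _"] cong: if_cong)
    finally show ?thesis by (simp add: trace_e)
  qed
  have su2: "?P X" if "X \<in> su2" for X
  proof -
    from that obtain m where X: "X = (\<Sum>\<alpha>\<in>UNIV. m \<alpha> *\<^sub>R e \<alpha>)" by (rule real_comb)
    have z: "?P 0" by (simp add: trace_zero2)
    have "?P (\<Sum>\<alpha>\<in>S. m \<alpha> *\<^sub>R e \<alpha>)" if "finite S" for S
      using that
    proof induction
      case empty then show ?case using z by simp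
    next
      case (insert \<gamma> S)
      have eq: "(m \<gamma>) *\<^sub>R e \<gamma> + (\<Sum>\<alpha>\<in>S. m \<alpha> *\<^sub>R e \<alpha>) = mat (of_real (m \<gamma>)) ** e \<gamma> + mat 1 ** (\<Sum>\<alpha>\<in>S. m \<alpha> *\<^sub>R e \<alpha>)"
        by (simp add: vec_eq_iff forall_2 matrix_matrix_mult_def sum_2 mat_def del: sum_component)
          (simp add: scaleR_conv_of_real)
      show ?case
        unfolding sum.insert[OF insert.hyps] eq by (rule lin[OF e insert.IH])
    qed
    then show ?thesis unfolding X by simp
  qed
  have one: "?P (mat 1)"
    by (simp add: trace_e) (simp add: mat_def)
  \<comment> \<open>U is the traceless skew-Hermitian part of M and U' is - i times its traceless
    Hermitian part. Both lie in su(2), and M = U + i U' + trace M / 2.\<close>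
  define U where "U = (\<chi> k l. (M $ k $ l - cnj (M $ l $ k)) / 2 - (if k = l then (trace M - cnj (trace M)) / 4 else 0))"
  define U' where "U' = (\<chi> k l. (M $ k $ l + cnj (M $ l $ k)) * (- \<i> / 2) - (if k = l then (trace M + cnj (trace M)) * (- \<i> / 4) else 0))"
  have "U \<in> su2"
    by (simp add: su2_def U_def trace_def sum_2 forall_2 complex_eq_iff field_simps)
  moreover have "U' \<in> su2"
    by (simp add: su2_def U'_def trace_def sum_2 forall_2 complex_eq_iff field_simps)
  ultimately have "?P (mat 1 ** (mat 1 ** U + mat \<i> ** U') + mat (trace M / 2) ** mat 1)"
    by (intro lin one su2)
  moreover have "mat 1 ** (mat 1 ** U + mat \<i> ** U') + mat (trace M / 2) ** mat 1 = M"
    by (simp add: matrix2_expand U_def U'_def field_simps)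
  ultimately show ?thesis by (simp only:)
qed

text \<open>Completeness applied to the matrix unit M for which \<open>trace (M ** X)\<close> is the
  entry \<open>X $ k $ l\<close>.\<close>

lemma fierz:
  "(\<Sum>\<alpha>\<in>UNIV. \<Sum>\<beta>\<in>UNIV. G \<alpha> \<beta> * (e \<alpha> $ k $ l * e \<beta> $ i $ j))
     = (if l = i \<and> k = j then 1 else 0) - (if i = j \<and> k = l then 1 / 2 else 0)"
proof -
  define M :: "complex^2^2" where "M = (\<chi> a b. if l = a \<and> k = b then 1 else 0)"
  have t: "trace (M ** X) = X $ k $ l" for X :: "complex^2^2"
    using exhaust_2[of k] exhaust_2[of l] by (auto simp: M_def trace_def sum_2 matrix_matrix_mult_def)
  have tM: "trace M = (if k = l then 1 else 0)"
    using exhaust_2[of k] exhaust_2[of l] by (auto simp: M_def trace_def sum_2)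
  have "(\<Sum>\<alpha>\<in>UNIV. \<Sum>\<beta>\<in>UNIV. G \<alpha> \<beta> * (e \<alpha> $ k $ l * e \<beta> $ i $ j)) = M $ i $ j - trace M / 2 * (if i = j then 1 else 0)"
    using completeness[of M i j] unfolding t by (simp add: mult.assoc)
  then show ?thesis unfolding tM unfolding M_def by (cases "k = l"; cases "i = j") simp_all
qed

text \<open>Contracting the Casimir element between two loops fuses them into one, up to a multiple
  of the unchanged pair.\<close>

lemma casimir_two_traces:
  "(\<Sum>\<alpha>\<in>UNIV. \<Sum>\<beta>\<in>UNIV. G \<alpha> \<beta> * (trace (e \<alpha> ** X) * trace (e \<beta> ** Y)))
     = trace (X ** Y) - trace X * trace Y / 2"
proof -
  have "(\<Sum>\<alpha>\<in>UNIV. \<Sum>\<beta>\<in>UNIV. G \<alpha> \<beta> * (trace (e \<alpha> ** X) * trace (e \<beta> ** Y)))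
    = (\<Sum>k\<in>UNIV. \<Sum>l\<in>UNIV. \<Sum>i\<in>UNIV. \<Sum>j\<in>UNIV. X $ l $ k * Y $ j $ i *
        (\<Sum>\<alpha>\<in>UNIV. \<Sum>\<beta>\<in>UNIV. G \<alpha> \<beta> * (e \<alpha> $ k $ l * e \<beta> $ i $ j)))"
    unfolding sum_2 sum_distrib_left sum.distrib[symmetric]
    by (intro sum.cong refl) (simp add: trace_def sum_2 matrix_matrix_mult_def algebra_simps)
  also have "\<dots> = trace (X ** Y) - trace X * trace Y / 2"
    unfolding fierz by (simp add: sum_2 trace_def matrix_matrix_mult_def field_simps)
  finally show ?thesis .
qed

text \<open>The companion case: with both insertions on the same loop, the Casimir element splits it
  in two.\<close>

lemma casimir_one_trace:
  "(\<Sum>\<alpha>\<in>UNIV. \<Sum>\<beta>\<in>UNIV. G \<alpha> \<beta> * trace (e \<alpha> ** X ** e \<beta> ** Y))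
     = trace X * trace Y - trace (X ** Y) / 2"
proof -
  have "(\<Sum>\<alpha>\<in>UNIV. \<Sum>\<beta>\<in>UNIV. G \<alpha> \<beta> * trace (e \<alpha> ** X ** e \<beta> ** Y))
    = (\<Sum>k\<in>UNIV. \<Sum>l\<in>UNIV. \<Sum>i\<in>UNIV. \<Sum>j\<in>UNIV. X $ l $ i * Y $ j $ k *
        (\<Sum>\<alpha>\<in>UNIV. \<Sum>\<beta>\<in>UNIV. G \<alpha> \<beta> * (e \<alpha> $ k $ l * e \<beta> $ i $ j)))"
    unfolding sum_2 sum_distrib_left sum.distrib[symmetric]
    by (intro sum.cong refl) (simp add: trace_def sum_2 matrix_matrix_mult_def algebra_simps)
  also have "\<dots> = trace X * trace Y - trace (X ** Y) / 2"
    unfolding fierz by (simp add: sum_2 trace_def matrix_matrix_mult_def field_simps)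
  finally show ?thesis .
qed

text \<open>The value comes from \<open>casimir_one_trace\<close> with X = Y = 1, that is 2 * 2 - 2
  / 2. This is the 3 under the square root in a and b.\<close>

lemma card_basis: "of_nat CARD('n) = (3 :: complex)"
proof -
  have "of_nat CARD('n) = (\<Sum>\<alpha>\<in>UNIV. \<Sum>\<beta>\<in>UNIV. G \<alpha> \<beta> * g \<beta> \<alpha>)"
    by (simp add: G_left)
  also have "\<dots> = (\<Sum>\<alpha>\<in>UNIV. \<Sum>\<beta>\<in>UNIV. G \<alpha> \<beta> * trace (e \<alpha> ** mat 1 ** e \<beta> ** mat 1))"
    by (simp add: trace_mult_commute)
  also have "\<dots> = 3" unfolding casimir_one_trace by simp
  finally show ?thesis .
qed

end

section \<open>Loops formed by two perfect matchings\<close>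

text \<open>Finiteness forces a repetition in the orbit, and injectivity cancels the common initial
  steps, so the orbit has no tail; n is the least positive return time.\<close>

lemma period:
  assumes "finite S" "\<sigma> ` S \<subseteq> S" "inj_on \<sigma> S" "x \<in> S"
  obtains n where "0 < n" "(\<sigma> ^^ n) x = x" "inj_on (\<lambda>m. (\<sigma> ^^ m) x) {..<n}"
    "\<forall>m. (\<sigma> ^^ m) x = (\<sigma> ^^ (m mod n)) x"
proof -
  have S: "(\<sigma> ^^ m) y \<in> S" if "y \<in> S" for m y
    using assms(2) that by (induction m) auto
  have cancel: "(\<sigma> ^^ k) x = x" if "(\<sigma> ^^ (i + k)) x = (\<sigma> ^^ i) x" for i k
    using that
  proof (induction i)
    case (Suc i)
    then have "(\<sigma> ^^ (i + k)) x = (\<sigma> ^^ i) x"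
      using assms(3) S[OF assms(4)] by (auto dest: inj_onD)
    then show ?case by (rule Suc.IH)
  qed simp
  have "range (\<lambda>m. (\<sigma> ^^ m) x) \<subseteq> S" using S[OF assms(4)] by blast
  then have "finite (range (\<lambda>m. (\<sigma> ^^ m) x))" using assms(1) finite_subset by blast
  then have "\<not> inj (\<lambda>m. (\<sigma> ^^ m) x)" using finite_imageD infinite_UNIV_nat by blast
  then obtain i' j' where "i' \<noteq> j'" "(\<sigma> ^^ i') x = (\<sigma> ^^ j') x" unfolding inj_on_def by blast
  then obtain i j where "i < j" "(\<sigma> ^^ i) x = (\<sigma> ^^ j) x" by (cases i' j' rule: linorder_cases) auto
  then have "0 < j - i \<and> (\<sigma> ^^ (j - i)) x = x" using cancel[of i "j - i"] by simp
  then have ex: "\<exists>n. 0 < n \<and> (\<sigma> ^^ n) x = x" by blast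
  define n where "n = (LEAST n. 0 < n \<and> (\<sigma> ^^ n) x = x)"
  have n: "0 < n" "(\<sigma> ^^ n) x = x" using LeastI_ex[OF ex] by (auto simp: n_def)
  have least: "n \<le> k" if "0 < k" "(\<sigma> ^^ k) x = x" for k
    unfolding n_def using that by (auto intro: Least_le)
  have "i = j" if "i < n" "j < n" "(\<sigma> ^^ i) x = (\<sigma> ^^ j) x" "i \<le> j" for i j
    using cancel[of i "j - i"] least[of "j - i"] that by (cases "i = j") auto
  then have "inj_on (\<lambda>m. (\<sigma> ^^ m) x) {..<n}"
    by (intro inj_onI) (metis lessThan_iff nat_le_linear)
  moreover have "(\<sigma> ^^ m) x = (\<sigma> ^^ (m mod n)) x" for m
    using funpow_mod_eq[OF n(2)] by simp
  ultimately show ?thesis using that n by blast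
qed

definition fpf_involution :: "'a set \<Rightarrow> ('a \<Rightarrow> 'a) \<Rightarrow> bool" where
  "fpf_involution H f \<longleftrightarrow> (\<forall>x\<in>H. f x \<in> H \<and> f x \<noteq> x \<and> f (f x) = x)"

text \<open>The relation is not restricted to H, so that it agrees literally with the closure in
  \<open>components\<close>.\<close>

definition steps :: "('a \<Rightarrow> 'a) \<Rightarrow> ('a \<Rightarrow> 'a) \<Rightarrow> ('a \<times> 'a) set" where
  "steps f p = ({(z, f z) | z. True} \<union> {(z, p z) | z. True})\<^sup>*"

definition loop_of :: "'a set \<Rightarrow> ('a \<Rightarrow> 'a) \<Rightarrow> ('a \<Rightarrow> 'a) \<Rightarrow> 'a \<Rightarrow> 'a set" where
  "loop_of H f p x = {y \<in> H. (x, y) \<in> steps f p}"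

definition loops :: "'a set \<Rightarrow> ('a \<Rightarrow> 'a) \<Rightarrow> ('a \<Rightarrow> 'a) \<Rightarrow> 'a set set" where
  "loops H f p = loop_of H f p ` H"

definition loop_trace ::
    "('a \<Rightarrow> 'a) \<Rightarrow> ('a \<Rightarrow> 'a) \<Rightarrow> ('a \<Rightarrow> complex^2^2) \<Rightarrow> nat \<Rightarrow> 'a \<Rightarrow> complex" where
  "loop_trace f p w n x = trace (ordered_prod (\<lambda>m. w (((p \<circ> f) ^^ m) x)) n)"

text \<open>A loop contains each of its edges in both directions, so half its cardinality is the
  length of one traversal. The minus sign per loop supplies the factor (-1)^j.\<close>

definition loop_value ::
    "('a \<Rightarrow> 'a) \<Rightarrow> ('a \<Rightarrow> 'a) \<Rightarrow> ('a \<Rightarrow> complex^2^2) \<Rightarrow> 'a set \<Rightarrow> complex" where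
  "loop_value f p w C = - loop_trace f p w (card C div 2) (SOME x. x \<in> C)"

definition state_value ::
    "'a set \<Rightarrow> ('a \<Rightarrow> 'a) \<Rightarrow> ('a \<Rightarrow> 'a) \<Rightarrow> ('a \<Rightarrow> complex^2^2) \<Rightarrow> complex" where
  "state_value H f p w = (\<Prod>C\<in>loops H f p. loop_value f p w C)"

text \<open>The adjugate is the inverse for determinant one but, unlike the inverse, it is linear and
  reverses products of all matrices, so that arbitrary matrices can be inserted.\<close>

definition reversible :: "'a set \<Rightarrow> ('a \<Rightarrow> 'a) \<Rightarrow> ('a \<Rightarrow> complex^2^2) \<Rightarrow> bool" where
  "reversible H f w \<longleftrightarrow> (\<forall>x\<in>H. w (f x) = adjugate (w x))"

text \<open>\<open>Z x\<close> stands at the start of the directed edge x. From the reversed edge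
  the same insertion is met at the end, as an adjugate, which keeps the weights reversible.\<close>

definition insert_matrices ::
    "('a \<Rightarrow> 'a) \<Rightarrow> ('a \<Rightarrow> complex^2^2) \<Rightarrow> ('a \<Rightarrow> complex^2^2) \<Rightarrow> 'a \<Rightarrow> complex^2^2" where
  "insert_matrices f Z w x = Z x ** w x ** adjugate (Z (f x))"

lemma reversible_insert:
  "fpf_involution H f \<Longrightarrow> reversible H f w \<Longrightarrow> reversible H f (insert_matrices f Z w)"
  by (simp add: reversible_def insert_matrices_def fpf_involution_def adjugate_mult matrix_mul_assoc)

lemma insert_matrices_one [simp]: "insert_matrices f (\<lambda>x. mat 1) w = w"
  by (simp add: insert_matrices_def fun_eq_iff)

lemma insert_matrices_insert:
  "insert_matrices f Z (insert_matrices f Z' w) = insert_matrices f (\<lambda>x. Z x ** Z' x) w"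
  by (simp add: insert_matrices_def fun_eq_iff adjugate_mult matrix_mul_assoc)

lemma steps_refl [simp]: "(x, x) \<in> steps f p"
  by (simp add: steps_def)

lemma steps_f: "(x, y) \<in> steps f p \<Longrightarrow> (x, f y) \<in> steps f p"
  unfolding steps_def by (erule rtrancl_into_rtrancl) blast

lemma steps_p: "(x, y) \<in> steps f p \<Longrightarrow> (x, p y) \<in> steps f p"
  unfolding steps_def by (erule rtrancl_into_rtrancl) blast

lemma steps_f1: "(x, f x) \<in> steps f p" and steps_p1: "(x, p x) \<in> steps f p"
  using steps_f[OF steps_refl] steps_p[OF steps_refl] by fast+

lemma steps_trans: "(x, y) \<in> steps f p \<Longrightarrow> (y, z) \<in> steps f p \<Longrightarrow> (x, z) \<in> steps f p"
  unfolding steps_def by (rule rtrancl_trans)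

lemma steps_induct [consumes 1, case_names refl f p]:
  assumes "(x, y) \<in> steps f p" "P x"
    and "\<And>y. (x, y) \<in> steps f p \<Longrightarrow> P y \<Longrightarrow> P (f y)"
    and "\<And>y. (x, y) \<in> steps f p \<Longrightarrow> P y \<Longrightarrow> P (p y)"
  shows "P y"
  using assms(1) unfolding steps_def
  by (induction rule: rtrancl_induct) (use assms(2-4) in \<open>auto simp: steps_def\<close>)

section \<open>Walks that alternate between the edges f and the junctions p\<close>

locale matching_pair =
  fixes H :: "'a set" and f p :: "'a \<Rightarrow> 'a"
  assumes fin: "finite H" and f: "fpf_involution H f" and p: "fpf_involution H p"
begin

definition N :: "'a \<Rightarrow> 'a" where "N = p \<circ> f"

lemma N_apply: "N x = p (f x)"
  by (simp add: N_def)

lemma loop_trace_eq: "loop_trace f p w n x = trace (ordered_prod (\<lambda>m. w ((N ^^ m) x)) n)"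
  by (simp add: loop_trace_def N_def)

lemma f_in [simp]: "x \<in> H \<Longrightarrow> f x \<in> H" and f_f [simp]: "x \<in> H \<Longrightarrow> f (f x) = x"
  and f_neq: "x \<in> H \<Longrightarrow> f x \<noteq> x"
  using f by (auto simp: fpf_involution_def)

lemma p_in [simp]: "x \<in> H \<Longrightarrow> p x \<in> H" and p_p [simp]: "x \<in> H \<Longrightarrow> p (p x) = x"
  and p_neq: "x \<in> H \<Longrightarrow> p x \<noteq> x"
  using p by (auto simp: fpf_involution_def)

lemma N_in1 [simp]: "x \<in> H \<Longrightarrow> N x \<in> H" and N_f_N [simp]: "x \<in> H \<Longrightarrow> N (f (N x)) = f x"
  by (simp_all add: N_apply)

lemma N_in [simp]: "x \<in> H \<Longrightarrow> (N ^^ m) x \<in> H"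
  by (induction m) auto

lemma N_inj: "inj_on N H"
  by (rule inj_on_inverseI[of _ "\<lambda>x. f (p x)"]) (simp add: N_apply)

lemma N_cancel: "x \<in> H \<Longrightarrow> y \<in> H \<Longrightarrow> (N ^^ m) x = (N ^^ m) y \<Longrightarrow> x = y"
proof (induction m)
  case (Suc m)
  then have "N ((N ^^ m) x) = N ((N ^^ m) y)" by simp
  then show ?case using inj_onD[OF N_inj] N_in Suc by blast
qed simp

text \<open>By \<open>N_f_N\<close>, conjugation with f turns N into its inverse, so the reversed
  walk retraces its steps.\<close>

lemma N_reverse: "x \<in> H \<Longrightarrow> (N ^^ m) (f ((N ^^ m) x)) = f x"
proof (induction m)
  case (Suc m)
  have "(N ^^ Suc m) (f ((N ^^ Suc m) x)) = (N ^^ m) (N (f (N ((N ^^ m) x))))"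
    by (simp add: funpow_swap1)
  also have "N (f (N ((N ^^ m) x))) = f ((N ^^ m) x)" using Suc.prems by simp
  finally show ?case using Suc by simp
qed simp

text \<open>A walk meeting its own reverse would have to turn around at an edge or at a crossing.\<close>

lemma N_neq_f:
  assumes "x \<in> H"
  shows "(N ^^ k) x \<noteq> f x"
proof
  assume eq: "(N ^^ k) x = f x"
  define m where "m = k div 2"
  let ?y = "(N ^^ m) x"
  have y: "?y \<in> H" using assms by simp
  have rev: "(N ^^ m) (f ?y) = f x" using N_reverse[OF assms] .
  show False
  proof (cases "even k")
    case True
    then have "k = m + m" unfolding m_def by presburger
    then have "(N ^^ m) (f ?y) = (N ^^ m) ?y" using eq rev by (simp add: funpow_add)
    then show False using N_cancel[of "f ?y" ?y] y f_neq[OF y] by simp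
  next
    case False
    then have "k = m + Suc m" unfolding m_def by presburger
    then have "(N ^^ m) (f ?y) = (N ^^ m) (N ?y)" using eq rev by (simp add: funpow_add funpow_swap1)
    then have "f ?y = N ?y" using N_cancel[of "f ?y" "N ?y"] y by simp
    then show False using p_neq[of "f ?y"] y by (simp add: N_apply)
  qed
qed

lemma N_neq_f_N:
  assumes "x \<in> H"
  shows "(N ^^ i) x \<noteq> f ((N ^^ j) x)"
proof (cases "j \<le> i")
  case True
  then have "(N ^^ i) x = (N ^^ (i - j)) ((N ^^ j) x)" by (metis funpow_add le_add_diff_inverse2 o_apply)
  then show ?thesis using N_neq_f[of "(N ^^ j) x"] assms by simp
next
  case False
  then have "(N ^^ j) x = (N ^^ (j - i)) ((N ^^ i) x)" by (metis funpow_add le_add_diff_inverse2 nat_le_linear o_apply)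
  then have "(N ^^ j) x \<noteq> f ((N ^^ i) x)" using N_neq_f[of "(N ^^ i) x"] assms by simp
  then show ?thesis using assms by (metis N_in f_f)
qed

lemma steps_sym:
  assumes "(x, y) \<in> steps f p" "x \<in> H"
  shows "y \<in> H \<and> (y, x) \<in> steps f p"
  using assms
proof (induction rule: steps_induct)
  case (f y)
  have "(f y, f (f y)) \<in> steps f p" by (rule steps_f) simp
  then show ?case using f by (auto intro: steps_trans)
next
  case (p y)
  have "(p y, p (p y)) \<in> steps f p" by (rule steps_p) simp
  then show ?case using p by (auto intro: steps_trans)
qed simp

lemma steps_N: "(x, (N ^^ m) x) \<in> steps f p"
  by (induction m) (auto simp: N_apply intro: steps_f steps_p)

lemma loop_of_self: "x \<in> H \<Longrightarrow> x \<in> loop_of H f p x"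
  by (simp add: loop_of_def)

lemma loop_of_eq: "x \<in> H \<Longrightarrow> y \<in> loop_of H f p x \<Longrightarrow> loop_of H f p y = loop_of H f p x"
  using steps_sym by (auto simp: loop_of_def intro: steps_trans)

lemma finite_loops: "finite (loops H f p)"
  using fin by (simp add: loops_def)

text \<open>A loop is one orbit of N together with its reversal. By \<open>N_neq_f_N\<close> the two
  are disjoint, so the number of half-strands is twice the period.\<close>

lemma loop_structure:
  assumes x: "x \<in> H"
  obtains n where "0 < n" "(N ^^ n) x = x" "inj_on (\<lambda>m. (N ^^ m) x) {..<n}"
    "loop_of H f p x = (\<lambda>m. (N ^^ m) x) ` {..<n} \<union> (\<lambda>m. f ((N ^^ m) x)) ` {..<n}"
    "card (loop_of H f p x) = 2 * n"
proof -
  have "N ` H \<subseteq> H" by auto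
  then obtain n where n: "0 < n" "(N ^^ n) x = x" "inj_on (\<lambda>m. (N ^^ m) x) {..<n}"
    and md: "\<forall>m. (N ^^ m) x = (N ^^ (m mod n)) x"
    by (rule period[OF fin _ N_inj x])
  define O1 where "O1 = (\<lambda>m. (N ^^ m) x) ` {..<n}"
  define O2 where "O2 = (\<lambda>m. f ((N ^^ m) x)) ` {..<n}"
  have O1: "(N ^^ m) x \<in> O1" for m
    unfolding O1_def by (subst md[rule_format]) (use n(1) in simp)
  have O2: "f ((N ^^ m) x) \<in> O2" for m
    unfolding O2_def by (subst md[rule_format]) (use n(1) in simp)
  have "y \<in> O1 \<union> O2" if "(x, y) \<in> steps f p" for y
    using that
  proof (induction rule: steps_induct)
    case refl then show ?case using O1[of 0] by simp
  next
    case (f y)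
    from f.IH consider m where "y = (N ^^ m) x" | m where "y = f ((N ^^ m) x)"
      by (auto simp: O1_def O2_def)
    then show ?case
      by cases (use O1 O2 x in auto)
  next
    case (p y)
    from p.IH consider m where "y = (N ^^ m) x" | m where "y = f ((N ^^ m) x)"
      by (auto simp: O1_def O2_def)
    then show ?case
    proof cases
      case (1 m)
      \<comment> \<open>A junction leads from an edge back to the reversal of its predecessor.
        Adding the period n provides a predecessor also for m = 0.\<close>
      have "(N ^^ m) x = (N ^^ (m + n)) x" using n(2) by (simp add: funpow_add)
      also have "\<dots> = N ((N ^^ (m + n - 1)) x)" using n(1)
        by (metis Suc_pred' add_pos_pos funpow.simps(2) le_add2 o_apply order_less_le_trans add_gr_0)
      finally have "y = p (f ((N ^^ (m + n - 1)) x))" using 1 by (simp only: N_apply)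
      then have "p y = f ((N ^^ (m + n - 1)) x)" using x by simp
      then show ?thesis using O2 by simp
    next
      case (2 m)
      then have "p y = (N ^^ Suc m) x" by (simp add: N_apply)
      then show ?thesis using O1[of "Suc m"] by (simp del: funpow.simps)
    qed
  qed
  moreover have "O1 \<union> O2 \<subseteq> loop_of H f p x"
    using x steps_N[of x] by (auto simp: O1_def O2_def loop_of_def intro: steps_f)
  ultimately have eq: "loop_of H f p x = O1 \<union> O2" by (auto simp: loop_of_def)
  have c1: "card O1 = n" unfolding O1_def by (subst card_image[OF n(3)]) simp
  have "inj_on (\<lambda>m. f ((N ^^ m) x)) {..<n}"
    using n(3) x unfolding inj_on_def by (metis N_in f_f)
  then have c2: "card O2 = n" unfolding O2_def by (subst card_image) simp_all
  have "O1 \<inter> O2 = {}" using N_neq_f_N[OF x] by (auto simp: O1_def O2_def)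
  then have "card (O1 \<union> O2) = 2 * n"
    using c1 c2 by (subst card_Un_disjoint) (simp_all add: O1_def O2_def)
  then show ?thesis using that n eq by (simp add: O1_def O2_def)
qed

lemma loop_trace_N:
  assumes "(N ^^ n) x = x"
  shows "loop_trace f p w n ((N ^^ k) x) = loop_trace f p w n x"
proof (induction k)
  case (Suc k)
  let ?z = "(N ^^ k) x"
  have per: "(N ^^ n) ?z = ?z" using assms by (metis add.commute comp_apply funpow_add)
  have "loop_trace f p w n (N ?z) = trace (ordered_prod (\<lambda>m. w ((N ^^ Suc m) ?z)) n)"
    unfolding loop_trace_eq by (simp add: funpow_swap1)
  also have "\<dots> = loop_trace f p w n ?z"
    unfolding loop_trace_eq by (rule trace_ordered_prod_rotate) (use per in simp)
  finally show ?case using Suc by simp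
qed simp

text \<open>Backward traversal yields the adjugate of the forward product, and a matrix and its
  adjugate have the same trace.\<close>

lemma loop_trace_f:
  assumes x: "x \<in> H" and per: "(N ^^ n) x = x" and w: "reversible H f w"
  shows "loop_trace f p w n (f x) = loop_trace f p w n x"
proof -
  \<comment> \<open>Indices are shifted by one because the backward walk starts at f x, the reversal
    of the last edge \<open>(N ^^ n) x = x\<close> of the forward walk.\<close>
  let ?g = "\<lambda>m. w ((N ^^ Suc m) x)"
  have "w ((N ^^ m) (f x)) = adjugate (?g (n - Suc m))" if "m < n" for m
  proof -
    let ?y = "(N ^^ (n - m)) x"
    have "(N ^^ m) ?y = x" using per that by (metis comp_apply funpow_add le_add_diff_inverse less_imp_le)
    then have "(N ^^ m) (f x) = f ?y" using N_reverse[of ?y m] x by simp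
    moreover have "Suc (n - Suc m) = n - m" using that by simp
    ultimately show ?thesis using w x by (metis N_in reversible_def)
  qed
  then have "ordered_prod (\<lambda>m. w ((N ^^ m) (f x))) n = ordered_prod (\<lambda>m. adjugate (?g (n - Suc m))) n"
    by (intro ordered_prod_cong) simp
  also have "\<dots> = adjugate (ordered_prod ?g n)" by (rule ordered_prod_adjugate)
  finally have "loop_trace f p w n (f x) = trace (ordered_prod ?g n)"
    by (simp add: loop_trace_eq)
  also have "\<dots> = loop_trace f p w n x"
    unfolding loop_trace_eq by (rule trace_ordered_prod_rotate) (use per in simp)
  finally show ?thesis .
qed

lemma loop_trace_indep:
  assumes x: "x \<in> H" and y: "y \<in> loop_of H f p x" and w: "reversible H f w"
  shows "loop_trace f p w (card (loop_of H f p x) div 2) y = loop_trace f p w (card (loop_of H f p x) div 2) x"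
proof -
  obtain n where n: "(N ^^ n) x = x" "card (loop_of H f p x) = 2 * n"
      "loop_of H f p x = (\<lambda>m. (N ^^ m) x) ` {..<n} \<union> (\<lambda>m. f ((N ^^ m) x)) ` {..<n}"
    using loop_structure[OF x] by metis
  from y n(3) consider m where "y = (N ^^ m) x" | m where "y = f ((N ^^ m) x)" by auto
  then show ?thesis
  proof cases
    case 1 then show ?thesis using loop_trace_N[OF n(1)] n(2) by simp
  next
    case (2 m)
    have "(N ^^ n) ((N ^^ m) x) = (N ^^ m) x" using n(1) by (metis add.commute comp_apply funpow_add)
    then show ?thesis using loop_trace_f[OF N_in[OF x] _ w] loop_trace_N[OF n(1)] n(2) 2 by simp
  qed
qed

lemma loop_value_eq:
  assumes x: "x \<in> H" and w: "reversible H f w"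
  shows "loop_value f p w (loop_of H f p x) = - loop_trace f p w (card (loop_of H f p x) div 2) x"
proof -
  have "(SOME y. y \<in> loop_of H f p x) \<in> loop_of H f p x" using loop_of_self[OF x] by (rule someI)
  then show ?thesis unfolding loop_value_def using loop_trace_indep[OF x _ w] by simp
qed

lemma state_value_cong:
  assumes "\<And>x. x \<in> H \<Longrightarrow> w x = w' x"
  shows "state_value H f p w = state_value H f p w'"
  unfolding state_value_def
proof (rule prod.cong[OF refl])
  fix C assume "C \<in> loops H f p"
  then obtain x where x: "x \<in> H" "C = loop_of H f p x" by (auto simp: loops_def)
  then have "(SOME x. x \<in> C) \<in> C" using loop_of_self by (metis someI)
  then have "(SOME x. x \<in> C) \<in> H" using x by (auto simp: loop_of_def)
  then show "loop_value f p w C = loop_value f p w' C"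
    unfolding loop_value_def loop_trace_eq using assms N_in by (metis (mono_tags, lifting) ordered_prod_cong)
qed

section \<open>Deleting a loop of one edge and fusing two consecutive edges\<close>

lemma state_value_remove_loop:
  assumes a: "a \<in> H" and fa: "f a = p a" and w: "reversible H f w"
  shows "state_value H f p w = - trace (w a) * state_value (H - {a, p a}) f p w"
proof -
  let ?b = "p a"
  let ?H = "H - {a, ?b}"
  have fb: "f ?b = a" using fa a by (metis f_f)
  have off: "y \<in> ?H" if "(x, y) \<in> steps f p" "x \<in> ?H" for x y
    using that
  proof (induction rule: steps_induct)
    case (f y)
    then have "f y \<noteq> a" "f y \<noteq> ?b" using fa fb f_f by (metis DiffE insertCI)+
    then show ?case using f by simp
  next
    case (p y)
    then have "p y \<noteq> a" "p y \<noteq> ?b" using p_p a by (metis DiffE insertCI)+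
    then show ?case using p by simp
  qed simp
  have la: "loop_of H f p a = {a, ?b}"
  proof -
    have "y = a \<or> y = ?b" if "(a, y) \<in> steps f p" for y
      using that by (induction rule: steps_induct) (use a fa fb in auto)
    moreover have "(a, ?b) \<in> steps f p" by (rule steps_p) simp
    ultimately show ?thesis using a by (auto simp: loop_of_def)
  qed
  have lb: "loop_of H f p ?b = {a, ?b}" using loop_of_eq[OF a, of ?b] la by simp
  have lx: "loop_of H f p x = loop_of ?H f p x" if "x \<in> ?H" for x
    using off[OF _ that] by (auto simp: loop_of_def)
  have "H = insert a (insert ?b ?H)" using a by auto
  then have "loops H f p = insert {a, ?b} (loop_of H f p ` ?H)"
    unfolding loops_def using la lb by (metis (no_types, lifting) image_insert insert_absorb2)
  also have "loop_of H f p ` ?H = loops ?H f p"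
    unfolding loops_def using lx by (intro image_cong) auto
  finally have L: "loops H f p = insert {a, ?b} (loops ?H f p)" .
  have notin: "{a, ?b} \<notin> loops ?H f p"
    by (auto simp: loops_def loop_of_def)
  have "card {a, ?b} div 2 = 1" using p_neq[OF a] by (simp add: card_insert_if)
  then have "loop_value f p w {a, ?b} = - trace (w a)"
    using loop_value_eq[OF a w] unfolding la by (simp add: loop_trace_eq)
  moreover have "finite (loops ?H f p)" using fin by (simp add: loops_def)
  ultimately show ?thesis
    unfolding state_value_def L using notin by simp
qed

lemma contraction_fpf:
  assumes a: "a \<in> H" and fa: "f a \<noteq> p a"
  shows "fpf_involution (H - {a, p a}) (f(f a := f (p a), f (p a) := f a))"
    and "fpf_involution (H - {a, p a}) p"
proof -
  let ?b = "p a" let ?u = "f a" let ?v = "f ?b"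
  have b: "?b \<in> H" using a by simp
  have 1: "?u \<noteq> a" "?v \<noteq> ?b" "?v \<noteq> a" "?u \<noteq> ?v" "?u \<in> H" "?v \<in> H" "?u \<noteq> ?b"
    using f_neq p_neq a b fa f_f by (metis, metis, metis, metis, simp_all)
  have 2: "f x \<in> H - {a, ?b}" "f x \<noteq> ?u" "f x \<noteq> ?v" if "x \<in> H - {a, ?b}" "x \<noteq> ?u" "x \<noteq> ?v" for x
    using that a b f_f by (auto, metis+)
  have 3: "p x \<noteq> a" "p x \<noteq> ?b" if "x \<in> H - {a, ?b}" for x
    using that a by (metis DiffE insertCI p_p)+
  show "fpf_involution (H - {a, ?b}) (f(?u := ?v, ?v := ?u))"
    unfolding fpf_involution_def using 1 2 f_neq by auto
  show "fpf_involution (H - {a, ?b}) p"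
    unfolding fpf_involution_def using p_neq 3 by auto
qed

text \<open>The walk runs from u along an edge to a, through the junction to b, and along a second
  edge to v. Fused, this is one edge from u to v with weight \<open>w u ** w b\<close>, and
  \<open>w v ** w a\<close> backwards. Since f a and p a differ, no loop is contained in {a, b}, so
  deleting these two is injective on loops.\<close>

lemma state_value_contract:
  assumes a: "a \<in> H" and fa: "f a \<noteq> p a" and w: "reversible H f w"
  defines "b \<equiv> p a" and "u \<equiv> f a" and "v \<equiv> f (p a)"
  defines "f' \<equiv> f(u := v, v := u)" and "w' \<equiv> w(u := w u ** w b, v := w v ** w a)"
  shows "reversible (H - {a, b}) f' w'"
    and "state_value H f p w = state_value (H - {a, b}) f' p w'"
proof -
  let ?H = "H - {a, b}"
  have b: "b \<in> H" using a by (simp add: b_def)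
  have pb: "p b = a" using a by (simp add: b_def)
  have neq: "u \<noteq> a" "v \<noteq> b" "v \<noteq> a" "u \<noteq> v" "u \<noteq> b" "a \<noteq> b" and uv: "u \<in> H" "v \<in> H"
    unfolding u_def v_def b_def using f_neq p_neq a b fa f_f b_def by (metis, metis, metis, metis, metis, metis, simp_all)
  have fu: "f u = a" "f v = b" using a b by (simp_all add: u_def v_def b_def)
  have vb: "v = f b" by (simp add: v_def b_def)
  have fx: "f x \<in> ?H" "f x \<noteq> u" "f x \<noteq> v" if "x \<in> ?H" "x \<noteq> u" "x \<noteq> v" for x
    using that a b f_f unfolding u_def vb by (auto, metis+)
  have wa: "w a = adjugate (w u)" "w b = adjugate (w v)" "w u = adjugate (w a)" "w v = adjugate (w b)"
    using w uv a b fu unfolding reversible_def u_def vb by (metis, metis, metis, metis)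
  show rev': "reversible ?H f' w'"
    unfolding reversible_def
  proof
    fix x assume x: "x \<in> ?H"
    consider "x = u" | "x = v" | "x \<noteq> u" "x \<noteq> v" by blast
    then show "w' (f' x) = adjugate (w' x)"
    proof cases
      case 1
      then show ?thesis using neq by (simp add: f'_def w'_def adjugate_mult wa(1) wa(4))
    next
      case 2
      then show ?thesis using neq by (simp add: f'_def w'_def adjugate_mult wa(2) wa(3))
    next
      case 3
      then show ?thesis using fx[OF x 3] w x by (simp add: f'_def w'_def reversible_def)
    qed
  qed
  have fpf': "fpf_involution ?H f'" "fpf_involution ?H p"
    using contraction_fpf[OF a fa] by (simp_all add: f'_def u_def v_def b_def)
  then interpret c: matching_pair ?H f' p by unfold_locales (use fin in simp_all)

  \<comment> \<open>\<rho> moves the two vanishing half-strands to the far ends of their edges,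
    which turns old walks into new ones.\<close>
  define \<rho> where "\<rho> z = (if z = a then u else if z = b then v else z)" for z
  have px: "p x \<in> ?H" if "x \<in> ?H" for x using that p_p pb b_def by (metis Diff_iff insert_iff empty_iff p_in)
  have \<rho>f: "(\<rho> z, \<rho> (f z)) \<in> steps f' p" if z: "z \<in> H" for z
  proof -
    consider "z = a" | "z = b" | "z = u" | "z = v" | "z \<in> ?H" "z \<noteq> u" "z \<noteq> v" using z by blast
    then show ?thesis
    proof cases
      case 5
      have "\<rho> z = z" "\<rho> (f z) = f z" "f' z = f z" using 5 fx[OF 5] by (auto simp: \<rho>_def f'_def)
      then show ?thesis using steps_f1[of z f' p] by simp
    qed (use neq fu in \<open>simp_all add: \<rho>_def u_def[symmetric] vb[symmetric]\<close>)
  qed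
  have \<rho>p: "(\<rho> z, \<rho> (p z)) \<in> steps f' p" if z: "z \<in> H" for z
  proof -
    consider "z = a" | "z = b" | "z \<in> ?H" using z by blast
    then show ?thesis
    proof cases
      case 1
      have "f' u = v" using neq by (simp add: f'_def)
      then show ?thesis using 1 steps_f1[of u f' p] neq by (simp add: \<rho>_def b_def[symmetric])
    next
      case 2
      have "f' v = u" using neq by (simp add: f'_def)
      then show ?thesis using 2 steps_f1[of v f' p] neq pb by (simp add: \<rho>_def)
    next
      case 3
      have "\<rho> z = z" "\<rho> (p z) = p z" using 3 px[OF 3] by (auto simp: \<rho>_def)
      then show ?thesis using steps_p1[of z p f'] by simp
    qed
  qed
  have to': "(\<rho> x, \<rho> y) \<in> steps f' p" if "(x, y) \<in> steps f p" "x \<in> H" for x y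
    using that
  proof (induction rule: steps_induct)
    case (f y) then show ?case using \<rho>f steps_sym by (meson steps_trans)
  next
    case (p y) then show ?case using \<rho>p steps_sym by (meson steps_trans)
  qed simp
  have from': "(x, y) \<in> steps f p" if "(x, y) \<in> steps f' p" "x \<in> ?H" for x y
    using that
  proof (induction rule: steps_induct)
    case (f y)
    then have y: "(x, y) \<in> steps f p" by simp
    consider "y = u" | "y = v" | "y \<noteq> u" "y \<noteq> v" by blast
    then show ?case
    proof cases
      case 1
      then have "(x, f (p (f y))) \<in> steps f p" using y by (intro steps_f steps_p)
      then show ?thesis using 1 neq fu by (simp add: f'_def v_def)
    next
      case 2
      then have "(x, f (p (f y))) \<in> steps f p" using y by (intro steps_f steps_p)
      then show ?thesis using 2 neq fu pb by (simp add: f'_def u_def)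
    next
      case 3
      then show ?thesis using steps_f[OF y] by (simp add: f'_def)
    qed
  next
    case (p y) then show ?case by (auto intro: steps_p)
  qed simp
  have loop': "loop_of ?H f' p x = loop_of H f p x - {a, b}" if x: "x \<in> ?H" for x
  proof -
    have "(x, y) \<in> steps f' p" if "(x, y) \<in> steps f p" "y \<in> ?H" for y
      using to'[OF that(1)] x that(2) by (auto simp: \<rho>_def)
    then show ?thesis using from' x by (auto simp: loop_of_def)
  qed
  have rep: "\<exists>x\<in>?H. loop_of H f p z = loop_of H f p x" if z: "z \<in> H" for z
  proof -
    have "\<rho> z \<in> ?H" using z uv neq by (auto simp: \<rho>_def)
    moreover have "(z, \<rho> z) \<in> steps f p"
      using steps_f1[of z f p] by (auto simp: \<rho>_def u_def vb)
    ultimately show ?thesis using loop_of_eq[OF z, of "\<rho> z"] by (metis (no_types, lifting) Diff_iff loop_of_def mem_Collect_eq)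
  qed
  have L: "loops H f p = loop_of H f p ` ?H" using rep by (auto simp: loops_def)
  have inj: "inj_on (\<lambda>C. C - {a, b}) (loops H f p)"
  proof (rule inj_onI)
    fix C C' assume C: "C \<in> loops H f p" "C' \<in> loops H f p" and eq: "C - {a, b} = C' - {a, b}"
    from C obtain x x' where x: "x \<in> ?H" "C = loop_of H f p x" "x' \<in> ?H" "C' = loop_of H f p x'"
      unfolding L by blast
    have "x \<in> C - {a, b}" using x loop_of_self by blast
    then have "x \<in> loop_of H f p x'" using eq x by blast
    then show "C = C'" using loop_of_eq x by blast
  qed
  have val: "loop_value f p w C = loop_value f' p w' (C - {a, b})" if C: "C \<in> loops H f p" for C
  proof (cases "a \<in> C")
    case True
    obtain x where x: "x \<in> H" "C = loop_of H f p x" using C by (auto simp: loops_def)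
    \<comment> \<open>Reading the loop from u makes the two edges to be fused its first two
      factors.\<close>
    have "u \<in> C" using True x uv unfolding u_def by (auto simp: loop_of_def intro: steps_f)
    then have Cu: "C = loop_of H f p u" using loop_of_eq x by blast
    have bC: "b \<in> C" using True x b unfolding b_def by (auto simp: loop_of_def intro: steps_p)
    obtain n where n: "0 < n" "(N ^^ n) u = u" "inj_on (\<lambda>m. (N ^^ m) u) {..<n}" "card C = 2 * n"
      using loop_structure[OF uv(1)] Cu by metis
    have Nu: "N u = b" using fu by (simp add: b_def N_apply)
    have Nb: "N b = p v" by (simp add: vb N_apply)
    have "n \<noteq> 1" using n(2) Nu neq by auto
    then obtain k where k: "n = Suc (Suc k)" using n(1) by (metis One_nat_def gr0_implies_Suc not0_implies_Suc)
    have away: "(N ^^ m) u \<noteq> u" "(N ^^ m) u \<noteq> v" if "0 < m" "m < n" for m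
    proof -
      show "(N ^^ m) u \<noteq> u" using inj_onD[OF n(3), of m 0] that by auto
      show "(N ^^ m) u \<noteq> v" using N_neq_f_N[OF uv(1), of m 1] Nu vb by simp
    qed
    have walk: "(c.N ^^ Suc m) u = (N ^^ Suc (Suc m)) u" if "m \<le> k" for m
      using that
    proof (induction m)
      case 0
      have "f' u = v" using neq by (simp add: f'_def)
      then show ?case using Nu Nb by (simp add: c.N_apply)
    next
      case (Suc m)
      let ?z = "(N ^^ Suc (Suc m)) u"
      have "f' ?z = f ?z" using away[of "Suc (Suc m)"] Suc.prems k by (simp add: f'_def)
      then have "c.N ?z = N ?z" by (simp only: N_apply c.N_apply)
      then show ?case using Suc by simp
    qed
    have w'N: "w' ((N ^^ Suc (Suc m)) u) = w ((N ^^ Suc (Suc m)) u)" if "m < k" for m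
      using away[of "Suc (Suc m)"] that k by (simp add: w'_def)
    have "ordered_prod (\<lambda>m. w ((N ^^ m) u)) n
        = w u ** (w b ** ordered_prod (\<lambda>m. w ((N ^^ Suc (Suc m)) u)) k)"
      unfolding k ordered_prod_front using Nu by simp
    also have "\<dots> = w' u ** ordered_prod (\<lambda>m. w' ((c.N ^^ Suc m) u)) k"
    proof -
      have "ordered_prod (\<lambda>m. w' ((c.N ^^ Suc m) u)) k = ordered_prod (\<lambda>m. w ((N ^^ Suc (Suc m)) u)) k"
        by (rule ordered_prod_cong) (metis walk w'N less_imp_le)
      then show ?thesis using neq by (simp add: w'_def matrix_mul_assoc)
    qed
    also have "\<dots> = ordered_prod (\<lambda>m. w' ((c.N ^^ m) u)) (Suc k)"
      unfolding ordered_prod_front by simp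
    finally have tr: "loop_trace f p w n u = loop_trace f' p w' (Suc k) u"
      by (simp only: loop_trace_eq c.loop_trace_eq)
    have uH: "u \<in> ?H" using uv neq by simp
    have "card (C - {a, b}) = card C - 2"
      using True bC neq fin x by (subst card_Diff_subset) (auto simp: loop_of_def)
    then have "card (C - {a, b}) div 2 = Suc k" using n(4) k by simp
    moreover have "C - {a, b} = loop_of ?H f' p u" using loop'[OF uH] Cu by simp
    ultimately show ?thesis
      using loop_value_eq[OF uv(1) w] c.loop_value_eq[OF uH rev'] tr n(4) Cu by simp
  next
    case False
    obtain x where x: "x \<in> ?H" "C = loop_of H f p x" using C unfolding L by blast
    then have xH: "x \<in> H" by simp
    have cl: "f y \<in> C" "p y \<in> C" if "y \<in> C" for y
      using that x by (auto simp: loop_of_def intro: steps_f steps_p)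
    have "b \<notin> C" using cl(2)[of b] False pb by auto
    have "u \<notin> C" "v \<notin> C" using cl(1)[of u] cl(1)[of v] False \<open>b \<notin> C\<close> fu by auto
    have NC: "(N ^^ m) x \<in> C" for m using x xH steps_N by (auto simp: loop_of_def)
    have walk: "(c.N ^^ m) x = (N ^^ m) x" for m
    proof (induction m)
      case (Suc m)
      have "f' ((N ^^ m) x) = f ((N ^^ m) x)" using NC[of m] \<open>u \<notin> C\<close> \<open>v \<notin> C\<close> by (auto simp: f'_def)
      then have "c.N ((N ^^ m) x) = N ((N ^^ m) x)" by (simp only: N_apply c.N_apply)
      then show ?case using Suc by simp
    qed simp
    have "w' ((N ^^ m) x) = w ((N ^^ m) x)" for m
      using NC[of m] \<open>u \<notin> C\<close> \<open>v \<notin> C\<close> by (auto simp: w'_def)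
    then have tr: "loop_trace f' p w' n x = loop_trace f p w n x" for n
      by (simp add: loop_trace_eq c.loop_trace_eq walk)
    have "C - {a, b} = C" using False \<open>b \<notin> C\<close> by blast
    moreover have "C - {a, b} = loop_of ?H f' p x" using loop'[OF x(1)] x by simp
    ultimately show ?thesis
      using loop_value_eq[OF xH w] c.loop_value_eq[OF x(1) rev'] tr x by simp
  qed
  have "loops ?H f' p = (\<lambda>C. C - {a, b}) ` (loop_of H f p ` ?H)"
    unfolding loops_def image_image using loop' by (intro image_cong) auto
  then have "loops ?H f' p = (\<lambda>C. C - {a, b}) ` loops H f p" unfolding L .
  then show "state_value H f p w = state_value ?H f' p w'"
    unfolding state_value_def by (simp add: prod.reindex[OF inj] val cong: prod.cong)
qed

end

section \<open>Reduction of a state to a few half-strands\<close>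

lemma state_value_empty [simp]: "state_value {} f p w = 1"
  by (simp add: state_value_def loops_def)

text \<open>The order of quantifiers matters: the reduced data are chosen before p and Z, so all
  matchings and insertions that differ only on Q share them, and a linear relation among their
  values may be checked on Q alone. Pairs outside Q are removed one at a time; an edge closing up on
  itself becomes a factor of R, every other pair is fused away.\<close>

lemma state_value_reduce:
  assumes "finite H" "Q \<subseteq> H" "fpf_involution H f" "fpf_involution H p\<^sub>0" "fpf_involution (H - Q) p\<^sub>0" "reversible H f w"
  shows "\<exists>R f\<^sub>0 w\<^sub>0. fpf_involution Q f\<^sub>0 \<and> reversible Q f\<^sub>0 w\<^sub>0 \<and>
    (\<forall>p Z. fpf_involution Q p \<longrightarrow> (\<forall>x\<in>H - Q. p x = p\<^sub>0 x \<and> Z x = mat 1) \<longrightarrow>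
      state_value H f p (insert_matrices f Z w) = R * state_value Q f\<^sub>0 p (insert_matrices f\<^sub>0 Z w\<^sub>0))"
  using assms
proof (induction "card H" arbitrary: H f w rule: less_induct)
  case less
  show ?case
  proof (cases "H = Q")
    case True
    then show ?thesis using less.prems by (intro exI[of _ 1] exI[of _ f] exI[of _ w]) auto
  next
    case False
    then obtain a where a: "a \<in> H - Q" using less.prems(2) by blast
    define b where "b = p\<^sub>0 a"
    have b: "b \<in> H - Q" "b \<noteq> a" "p\<^sub>0 b = a"
      using less.prems(5) a unfolding fpf_involution_def b_def by blast+
    let ?H = "H - {a, b}"
    have Q: "Q \<subseteq> ?H" using less.prems(2) a b by blast
    have smaller: "card ?H < card H" using a less.prems(1) by (intro psubset_card_mono) auto
    interpret p0: matching_pair H f p\<^sub>0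
      by unfold_locales (use less.prems in simp_all)
    have fp0: "fpf_involution (?H - Q) p\<^sub>0" "fpf_involution ?H p\<^sub>0"
      using less.prems(4,5) a b unfolding fpf_involution_def b_def by (metis Diff_iff empty_iff insert_iff)+
    have fp: "fpf_involution H p" if "fpf_involution Q p" "\<forall>x\<in>H - Q. p x = p\<^sub>0 x \<and> Z x = mat 1" for p and Z :: "'a \<Rightarrow> complex^2^2"
      unfolding fpf_involution_def
    proof
      fix x assume x: "x \<in> H"
      show "p x \<in> H \<and> p x \<noteq> x \<and> p (p x) = x"
      proof (cases "x \<in> Q")
        case True
        then show ?thesis using that(1) less.prems(2) by (auto simp: fpf_involution_def)
      next
        case False
        then have "p\<^sub>0 x \<in> H - Q \<and> p\<^sub>0 x \<noteq> x \<and> p\<^sub>0 (p\<^sub>0 x) = x"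
          using x less.prems(5) by (auto simp: fpf_involution_def)
        then show ?thesis using that(2) x False by auto
      qed
    qed
    show ?thesis
    proof (cases "f a = b")
      case True
      have fb: "f b = a" using True a less.prems(3) unfolding fpf_involution_def by blast
      have fH: "fpf_involution ?H f"
        using less.prems(3) True fb unfolding fpf_involution_def by (metis Diff_iff empty_iff insert_iff)
      have wH: "reversible ?H f w" using less.prems(6) by (simp add: reversible_def)
      obtain R f0 w0 where IH: "fpf_involution Q f0" "reversible Q f0 w0"
        "\<And>p Z. fpf_involution Q p \<Longrightarrow> \<forall>x\<in>?H - Q. p x = p\<^sub>0 x \<and> Z x = mat 1 \<Longrightarrow>
          state_value ?H f p (insert_matrices f Z w) = R * state_value Q f0 p (insert_matrices f0 Z w0)"
        using less.hyps[OF smaller finite_Diff[OF less.prems(1)] Q fH fp0(2,1) wH] by blast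
      have "state_value H f p (insert_matrices f Z w) = (- trace (w a) * R) * state_value Q f0 p (insert_matrices f0 Z w0)"
        if pZ: "fpf_involution Q p" "\<forall>x\<in>H - Q. p x = p\<^sub>0 x \<and> Z x = mat 1" for p Z
      proof -
        interpret matching_pair H f p
          by unfold_locales (use less.prems fp[OF pZ] in simp_all)
        have pa: "p a = b" using pZ(2) a b_def by simp
        have wa: "insert_matrices f Z w a = w a"
          using pZ(2) a b True by (simp add: insert_matrices_def)
        have "state_value H f p (insert_matrices f Z w)
            = - trace (w a) * state_value ?H f p (insert_matrices f Z w)"
          using state_value_remove_loop[of a "insert_matrices f Z w"] reversible_insert[OF less.prems(3,6)] True pa wa a by simp
        then show ?thesis using IH(3)[OF pZ(1), of Z] pZ(2) by simp
      qed
      then show ?thesis using IH(1,2) by blast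
    next
      case False
      let ?u = "f a" and ?v = "f b"
      let ?f = "f(?u := ?v, ?v := ?u)" and ?w = "w(?u := w ?u ** w b, ?v := w ?v ** w a)"
      let ?p = "\<lambda>x. if x \<in> Q then f x else p\<^sub>0 x"
      have aH: "a \<in> H" and bH: "b \<in> H" using a b by simp_all
      have F: "fpf_involution ?H ?f" "reversible ?H ?f ?w"
        using p0.contraction_fpf(1)[OF aH] p0.state_value_contract(1)[OF aH _ less.prems(6)] False
        by (simp_all add: b_def)
      obtain R f0 w0 where IH: "fpf_involution Q f0" "reversible Q f0 w0"
          "\<And>p Z. fpf_involution Q p \<Longrightarrow> \<forall>x\<in>?H - Q. p x = p\<^sub>0 x \<and> Z x = mat 1 \<Longrightarrow>
            state_value ?H ?f p (insert_matrices ?f Z ?w) = R * state_value Q f0 p (insert_matrices f0 Z w0)"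
        using less.hyps[OF smaller finite_Diff[OF less.prems(1)] Q F(1) fp0(2,1) F(2)] by blast
      have "state_value H f p (insert_matrices f Z w) = state_value ?H ?f p (insert_matrices ?f Z ?w)"
        if pZ: "fpf_involution Q p" "\<forall>x\<in>H - Q. p x = p\<^sub>0 x \<and> Z x = mat 1" for p Z
      proof -
        interpret matching_pair H f p
          by unfold_locales (use less.prems fp[OF pZ] in simp_all)
        have pa: "p a = b" using pZ(2) a b_def by simp
        have fa: "f a \<noteq> p a" using False pa by simp
        have rev: "reversible H f (insert_matrices f Z w)" by (rule reversible_insert[OF less.prems(3,6)])
        interpret c: matching_pair ?H ?f p
          by unfold_locales (use less.prems(1) contraction_fpf[OF aH fa, unfolded pa] in simp_all)
        have neq: "?u \<noteq> a" "?v \<noteq> b" "?v \<noteq> a" "?u \<noteq> ?v" "?u \<noteq> b"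
          using f_neq aH bH b(2) False f_f by metis+
        have Z1: "Z a = mat 1" "Z b = mat 1" using pZ(2) a b by auto
        have ff: "f ?u = a" "f ?v = b" using aH bH by auto
        have "state_value ?H ?f p ((insert_matrices f Z w)(?u := insert_matrices f Z w ?u ** insert_matrices f Z w b,
              ?v := insert_matrices f Z w ?v ** insert_matrices f Z w a))
          = state_value ?H ?f p (insert_matrices ?f Z ?w)"
        proof (rule c.state_value_cong)
          fix x assume x: "x \<in> ?H"
          consider "x = ?u" | "x = ?v" | "x \<noteq> ?u" "x \<noteq> ?v" by blast
          then show "((insert_matrices f Z w)(?u := insert_matrices f Z w ?u ** insert_matrices f Z w b,
              ?v := insert_matrices f Z w ?v ** insert_matrices f Z w a)) x = insert_matrices ?f Z ?w x"
            by cases (use neq Z1 ff in \<open>simp_all add: insert_matrices_def matrix_mul_assoc\<close>)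
        qed
        then show ?thesis using state_value_contract(2)[OF aH fa rev, unfolded pa] by simp
      qed
      then show ?thesis using IH by (intro exI[of _ R] exI[of _ f0] exI[of _ w0]) auto
    qed
  qed
qed

lemma state_value_two:
  assumes "a \<noteq> b" "f a = b" "f b = a" "p a = b" "p b = a" "reversible {a, b} f w"
  shows "state_value {a, b} f p w = - trace (w a)"
proof -
  interpret matching_pair "{a, b}" f p
    by unfold_locales (use assms in \<open>auto simp: fpf_involution_def\<close>)
  have "{a, b} - {a, p a} = {}" using assms by auto
  then show ?thesis using state_value_remove_loop[of a w] assms by simp
qed

text \<open>Two one-edge loops, whose signs cancel. When f and p differ on the four points there is
  a single loop and one sign survives.\<close>

lemma state_value_four_parallel:
  assumes "distinct [a, b, c, d]" "Q = {a, b, c, d}" "reversible Q f w"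
    and "p a = b" "p b = a" "p c = d" "p d = c" "f a = b" "f b = a" "f c = d" "f d = c"
  shows "state_value Q f p w = trace (w a) * trace (w c)"
proof -
  interpret matching_pair Q f p
    by unfold_locales (use assms(1,4-11) in \<open>auto simp: fpf_involution_def assms(2)\<close>)
  have "Q - {a, p a} = {c, d}" unfolding assms(2,4) using assms(1) by auto
  moreover have "reversible {c, d} f w" using assms(3) unfolding assms(2) by (simp add: reversible_def)
  ultimately show ?thesis
    using state_value_remove_loop[of a w] state_value_two[of c d f p w] assms by simp
qed

lemma state_value_four_crossed:
  assumes "distinct [a, b, c, d]" "Q = {a, b, c, d}" "reversible Q f w"
    and "p a = b" "p b = a" "p c = d" "p d = c" "f a = c" "f c = a" "f b = d" "f d = b"
  shows "state_value Q f p w = - trace (w c ** w b)"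
proof -
  interpret matching_pair Q f p
    by unfold_locales (use assms(1,4-11) in \<open>auto simp: fpf_involution_def assms(2)\<close>)
  let ?f = "f(c := d, d := c)" and ?w = "w(c := w c ** w b, d := w d ** w a)"
  have Q: "Q - {a, b} = {c, d}" unfolding assms(2) using assms(1) by auto
  have fa: "f a \<noteq> p a" unfolding assms(4,8) using assms(1) by auto
  have aQ: "a \<in> Q" by (simp add: assms(2))
  have "reversible {c, d} ?f ?w" "state_value Q f p w = state_value {c, d} ?f p ?w"
    using state_value_contract[OF aQ fa assms(3)] Q by (simp_all add: assms(4,8,10))
  moreover have "b \<noteq> c" "c \<noteq> d" using assms(1) by auto
  ultimately show ?thesis using state_value_two[of c d ?f p ?w] assms(1,6,7) by simp
qed

section \<open>The skein identity at four half-strands\<close>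

context su2_basis
begin

text \<open>The reduced f is again one of the three matchings of four points. Writing V for the
  state values, in each case V(p) + V(p2) + V(p3) = 0 by Cayley-Hamilton, and the contracted
  insertion equals - V(p2) - V(p) / 2 by the Casimir identities. Eliminating V(p) produces k2 and
  k3.\<close>

lemma skein_four:
  assumes dist: "distinct [a, b, c, d]" and Q: "Q = {a, b, c, d}"
    and f: "fpf_involution Q f" and w: "reversible Q f w"
    and p: "p a = b" "p b = a" "p c = d" "p d = c"
    and p2: "p2 a = d" "p2 d = a" "p2 b = c" "p2 c = b"
    and p3: "p3 a = c" "p3 c = a" "p3 b = d" "p3 d = b"
    and k2: "k2 = - x / 2 - y" and k3: "k3 = x / 2 - y"
  shows "y * state_value Q f p w
      + x * (\<Sum>\<alpha>\<in>UNIV. \<Sum>\<beta>\<in>UNIV. G \<alpha> \<beta> *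
          state_value Q f p (insert_matrices f ((\<lambda>x. mat 1)(a := e \<alpha>, c := e \<beta>)) w))
    = k2 * state_value Q f p2 w + k3 * state_value Q f p3 w"
proof -
  let ?w = "\<lambda>\<alpha> \<beta>. insert_matrices f ((\<lambda>x. mat 1)(a := e \<alpha>, c := e \<beta>)) w"
  have rev: "reversible Q f (?w \<alpha> \<beta>)" for \<alpha> \<beta> by (rule reversible_insert[OF f w])
  have dd: "a \<noteq> b" "a \<noteq> c" "a \<noteq> d" "b \<noteq> c" "b \<noteq> d" "c \<noteq> d" using dist by auto
  have fQ: "f v \<in> Q \<and> f v \<noteq> v \<and> f (f v) = v" if "v \<in> Q" for v using f that by (simp add: fpf_involution_def)
  \<comment> \<open>An insertion read from the reversed edge changes sign. With the signs of the
    loops this gives the same relation in all three cases.\<close>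
  have ade: "adjugate (e \<alpha>) = - e \<alpha>" for \<alpha> by (rule adjugate_traceless[OF trace_e])
  have neg: "(- M) ** N = - (M ** N)" "M ** (- N) = - (M ** N)" for M N :: "complex^2^2"
    by (simp_all add: matrix2_expand)
  have trn: "trace (- M) = - trace M" for M :: "complex^2^2" by (simp add: matrix2_expand)
  have "f a = b \<or> f a = c \<or> f a = d" using fQ[of a] Q by auto
  then consider (1) "f a = b" "f b = a" "f c = d" "f d = c"
    | (2) "f a = c" "f c = a" "f b = d" "f d = b"
    | (3) "f a = d" "f d = a" "f b = c" "f c = b"
    using fQ[of a] fQ[of b] fQ[of c] fQ[of d] Q dd by (elim disjE) auto
  then show ?thesis
  proof cases
    case 1
    have wb: "w b = adjugate (w a)" "w d = adjugate (w c)"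
      using w Q 1 unfolding reversible_def by (metis insertCI)+
    have v1: "state_value Q f p w = trace (w a) * trace (w c)"
      by (rule state_value_four_parallel[OF dist Q w]) (use 1 p in auto)
    have v2: "state_value Q f p2 w = - trace (w c ** w a)"
      by (rule state_value_four_crossed[of d a c b]) (use 1 p2 dd Q w in auto)
    have v3: "state_value Q f p3 w = - trace (w d ** w a)"
      by (rule state_value_four_crossed[of c a d b]) (use 1 p3 dd Q w in auto)
    have v4: "state_value Q f p (?w \<alpha> \<beta>) = trace (e \<alpha> ** w a) * trace (e \<beta> ** w c)" for \<alpha> \<beta>
      by (subst state_value_four_parallel[OF dist Q rev])
        (use 1 p dd in \<open>auto simp: insert_matrices_def\<close>)
    show ?thesis
      unfolding v1 v2 v3 v4 casimir_two_traces wb trace_adjugate_mult k2 k3 trace_mult_commute[of "w c" "w a"]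
      by (simp add: algebra_simps)
  next
    case 2
    have wb: "w d = adjugate (w b)" "w a = adjugate (w c)"
      using w Q 2 unfolding reversible_def by (metis insertCI)+
    have v1: "state_value Q f p w = - trace (w c ** w b)"
      by (rule state_value_four_crossed[OF dist Q w]) (use 2 p in auto)
    have v2: "state_value Q f p2 w = - trace (w c ** w d)"
      by (rule state_value_four_crossed[of a d c b]) (use 2 p2 dd Q w in auto)
    have v3: "state_value Q f p3 w = trace (w a) * trace (w b)"
      by (rule state_value_four_parallel[of a c b d]) (use 2 p3 dd Q w in auto)
    have v4: "state_value Q f p (?w \<alpha> \<beta>) = trace (e \<alpha> ** w b ** e \<beta> ** w c)" for \<alpha> \<beta>
    proof -
      have "state_value Q f p (?w \<alpha> \<beta>) = trace ((e \<beta> ** w c) ** (e \<alpha> ** w b))"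
        by (subst state_value_four_crossed[OF dist Q rev])
          (use 2 p dd in \<open>auto simp: insert_matrices_def ade neg trn matrix_mul_assoc\<close>)
      then show ?thesis using trace_mult_commute[of "e \<beta> ** w c" "e \<alpha> ** w b"] by (simp add: matrix_mul_assoc)
    qed
    show ?thesis
      unfolding v1 v2 v3 v4 casimir_one_trace wb trace_mult_adjugate trace_adjugate k2 k3 trace_mult_commute[of "w c" "w b"]
      by (simp add: algebra_simps)
  next
    case 3
    have wb: "w c = adjugate (w b)" "w a = adjugate (w d)"
      using w Q 3 unfolding reversible_def by (metis insertCI)+
    have v1: "state_value Q f p w = - trace (w d ** w b)"
      by (rule state_value_four_crossed[of a b d c]) (use 3 p dd Q w in auto)
    have v2: "state_value Q f p2 w = trace (w a) * trace (w b)"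
      by (rule state_value_four_parallel[of a d b c]) (use 3 p2 dd Q w in auto)
    have v3: "state_value Q f p3 w = - trace (w d ** w c)"
      by (rule state_value_four_crossed[of a c d b]) (use 3 p3 dd Q w in auto)
    have v4: "state_value Q f p (?w \<alpha> \<beta>) = - trace (e \<alpha> ** w b ** e \<beta> ** w d)" for \<alpha> \<beta>
    proof -
      have "state_value Q f p (?w \<alpha> \<beta>) = - trace ((w d ** e \<alpha>) ** (w b ** e \<beta>))"
        by (subst state_value_four_crossed[of a b d c])
          (use 3 p dd Q rev in \<open>auto simp: insert_matrices_def ade neg trn matrix_mul_assoc\<close>)
      also have "trace ((w d ** e \<alpha>) ** (w b ** e \<beta>)) = trace (w d ** (e \<alpha> ** w b ** e \<beta>))"
        by (simp add: matrix_mul_assoc)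
      finally show ?thesis unfolding trace_mult_commute[of "w d" "e \<alpha> ** w b ** e \<beta>"] .
    qed
    show ?thesis
      unfolding v1 v2 v3 v4 mult_minus_right sum_negf casimir_one_trace wb trace_mult_adjugate trace_adjugate k2 k3 trace_mult_commute[of "w d" "w b"]
      by (simp add: algebra_simps)
  qed
qed

text \<open>p, p2, p3 and the insertions differ only on the four half-strands, so
  \<open>state_value_reduce\<close> gives all terms the same factor R.\<close>

lemma skein_state_value:
  assumes fin: "finite H" and f: "fpf_involution H f" and w: "reversible H f w"
    and p: "fpf_involution H p" and dist: "distinct [a, b, c, d]" and Q: "{a, b, c, d} \<subseteq> H"
    and pQ: "p a = b" "p c = d"
    and p2: "p2 a = d" "p2 d = a" "p2 b = c" "p2 c = b" "\<And>v. v \<in> H - {a, b, c, d} \<Longrightarrow> p2 v = p v"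
    and p3: "p3 a = c" "p3 c = a" "p3 b = d" "p3 d = b" "\<And>v. v \<in> H - {a, b, c, d} \<Longrightarrow> p3 v = p v"
    and k2: "k2 = - x / 2 - y" and k3: "k3 = x / 2 - y"
  shows "y * state_value H f p w
      + x * (\<Sum>\<alpha>\<in>UNIV. \<Sum>\<beta>\<in>UNIV. G \<alpha> \<beta> *
          state_value H f p (insert_matrices f ((\<lambda>x. mat 1)(a := e \<alpha>, c := e \<beta>)) w))
    = k2 * state_value H f p2 w + k3 * state_value H f p3 w"
proof -
  let ?Q = "{a, b, c, d}"
  have pba: "p b = a" "p d = c" using p pQ Q unfolding fpf_involution_def by auto
  have pH: "fpf_involution (H - ?Q) p"
    unfolding fpf_involution_def
  proof
    fix v assume v: "v \<in> H - ?Q"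
    have 1: "p v \<in> H \<and> p v \<noteq> v \<and> p (p v) = v" using p v by (simp add: fpf_involution_def)
    have "p v \<notin> ?Q"
    proof
      assume "p v \<in> ?Q"
      then have "p (p v) \<in> ?Q" using pQ pba by auto
      then show False using 1 v by simp
    qed
    then show "p v \<in> H - ?Q \<and> p v \<noteq> v \<and> p (p v) = v" using 1 by simp
  qed
  obtain R f0 w0 where f0: "fpf_involution ?Q f0" "reversible ?Q f0 w0" and
    R0: "\<forall>p' Z. fpf_involution ?Q p' \<longrightarrow> (\<forall>v\<in>H - ?Q. p' v = p v \<and> Z v = mat 1) \<longrightarrow>
      state_value H f p' (insert_matrices f Z w) = R * state_value ?Q f0 p' (insert_matrices f0 Z w0)"
    using state_value_reduce[OF fin Q f p pH w] by (elim exE conjE) (rule that)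
  have R: "state_value H f p' (insert_matrices f Z w) = R * state_value ?Q f0 p' (insert_matrices f0 Z w0)"
    if "fpf_involution ?Q p'" "\<forall>v\<in>H - ?Q. p' v = p v \<and> Z v = mat 1" for p' Z
    by (rule R0[THEN spec, THEN spec, THEN mp, OF that(1), THEN mp, OF that(2)])
  have dd: "a \<noteq> b" "a \<noteq> c" "a \<noteq> d" "b \<noteq> c" "b \<noteq> d" "c \<noteq> d" using dist by auto
  have fQ: "fpf_involution ?Q p" "fpf_involution ?Q p2" "fpf_involution ?Q p3"
    using dd dd[symmetric] by (simp_all add: fpf_involution_def pQ pba p2(1-4) p3(1-4))
  have one: "state_value H f p' w = R * state_value ?Q f0 p' w0"
    if "fpf_involution ?Q p'" "\<And>v. v \<in> H - ?Q \<Longrightarrow> p' v = p v" for p'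
    using R[OF that(1), of "\<lambda>v. mat 1"] that(2) by simp
  have ins: "state_value H f p (insert_matrices f ((\<lambda>x. mat 1)(a := e \<alpha>, c := e \<beta>)) w)
      = R * state_value ?Q f0 p (insert_matrices f0 ((\<lambda>x. mat 1)(a := e \<alpha>, c := e \<beta>)) w0)" for \<alpha> \<beta>
    by (rule R[OF fQ(1)]) auto
  have one2: "state_value H f p2 w = R * state_value ?Q f0 p2 w0" by (rule one[OF fQ(2)]) (rule p2(5))
  have one3: "state_value H f p3 w = R * state_value ?Q f0 p3 w0" by (rule one[OF fQ(3)]) (rule p3(5))
  note four = skein_four[OF dist refl f0, of p p2 p3 k2 x y k3]
  have "y * state_value ?Q f0 p w0
      + x * (\<Sum>\<alpha>\<in>UNIV. \<Sum>\<beta>\<in>UNIV. G \<alpha> \<beta> *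
          state_value ?Q f0 p (insert_matrices f0 ((\<lambda>x. mat 1)(a := e \<alpha>, c := e \<beta>)) w0))
    = k2 * state_value ?Q f0 p2 w0 + k3 * state_value ?Q f0 p3 w0"
    using four pQ pba p2 p3 k2 k3 by simp
  from arg_cong[OF this, of "\<lambda>t. R * t"] show ?thesis
    unfolding ins one[OF fQ(1) refl] one2 one3
    by (simp add: algebra_simps sum_distrib_left)
qed

end

section \<open>Holonomy\<close>

lemma bounded_bilinear_matrix2: "bounded_bilinear (\<lambda>(M :: complex^2^2) (N :: complex^2^2). M ** N)"
proof -
  have "bilinear (\<lambda>(M :: complex^2^2) (N :: complex^2^2). M ** N)"
    unfolding bilinear_def
    by (auto intro!: linearI simp: matrix2_expand algebra_simps)
  then show ?thesis by (simp add: bilinear_conv_bounded_bilinear)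
qed

lemma bounded_linear_adjugate: "bounded_linear adjugate"
  unfolding linear_conv_bounded_linear[symmetric]
  by (rule linearI) (simp_all add: adjugate_add adjugate_def matrix2_expand algebra_simps)

section \<open>The parallel transport equation: existence, uniqueness, reversal\<close>

definition solves :: "(real \<Rightarrow> complex^2^2) \<Rightarrow> real \<Rightarrow> (real \<Rightarrow> complex^2^2) \<Rightarrow> bool" where
  "solves B L U \<longleftrightarrow> U 0 = mat 1 \<and>
     (\<forall>t\<in>{0..L}. (U has_vector_derivative U t ** B t) (at t within {0..L}))"

text \<open>The solution is the Dyson series: P n is the n-fold iterated integral, bounded by a
  multiple of (k c t)^n / n!, where k bounds matrix multiplication and c bounds B. The series
  converges uniformly and may be differentiated term by term.\<close>

lemma solves_exists:
  assumes B: "continuous_on {0..L} B" and L: "0 \<le> L"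
  shows "\<exists>U. solves B L U"
proof -
  interpret M: bounded_bilinear "\<lambda>(M :: complex^2^2) (N :: complex^2^2). M ** N" by (rule bounded_bilinear_matrix2)
  obtain k where k: "0 < k" "\<And>(M :: complex^2^2) (N :: complex^2^2). norm (M ** N) \<le> norm M * norm N * k"
    using M.pos_bounded by blast
  have "bounded (B ` {0..L})" using B by (intro compact_imp_bounded compact_continuous_image) auto
  then obtain c where c: "0 < c" "\<And>t. t \<in> {0..L} \<Longrightarrow> norm (B t) \<le> c"
    unfolding bounded_pos by auto
  define P where "P = rec_nat (\<lambda>t. mat 1) (\<lambda>n p t. integral {0..t} (\<lambda>s. p s ** B s))"
  have P0: "P 0 = (\<lambda>t. mat 1)" and PS: "P (Suc n) = (\<lambda>t. integral {0..t} (\<lambda>s. P n s ** B s))" for n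
    by (simp_all add: P_def)
  have PP: "continuous_on {0..L} (P n) \<and>
      (\<forall>t\<in>{0..L}. (P (Suc n) has_vector_derivative P n t ** B t) (at t within {0..L}))" for n
  proof (induction n)
    case 0
    have "continuous_on {0..L} (\<lambda>s. P 0 s ** B s)" unfolding P0 by (intro M.continuous_on continuous_intros B)
    then show ?case unfolding PS by (simp add: P0 integral_has_vector_derivative)
  next
    case (Suc n)
    then have cont: "continuous_on {0..L} (P (Suc n))"
      by (meson continuous_on_eq_continuous_within has_vector_derivative_continuous)
    then have "continuous_on {0..L} (\<lambda>s. P (Suc n) s ** B s)" by (intro M.continuous_on B)
    then have "\<forall>t\<in>{0..L}. (P (Suc (Suc n)) has_vector_derivative P (Suc n) t ** B t) (at t within {0..L})"
      unfolding PS[of "Suc n"] by (intro ballI integral_has_vector_derivative)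
    then show ?case using cont by simp
  qed
  define e0 where "e0 = norm (mat 1 :: complex^2^2)"
  have bound: "norm (P n t) \<le> e0 * (k * c * t) ^ n / fact n" if "t \<in> {0..L}" for n t
    using that
  proof (induction n arbitrary: t)
    case 0 then show ?case by (simp add: P0 e0_def)
  next
    case (Suc n)
    let ?F = "\<lambda>s. e0 * (k * c) ^ Suc n * s ^ Suc n / fact (Suc n)"
    let ?G = "\<lambda>s. e0 * (k * c) ^ Suc n * s ^ n / fact n"
    have dF: "(?F has_vector_derivative ?G s) (at s within {0..t})" for s
    proof -
      let ?c = "e0 * (k * c) ^ Suc n / fact (Suc n)"
      have "((\<lambda>s. s ^ Suc n) has_field_derivative of_nat (Suc n) * s ^ n) (at s within {0..t})"
        using has_field_derivative_at_within[OF DERIV_pow[of "Suc n" s]] by simp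
      from DERIV_cmult[OF this, of ?c]
      have "((\<lambda>s. ?c * s ^ Suc n) has_field_derivative ?c * (of_nat (Suc n) * s ^ n)) (at s within {0..t})" .
      moreover have "?c * (of_nat (Suc n) * s ^ n) = ?G s"
        by (simp add: fact_Suc del: of_nat_Suc power_Suc)
      moreover have "(\<lambda>s. ?c * s ^ Suc n) = ?F" by (simp add: fun_eq_iff)
      ultimately have "(?F has_field_derivative ?G s) (at s within {0..t})" by metis
      then show ?thesis by (rule has_real_derivative_iff_has_vector_derivative[THEN iffD1])
    qed
    have int: "(?G has_integral (?F t - ?F 0)) {0..t}"
      by (rule fundamental_theorem_of_calculus) (use Suc.prems dF in auto)
    have sub: "{0..t} \<subseteq> {0..L}" using Suc.prems by auto
    have "continuous_on {0..t} (\<lambda>s. P n s ** B s)"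
      by (intro M.continuous_on continuous_on_subset[OF _ sub] conjunct1[OF PP] B)
    then have intP: "(\<lambda>s. P n s ** B s) integrable_on {0..t}" by (rule integrable_continuous_interval)
    have "norm (P (Suc n) t) \<le> integral {0..t} ?G"
      unfolding PS
    proof (rule integral_norm_bound_integral[OF intP has_integral_integrable[OF int]])
      fix s assume s: "s \<in> {0..t}"
      have "norm (P n s ** B s) \<le> norm (P n s) * norm (B s) * k" by (rule k(2))
      also have "\<dots> \<le> (e0 * (k * c * s) ^ n / fact n) * c * k"
        using Suc.IH[of s] c(2)[of s] s sub k(1) c(1)
        by (intro mult_right_mono mult_mono divide_nonneg_pos mult_nonneg_nonneg zero_le_power) (auto simp: e0_def)
      also have "\<dots> = ?G s" by (simp add: power_mult_distrib algebra_simps)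
      finally show "norm (P n s ** B s) \<le> ?G s" .
    qed
    also have "integral {0..t} ?G = ?F t" using integral_unique[OF int] by simp
    also have "\<dots> = e0 * (k * c * t) ^ Suc n / fact (Suc n)" by (simp add: power_mult_distrib algebra_simps)
    finally show ?case .
  qed
  define S where "S t = (\<Sum>n. P n t)" for t
  let ?m = "\<lambda>n. e0 * ((k * c * L) ^ n / fact n)"
  have sm: "summable ?m"
    using summable_exp[of "k * c * L"] by (intro summable_mult) (simp add: field_simps)
  have pm: "norm (P n t) \<le> ?m n" if t: "t \<in> {0..L}" for n t
  proof -
    have "(k * c * t) ^ n \<le> (k * c * L) ^ n"
      using t k(1) c(1) by (intro power_mono mult_left_mono) auto
    then have "e0 * (k * c * t) ^ n / fact n \<le> ?m n"
      by (simp add: e0_def divide_right_mono mult_left_mono)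
    then show ?thesis using bound[OF t] order_trans by blast
  qed
  have unif: "uniform_limit {0..L} (\<lambda>n t. \<Sum>i<n. P i t) S sequentially"
    unfolding S_def[abs_def] by (rule Weierstrass_m_test[OF pm sm])
  have sums: "(\<lambda>n. P n t) sums S t" if "t \<in> {0..L}" for t
    unfolding S_def
    by (rule summable_sums, rule summable_comparison_test'[OF sm, of 0]) (rule pm[OF that])
  \<comment> \<open>The derivative of term \<open>Suc m\<close> is \<open>P m ** B\<close>, that of
    term 0 vanishes. The first n derivatives thus sum to n - 1 terms times B, whence
    \<open>Suc n0\<close> below.\<close>
  define P' where "P' n t h = h *\<^sub>R (case n of 0 \<Rightarrow> 0 | Suc m \<Rightarrow> P m t ** B t)" for n t and h :: real
  have "\<exists>g. \<forall>t\<in>{0..L}. (\<lambda>n. P n t) sums g t \<and>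
      (g has_derivative (\<lambda>h. h *\<^sub>R (S t ** B t))) (at t within {0..L})"
  proof (rule has_derivative_series[where f' = P' and x = 0])
    show "convex {0..L}" by simp
    show "(P n has_derivative P' n t) (at t within {0..L})" if "t \<in> {0..L}" for n t
      using PP[of "n - 1"] that
      by (cases n) (auto simp: P'_def[abs_def] P0 has_vector_derivative_def)
    show "\<forall>\<^sub>F n in sequentially. \<forall>t\<in>{0..L}. \<forall>h.
        norm ((\<Sum>i<n. P' i t h) - h *\<^sub>R (S t ** B t)) \<le> e * norm h" if e: "0 < e" for e
    proof -
      have "\<forall>\<^sub>F n in sequentially. \<forall>t\<in>{0..L}. dist (\<Sum>i<n. P i t) (S t) < e / (c * k)"
        using unif e c(1) k(1) unfolding uniform_limit_iff by simp
      then obtain n0 where n0: "\<And>n t. n \<ge> n0 \<Longrightarrow> t \<in> {0..L} \<Longrightarrow> norm ((\<Sum>i<n. P i t) - S t) < e / (c * k)"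
        unfolding eventually_sequentially dist_norm by blast
      have "norm ((\<Sum>i<n. P' i t h) - h *\<^sub>R (S t ** B t)) \<le> e * norm h"
        if n: "n \<ge> Suc n0" and t: "t \<in> {0..L}" for n t h
      proof -
        obtain m where m: "n = Suc m" "m \<ge> n0" using n by (cases n) auto
        have "(\<Sum>i<n. P' i t h) = h *\<^sub>R ((\<Sum>i<m. P i t) ** B t)"
          unfolding m by (simp add: sum.lessThan_Suc_shift P'_def M.sum_left scaleR_sum_right del: sum.lessThan_Suc)
        then have "norm ((\<Sum>i<n. P' i t h) - h *\<^sub>R (S t ** B t)) = \<bar>h\<bar> * norm (((\<Sum>i<m. P i t) - S t) ** B t)"
          by (simp add: M.diff_left scaleR_diff_right[symmetric])
        also have "\<dots> \<le> \<bar>h\<bar> * (norm ((\<Sum>i<m. P i t) - S t) * norm (B t) * k)"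
          by (intro mult_left_mono k(2)) auto
        also have "\<dots> \<le> \<bar>h\<bar> * (e / (c * k) * c * k)"
          using n0[OF m(2) t] c(2)[OF t] k(1) c(1) e by (intro mult_left_mono mult_right_mono mult_mono) auto
        also have "\<dots> = e * norm h" using c(1) k(1) by simp
        finally show ?thesis .
      qed
      then show ?thesis unfolding eventually_sequentially by blast
    qed
    show "0 \<in> {0..L}" using L by simp
    show "(\<lambda>n. P n 0) sums S 0" using sums L by simp
  qed
  then obtain g where g: "\<And>t. t \<in> {0..L} \<Longrightarrow> (\<lambda>n. P n t) sums g t"
      "\<And>t. t \<in> {0..L} \<Longrightarrow> (g has_derivative (\<lambda>h. h *\<^sub>R (S t ** B t))) (at t within {0..L})" by blast
  have gS: "g t = S t" if "t \<in> {0..L}" for t using g(1) sums that by (metis sums_unique2)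
  have "(\<lambda>n. P n 0) = (\<lambda>n. if n = 0 then mat 1 else 0)"
  proof
    fix n show "P n 0 = (if n = 0 then mat 1 else 0)" by (cases n) (simp_all add: P0 PS)
  qed
  then have "(\<lambda>n. P n 0) sums mat 1" using sums_single[of 0 "\<lambda>n. mat 1 :: complex^2^2"] by simp
  then have "g 0 = mat 1" using g(1)[of 0] L by (metis atLeastAtMost_iff order_refl sums_unique2)
  then have "solves B L g" unfolding solves_def has_vector_derivative_def using g(2) gS by simp
  then show ?thesis by blast
qed

text \<open>For traceless B, \<open>adjugate (V ** B)\<close> is \<open>- (B ** adjugate V)\<close>,
  so the two terms in the derivative of \<open>U ** adjugate V\<close> cancel. For V = U this
  inverts a solution.\<close>

lemma solves_mult_adjugate:
  assumes U: "solves B L U" and V: "solves B L V" and tr: "\<And>t. t \<in> {0..L} \<Longrightarrow> trace (B t) = 0"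
    and t: "t \<in> {0..L}"
  shows "U t ** adjugate (V t) = mat 1"
proof -
  interpret M: bounded_bilinear "\<lambda>(M :: complex^2^2) (N :: complex^2^2). M ** N" by (rule bounded_bilinear_matrix2)
  have "((\<lambda>t. U t ** adjugate (V t)) has_vector_derivative 0) (at t within {0..L})" if t: "t \<in> {0..L}" for t
  proof -
    have dU: "(U has_vector_derivative U t ** B t) (at t within {0..L})"
      using U t by (simp add: solves_def)
    have "((\<lambda>t. adjugate (V t)) has_vector_derivative adjugate (V t ** B t)) (at t within {0..L})"
      using V t by (intro bounded_linear.has_vector_derivative[OF bounded_linear_adjugate]) (simp add: solves_def)
    from M.has_vector_derivative[OF dU this]
    show ?thesis
      by (simp add: adjugate_mult adjugate_traceless[OF tr[OF t]] matrix_mul_assoc M.minus_left M.minus_right)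
  qed
  then obtain c where c: "\<And>s. s \<in> {0..L} \<Longrightarrow> U s ** adjugate (V s) = c"
    using has_vector_derivative_zero_constant[of "{0..L}" "\<lambda>t. U t ** adjugate (V t)"] by auto
  have "U 0 ** adjugate (V 0) = mat 1" using U V by (simp add: solves_def)
  then show ?thesis using c[of 0] c[OF t] t by simp
qed

lemma solves_unique:
  assumes "solves B L U" "solves B L V" "\<And>t. t \<in> {0..L} \<Longrightarrow> trace (B t) = 0" "t \<in> {0..L}"
  shows "U t = V t"
proof -
  have "U t ** (adjugate (V t) ** V t) = V t"
    using solves_mult_adjugate[OF assms(1,2,3,4)] by (simp add: matrix_mul_assoc)
  then show ?thesis
    using adjugate_inverse_comm[OF solves_mult_adjugate[OF assms(2,2,3,4)]] by simp
qed

text \<open>Reversed transport starts at the old endpoint, hence the normalisation by the inverse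
  \<open>adjugate (U L)\<close>. At t = L it takes exactly this value, because
  \<open>U 0 = mat 1\<close>.\<close>

lemma solves_reverse:
  assumes U: "solves B L U" and tr: "\<And>t. t \<in> {0..L} \<Longrightarrow> trace (B t) = 0" and L: "0 \<le> L"
    and B': "\<And>t. t \<in> {0..L} \<Longrightarrow> B' t = - B (L - t)"
  shows "solves B' L (\<lambda>t. adjugate (U L) ** U (L - t))"
proof -
  interpret M: bounded_bilinear "\<lambda>(M :: complex^2^2) (N :: complex^2^2). M ** N" by (rule bounded_bilinear_matrix2)
  have "adjugate (U L) ** U (L - 0) = mat 1"
    using adjugate_inverse_comm[OF solves_mult_adjugate[OF U U tr, of L]] L by simp
  moreover have "((\<lambda>t. adjugate (U L) ** U (L - t)) has_vector_derivative
      (adjugate (U L) ** U (L - t)) ** B' t) (at t within {0..L})" if t: "t \<in> {0..L}" for t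
  proof -
    have "(U has_vector_derivative U (L - t) ** B (L - t)) (at (L - t) within (\<lambda>t. L - t) ` {0..L})"
      using U t by (simp add: solves_def)
    then have "((U \<circ> (\<lambda>t. L - t)) has_vector_derivative (-1) *\<^sub>R (U (L - t) ** B (L - t))) (at t within {0..L})"
      by (intro vector_diff_chain_within) (auto intro!: derivative_eq_intros)
    then have "((\<lambda>t. U (L - t)) has_vector_derivative U (L - t) ** B' t) (at t within {0..L})"
      by (simp add: o_def B'[OF t] M.minus_right)
    from bounded_linear.has_vector_derivative[OF M.bounded_linear_right this]
    show ?thesis by (simp add: matrix_mul_assoc)
  qed
  ultimately show ?thesis unfolding solves_def by blast
qed

definition pulled_back :: "(real^2 \<Rightarrow> real^2 \<Rightarrow> complex^2^2) \<Rightarrow> (real \<Rightarrow> real^2) \<Rightarrow> real \<Rightarrow> complex^2^2" where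
  "pulled_back A g t = A (g t) (vector_derivative g (at t))"

text \<open>Uniqueness of solutions makes the description in \<open>path_holonomy\<close>
  definite.\<close>

lemma path_holonomy_eq:
  assumes U: "solves (pulled_back A g) L U" and A: "is_connection A" and L: "0 \<le> L"
  shows "path_holonomy A g L = U L"
proof -
  have tr: "trace (pulled_back A g t) = 0" for t
    using A by (simp add: pulled_back_def is_connection_def su2_trace)
  show ?thesis
    unfolding path_holonomy_def
  proof (rule the_equality)
    show "\<exists>V. V 0 = mat 1 \<and> V L = U L \<and> (\<forall>t\<in>{0..L}. (V has_vector_derivative
        V t ** A (g t) (vector_derivative g (at t))) (at t within {0..L}))"
      using U by (intro exI[of _ U]) (simp add: solves_def pulled_back_def)
  next
    fix X assume "\<exists>V. V 0 = mat 1 \<and> V L = X \<and> (\<forall>t\<in>{0..L}. (V has_vector_derivative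
        V t ** A (g t) (vector_derivative g (at t))) (at t within {0..L}))"
    then obtain V where "solves (pulled_back A g) L V" "V L = X"
      by (auto simp: solves_def pulled_back_def)
    then show "X = U L" using solves_unique[OF _ U tr, of V L] L by simp
  qed
qed

lemma path_holonomy_reverse:
  assumes A: "is_connection A" and L: "0 \<le> L" and cont: "continuous_on {0..L} (pulled_back A g)"
    and g: "\<And>t. g differentiable (at t)" and h: "\<And>t. h t = g (L - t)"
  shows "path_holonomy A h L = adjugate (path_holonomy A g L)"
proof -
  obtain U where U: "solves (pulled_back A g) L U" using solves_exists[OF cont L] by blast
  have tr: "trace (pulled_back A g t) = 0" for t
    using A by (simp add: pulled_back_def is_connection_def su2_trace)
  have "pulled_back A h t = - pulled_back A g (L - t)" for t
  proof -
    have "(g has_vector_derivative vector_derivative g (at (L - t))) (at (L - t))"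
      using g by (simp add: vector_derivative_works)
    then have "((g \<circ> (\<lambda>t. L - t)) has_vector_derivative (-1) *\<^sub>R vector_derivative g (at (L - t))) (at t)"
      by (intro vector_diff_chain_at) (auto intro!: derivative_eq_intros)
    moreover have "g \<circ> (\<lambda>t. L - t) = h" using h by (simp add: fun_eq_iff)
    ultimately have "vector_derivative h (at t) = - vector_derivative g (at (L - t))"
      by (simp add: vector_derivative_at)
    moreover have "A (h t) (- v) = - A (h t) v" for v
      using A by (simp add: is_connection_def linear_neg)
    ultimately show ?thesis by (simp add: pulled_back_def h)
  qed
  then have "solves (pulled_back A h) L (\<lambda>t. adjugate (U L) ** U (L - t))"
    by (intro solves_reverse[OF U tr L]) simp
  from path_holonomy_eq[OF this A L] path_holonomy_eq[OF U A L]
  show ?thesis using U by (simp add: solves_def)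
qed

lemma pulled_back_continuous:
  assumes A: "is_connection A" and g: "\<And>t. (g has_vector_derivative g' t) (at t)"
    and g': "continuous_on UNIV g'"
  shows "continuous_on S (pulled_back A g)"
proof -
  have lin: "linear (A p)" for p using A by (simp add: is_connection_def)
  have Acont: "continuous_on UNIV (\<lambda>p. A p v)" for v
    using A unfolding is_connection_def smooth_def by (metis times_continuously_differentiable.simps(1))
  have gcont: "continuous_on UNIV g"
    using has_vector_derivative_continuous[OF g] by (simp add: continuous_on_eq_continuous_at)
  \<comment> \<open>A is known to be continuous in the point for a fixed tangent vector only, so the
    velocity is expanded in the standard basis.\<close>
  have "pulled_back A g t = (\<Sum>i\<in>UNIV. (g' t $ i) *\<^sub>R A (g t) (axis i 1))" for t
  proof -
    have "pulled_back A g t = A (g t) (g' t)"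
      by (simp add: pulled_back_def vector_derivative_at[OF g])
    also have "g' t = (\<Sum>i\<in>UNIV. (g' t $ i) *\<^sub>R axis i 1)"
      by (simp add: vec_eq_iff axis_def if_distrib cong: if_cong)
    finally show ?thesis by (simp add: linear_sum[OF lin] linear_scale[OF lin])
  qed
  moreover have "continuous_on UNIV (\<lambda>t. \<Sum>i\<in>UNIV. (g' t $ i) *\<^sub>R A (g t) (axis i 1))"
    by (intro continuous_intros g' continuous_on_compose2[OF Acont gcont]) auto
  ultimately have "continuous_on UNIV (pulled_back A g)" by simp
  then show ?thesis using continuous_on_subset by blast
qed

section \<open>The half-strands of a diagram\<close>

locale diagram =
  fixes K :: link_diagram
  assumes diagram: "is_link_diagram K"
begin

lemma smooth_curve: "c < ncurves K \<Longrightarrow> smooth (curve K c)"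
  and curve_period_1: "c < ncurves K \<Longrightarrow> curve K c (t + 1) = curve K c t"
  using diagram by (simp_all add: is_link_diagram_def)

lemma positions_distinct: "i < ncross K \<Longrightarrow> j < ncross K \<Longrightarrow> i \<noteq> j \<Longrightarrow>
    position K (over K i) \<noteq> position K (over K j)"
  using diagram unfolding is_link_diagram_def by (elim conjE) blast

lemma crossing:
  assumes "i < ncross K"
  shows "over K i \<in> points K" "under K i \<in> points K" "over K i \<noteq> under K i"
    "position K (over K i) = position K (under K i)"
    "area (velocity K (over K i)) (velocity K (under K i)) \<noteq> 0"
  using diagram assms by (simp_all add: is_link_diagram_def)

lemma crossing_distinct:
  assumes i: "i < ncross K" and j: "j < ncross K" and p: "p \<in> {over K i, under K i}" "p \<in> {over K j, under K j}"
  shows "i = j"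
proof (rule ccontr)
  assume "i \<noteq> j"
  then have "position K (over K i) \<noteq> position K (over K j)"
    using positions_distinct[OF i j] by simp
  moreover have "position K p = position K (over K i)" "position K p = position K (over K j)"
    using p crossing(4)[OF i] crossing(4)[OF j] by auto
  ultimately show False by simp
qed

lemma over_neq_under:
  assumes "i < ncross K" "j < ncross K"
  shows "over K i \<noteq> under K j" "under K j \<noteq> over K i"
  using crossing_distinct[OF assms, of "over K i"] crossing(3)[OF assms(1)] by auto

lemma curve_derivative:
  assumes c: "c < ncurves K"
  shows "(curve K c has_vector_derivative vector_derivative (curve K c) (at t)) (at t)"
    and "continuous_on UNIV (\<lambda>t. vector_derivative (curve K c) (at t))"
proof -
  have "times_continuously_differentiable (Suc 0) (curve K c)"
    using smooth_curve[OF c] by (simp only: smooth_def)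
  then have d: "\<And>t. curve K c differentiable (at t)"
    and cont: "continuous_on UNIV (\<lambda>t. frechet_derivative (curve K c) (at t) 1)" by simp_all
  show *: "(curve K c has_vector_derivative vector_derivative (curve K c) (at t)) (at t)" for t
    using d by (simp add: vector_derivative_works)
  have "frechet_derivative (curve K c) (at t) 1 = vector_derivative (curve K c) (at t)" for t
    using *[of t] unfolding has_vector_derivative_def by (metis frechet_derivative_at scaleR_one)
  then show "continuous_on UNIV (\<lambda>t. vector_derivative (curve K c) (at t))" using cont by simp
qed

lemma curve_periodic:
  assumes c: "c < ncurves K" and k: "k \<in> \<int>"
  shows "curve K c (t + k) = curve K c t"
proof -
  note per = curve_period_1[OF c]
  have nat: "curve K c (t + of_nat n) = curve K c t" for t n
  proof (induction n)
    case (Suc n)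
    then show ?case using per[of "t + of_nat n"] by (simp add: add_ac)
  qed simp
  from k obtain m where m: "k = of_int m" by (auto elim: Ints_cases)
  show ?thesis
  proof (cases "0 \<le> m")
    case True
    then show ?thesis using nat[of t "nat m"] m by simp
  next
    case False
    then show ?thesis using nat[of "t + k" "nat (- m)"] m by simp
  qed
qed

section \<open>Cut points and the edges between them\<close>

lemma cut_points_cases:
  assumes "p \<in> cut_points K"
  shows "fst p < ncurves K" "0 \<le> snd p" "snd p < 1"
proof -
  have "p \<in> points K"
    using assms crossing(1,2) by (auto simp: cut_points_def passages_def points_def)
  then show "fst p < ncurves K" "0 \<le> snd p" "snd p < 1" by (auto simp: points_def)
qed

lemma finite_cut_points: "finite (cut_points K)"
proof -
  have "{(c, 0) | c. c < ncurves K \<and> (\<forall>p\<in>passages K. fst p \<noteq> c)} \<subseteq> (\<lambda>c. (c, 0)) ` {..<ncurves K}"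
    by auto
  then have "finite {(c, 0 :: real) | c. c < ncurves K \<and> (\<forall>p\<in>passages K. fst p \<noteq> c)}"
    by (rule finite_subset) simp
  then show ?thesis by (simp add: cut_points_def passages_def)
qed

lemma finite_half_strands: "finite (half_strands K)"
  by (simp add: half_strands_def finite_cut_points)

lemma over_under_cut: "i < ncross K \<Longrightarrow> over K i \<in> cut_points K" "i < ncross K \<Longrightarrow> under K i \<in> cut_points K"
  by (auto simp: cut_points_def passages_def)

lemma frac_eqI: "0 \<le> u \<Longrightarrow> u < 1 \<Longrightarrow> t - u \<in> \<int> \<Longrightarrow> frac t = (u :: real)"
  by (metis frac_unique_iff)

text \<open>The infimum is attained, so an edge does end at a cut point.\<close>

lemma edge_length:
  assumes p: "(c, t) \<in> cut_points K" and d: "d \<in> {1, -1}"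
  defines "L \<equiv> edge_length K ((c, t), d)"
  shows "0 < L" and "\<exists>t'. (c, t') \<in> cut_points K \<and> t + d * L - t' \<in> \<int>"
    and "\<And>L' t'. 0 < L' \<Longrightarrow> (c, t') \<in> cut_points K \<Longrightarrow> t + d * L' - t' \<in> \<int> \<Longrightarrow> L \<le> L'"
proof -
  define S where "S = {L. 0 < L \<and> (\<exists>t'. (c, t') \<in> cut_points K \<and> t + d * L - t' \<in> \<int>)}"
  have L: "L = Inf S" by (simp add: L_def edge_length_def S_def)
  have dd: "d * d = 1" "d \<in> \<int>" "\<bar>d\<bar> = 1" using d by auto
  have t: "0 \<le> t" "t < 1" using cut_points_cases[OF p] by auto
  have "1 \<in> S" unfolding S_def using p dd by auto
  \<comment> \<open>One full turn returns to the starting point, so candidates up to 1 suffice. Each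
    is determined by a cut point and an integer of absolute value at most 3, a crude bound, so there
    are finitely many.\<close>
  define T where "T = S \<inter> {..1}"
  have "T \<subseteq> (\<lambda>(q, k). d * (of_int k + snd q - t)) ` (cut_points K \<times> {-3..3})"
  proof
    fix x assume x: "x \<in> T"
    then obtain t' where t': "(c, t') \<in> cut_points K" "t + d * x - t' \<in> \<int>" by (auto simp: T_def S_def)
    then obtain k where k: "t + d * x - t' = of_int k" by (auto elim: Ints_cases)
    have b: "0 \<le> t'" "t' < 1" using cut_points_cases[OF t'(1)] by auto
    have "\<bar>d * x\<bar> \<le> 1" using x dd by (auto simp: T_def S_def abs_mult)
    then have "\<bar>of_int k :: real\<bar> \<le> 3" using k b t by linarith
    then have "k \<in> {-3..3}" by auto
    moreover have "x = d * (of_int k + t' - t)" using k dd by (simp add: algebra_simps flip: k)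
    ultimately show "x \<in> (\<lambda>(q, k). d * (of_int k + snd q - t)) ` (cut_points K \<times> {-3..3})"
      using t'(1) by (intro image_eqI[of _ _ "((c, t'), k)"]) auto
  qed
  then have "finite T" by (rule finite_subset) (simp add: finite_cut_points)
  moreover have "T \<noteq> {}" using \<open>1 \<in> S\<close> by (auto simp: T_def)
  ultimately have m: "Min T \<in> T" "\<And>x. x \<in> T \<Longrightarrow> Min T \<le> x" by auto
  have least: "Min T \<le> x" if "x \<in> S" for x
    using m that by (cases "x \<le> 1") (auto simp: T_def)
  have "Inf S = Min T" using m(1) least by (intro cInf_eq_minimum) (auto simp: T_def)
  then have LT: "L = Min T" using L by simp
  then have "L \<in> S" using m(1) by (simp add: T_def)
  then show "0 < L" "\<exists>t'. (c, t') \<in> cut_points K \<and> t + d * L - t' \<in> \<int>" by (auto simp: S_def)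
  show "L \<le> L'" if "0 < L'" "(c, t') \<in> cut_points K" "t + d * L' - t' \<in> \<int>" for L' t'
    unfolding LT by (rule least) (use that in \<open>auto simp: S_def\<close>)
qed

text \<open>A cut point met on the way back at a distance L' < L would be met on the way out at
  distance L - L', before the edge ends. Hence both directions measure the same length.\<close>

lemma far_end:
  assumes p: "(c, t) \<in> cut_points K" and d: "d \<in> {1, -1}"
  defines "L \<equiv> edge_length K ((c, t), d)"
  obtains t' where "far_end K ((c, t), d) = ((c, t'), - d)" "(c, t') \<in> cut_points K"
    "t + d * L - t' \<in> \<int>" "edge_length K ((c, t'), - d) = L" "far_end K ((c, t'), - d) = ((c, t), d)"
proof -
  note l = edge_length[OF p d, folded L_def]
  obtain t' where t': "(c, t') \<in> cut_points K" "t + d * L - t' \<in> \<int>" using l(2) by blast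
  have dm: "- d \<in> {1, -1}" using d by auto
  note l' = edge_length[OF t'(1) dm]
  have b: "0 \<le> t'" "t' < 1" "0 \<le> t" "t < 1" using cut_points_cases[OF t'(1)] cut_points_cases[OF p] by auto
  have "frac (t + d * L) = t'" by (rule frac_eqI) (use b t' in auto)
  then have 1: "far_end K ((c, t), d) = ((c, t'), - d)" by (simp add: far_end_def L_def)
  define L' where "L' = edge_length K ((c, t'), - d)"
  have rev: "t' + (- d) * L - t \<in> \<int>"
    using Ints_minus[OF t'(2)] by (simp add: algebra_simps)
  have "L' \<le> L" unfolding L'_def by (rule l'(3)[OF l(1) p rev])
  moreover have "\<not> L' < L"
  proof
    assume lt: "L' < L"
    obtain t'' where t'': "(c, t'') \<in> cut_points K" "t' + (- d) * L' - t'' \<in> \<int>"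
      using l'(2) unfolding L'_def by blast
    have "t + d * (L - L') - t'' \<in> \<int>"
      using Ints_add[OF t'(2) t''(2)] by (simp add: algebra_simps)
    then have "L \<le> L - L'" using l(3)[OF _ t''(1)] lt by simp
    then show False using l'(1) by (simp add: L'_def)
  qed
  ultimately have LL: "edge_length K ((c, t'), - d) = L" by (simp add: L'_def)
  have "frac (t' + (- d) * L) = t" by (rule frac_eqI) (use b rev in auto)
  then have "far_end K ((c, t'), - d) = ((c, t), d)" using LL by (simp add: far_end_def)
  then show ?thesis using that 1 t' LL by blast
qed

lemma half_strandsE:
  assumes "x \<in> half_strands K"
  obtains c t d where "x = ((c, t), d)" "(c, t) \<in> cut_points K" "d \<in> {1, -1}"
  using assms unfolding half_strands_def by (metis SigmaE prod.collapse)

lemma far_end_involution: "fpf_involution (half_strands K) (far_end K)"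
  unfolding fpf_involution_def
proof
  fix x assume "x \<in> half_strands K"
  then obtain c t d where x: "x = ((c, t), d)" "(c, t) \<in> cut_points K" "d \<in> {1, -1}" by (rule half_strandsE)
  then obtain t' where "far_end K x = ((c, t'), - d)" "(c, t') \<in> cut_points K" "far_end K ((c, t'), - d) = x"
    using far_end[of c t d] by metis
  then show "far_end K x \<in> half_strands K \<and> far_end K x \<noteq> x \<and> far_end K (far_end K x) = x"
    using x by (auto simp: half_strands_def)
qed

text \<open>Up to an integer shift of the parameter, harmless by periodicity, the far end
  parametrises the same path backwards.\<close>

lemma edge_holonomy_far_end:
  assumes A: "is_connection A" and x: "x \<in> half_strands K"
  shows "edge_holonomy K A (far_end K x) = adjugate (edge_holonomy K A x)"
proof -
  from x obtain c t d where x: "x = ((c, t), d)" "(c, t) \<in> cut_points K" "d \<in> {1, -1}" by (rule half_strandsE)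
  define L where "L = edge_length K ((c, t), d)"
  obtain t' where t': "far_end K x = ((c, t'), - d)" "t + d * L - t' \<in> \<int>" "edge_length K ((c, t'), - d) = L"
    using far_end[OF x(2,3)] x(1) unfolding L_def by metis
  have c: "c < ncurves K" using cut_points_cases[OF x(2)] by simp
  have L: "0 \<le> L" using edge_length(1)[OF x(2,3)] by (simp add: L_def)
  let ?g = "\<lambda>\<tau>. curve K c (t + d * \<tau>)"
  have dg: "(?g has_vector_derivative d *\<^sub>R vector_derivative (curve K c) (at (t + d * \<tau>))) (at \<tau>)" for \<tau>
  proof -
    have "((curve K c \<circ> (\<lambda>\<tau>. t + d * \<tau>)) has_vector_derivative
        d *\<^sub>R vector_derivative (curve K c) (at (t + d * \<tau>))) (at \<tau>)"
      by (intro vector_diff_chain_at curve_derivative(1)[OF c]) (auto intro!: derivative_eq_intros)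
    then show ?thesis by (simp add: o_def)
  qed
  have cont: "continuous_on {0..L} (pulled_back A ?g)"
    by (rule pulled_back_continuous[OF A dg])
      (intro continuous_intros continuous_on_compose2[OF curve_derivative(2)[OF c]], auto)
  have "path_holonomy A (\<lambda>\<tau>. curve K c (t' + (- d) * \<tau>)) L = adjugate (path_holonomy A ?g L)"
  proof (rule path_holonomy_reverse[OF A L cont])
    show "?g differentiable (at \<tau>)" for \<tau> using dg by (rule differentiableI_vector)
    show "curve K c (t' + (- d) * \<tau>) = curve K c (t + d * (L - \<tau>))" for \<tau>
      using curve_periodic[OF c t'(2), of "t' + (- d) * \<tau>"] by (simp add: algebra_simps)
  qed
  then show ?thesis using t' x by (simp add: edge_holonomy_def L_def)
qed

lemma edge_holonomy_reversible:
  "is_connection A \<Longrightarrow> reversible (half_strands K) (far_end K) (edge_holonomy K A)"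
  by (simp add: reversible_def edge_holonomy_far_end)

subsection \<open>Smoothings\<close>

definition smoothed :: "(nat \<Rightarrow> smoothing) \<Rightarrow> passage \<Rightarrow> bool" where
  "smoothed s p \<longleftrightarrow> (\<exists>i<ncross K. s i \<noteq> Active \<and> p \<in> {over K i, under K i})"

lemma smoothed_iff:
  assumes i: "i < ncross K" "p \<in> {over K i, under K i}"
  shows "smoothed s p \<longleftrightarrow> s i \<noteq> Active"
proof
  assume "smoothed s p"
  then obtain j where j: "j < ncross K" "s j \<noteq> Active" "p \<in> {over K j, under K j}"
    unfolding smoothed_def by blast
  have "i = j" by (rule crossing_distinct[OF i(1) j(1) i(2) j(3)])
  then show "s i \<noteq> Active" using j(2) by simp
next
  assume "s i \<noteq> Active"
  then show "smoothed s p" unfolding smoothed_def using i by blast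
qed

lemma joined_sym:
  assumes "joined K s x y"
  shows "joined K s y x"
proof -
  have "{y, x} = {x, y}" by (rule insert_commute)
  then show ?thesis using assms unfolding joined_def by auto
qed

lemma joined_pass:
  assumes "\<not> smoothed s (fst x)"
  shows "joined K s x y \<longleftrightarrow> y = (fst x, - snd x)"
proof -
  have no: False if "i < ncross K" "{x, y} = {x', y'}" "fst x' = over K i" "fst y' = under K i"
      "s i = SmoothA \<or> s i = SmoothB" for i x' y'
  proof -
    have "fst x \<in> {over K i, under K i}" using that(2-4) by (metis doubleton_eq_iff insertCI)
    then show False using assms that(1,5) unfolding smoothed_def by force
  qed
  have "joined K s x y \<longleftrightarrow> fst x = fst y \<and> snd x = - snd y"
    unfolding joined_def using assms no unfolding smoothed_def by blast
  then show ?thesis by (auto simp: prod_eq_iff)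
qed

lemma joined_over:
  assumes i: "i < ncross K" and x: "fst x = over K i" and s: "s i \<noteq> Active"
  shows "joined K s x y \<longleftrightarrow> fst y = under K i \<and>
    (s i = SmoothA \<and> area (tangent K x) (tangent K y) < 0 \<or>
     s i = SmoothB \<and> area (tangent K x) (tangent K y) > 0)"
proof
  assume "joined K s x y"
  moreover have "smoothed s (fst x)" using i x s by (auto simp: smoothed_def)
  ultimately obtain j x' y' where j: "j < ncross K" "{x, y} = {x', y'}" "fst x' = over K j" "fst y' = under K j"
    "s j = SmoothA \<and> area (tangent K x') (tangent K y') < 0 \<or>
     s j = SmoothB \<and> area (tangent K x') (tangent K y') > 0"
    unfolding joined_def smoothed_def by blast
  have "x \<noteq> y'" using over_neq_under(1)[OF i j(1)] x j(4) by auto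
  then have "x = x'" "y = y'" using j(2) by (auto simp: doubleton_eq_iff)
  moreover have "i = j" using crossing_distinct[OF i j(1), of "fst x"] x j(3) \<open>x = x'\<close> by auto
  ultimately show "fst y = under K i \<and> (s i = SmoothA \<and> area (tangent K x) (tangent K y) < 0 \<or>
     s i = SmoothB \<and> area (tangent K x) (tangent K y) > 0)" using j by simp
next
  assume "fst y = under K i \<and> (s i = SmoothA \<and> area (tangent K x) (tangent K y) < 0 \<or>
     s i = SmoothB \<and> area (tangent K x) (tangent K y) > 0)"
  then show "joined K s x y" unfolding joined_def using i x by blast
qed

lemma area_tangent:
  "area (tangent K (p, d)) (tangent K (p', d')) = d * d' * area (velocity K p) (velocity K p')"
  by (simp add: area_def tangent_def algebra_simps)

text \<open>Transversality makes the area nonzero, and its sign flips with the direction of the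
  other strand, so exactly one of the two half-strands there has the sign that the smoothing
  demands. This makes \<open>partner\<close> well defined.\<close>

lemma joined_exists1:
  assumes x: "x \<in> half_strands K"
  shows "\<exists>y. y \<in> half_strands K \<and> joined K s x y \<and> y \<noteq> x \<and> (\<forall>z. z \<in> half_strands K \<longrightarrow> joined K s x z \<longrightarrow> z = y)"
proof -
  have sgn: "\<exists>d'\<in>{1, -1}. Q (d * d' * v) \<and> (\<forall>d''\<in>{1, -1}. Q (d * d'' * v) \<longrightarrow> d'' = d')"
    if v: "v \<noteq> 0" and d: "d \<in> {1, -1}" and Q: "Q = (\<lambda>u. u < 0) \<or> Q = (\<lambda>u. u > 0)" for v d :: real and Q
    using v d Q by (cases "v < 0") auto
  obtain p d where pd: "x = (p, d)" "p \<in> cut_points K" "d \<in> {1, -1}"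
    using x by (auto simp: half_strands_def)
  consider "\<not> smoothed s p" | i where "i < ncross K" "s i \<noteq> Active" "p = over K i"
    | i where "i < ncross K" "s i \<noteq> Active" "p = under K i"
    by (auto simp: smoothed_def)
  then show ?thesis
  proof cases
    case 1
    then show ?thesis
      using joined_pass[of s x] pd by (intro exI[of _ "(p, - d)"]) (auto simp: half_strands_def)
  next
    case (2 i)
    define Q where "Q = (if s i = SmoothA then (\<lambda>u :: real. u < 0) else (\<lambda>u. u > 0))"
    let ?v = "area (velocity K (over K i)) (velocity K (under K i))"
    have j: "joined K s x y \<longleftrightarrow> fst y = under K i \<and> Q (d * snd y * ?v)" for y
      using joined_over[of i x s y] pd 2 area_tangent[of "over K i" d "fst y" "snd y"]
      by (cases "s i") (auto simp: Q_def)
    have "Q = (\<lambda>u. u < 0) \<or> Q = (\<lambda>u. u > 0)" by (simp add: Q_def)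
    from sgn[OF crossing(5)[OF 2(1)] pd(3) this]
    obtain d' where d': "d' \<in> {1, -1}" "Q (d * d' * ?v)" "\<And>d''. d'' \<in> {1, -1} \<Longrightarrow> Q (d * d'' * ?v) \<Longrightarrow> d'' = d'"
      by blast
    let ?y = "(under K i, d')"
    have "?y \<in> half_strands K" using d'(1) over_under_cut[OF 2(1)] by (simp add: half_strands_def)
    moreover have "joined K s x ?y" using d'(2) by (simp add: j)
    moreover have "?y \<noteq> x" using crossing(3)[OF 2(1)] pd(1) 2(3) by auto
    moreover have "z = ?y" if "z \<in> half_strands K" "joined K s x z" for z
      using that d'(3)[of "snd z"] unfolding j by (auto simp: half_strands_def prod_eq_iff)
    ultimately show ?thesis by blast
  next
    case (3 i)
    define Q where "Q = (if s i = SmoothA then (\<lambda>u :: real. u < 0) else (\<lambda>u. u > 0))"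
    let ?v = "area (velocity K (over K i)) (velocity K (under K i))"
    have j: "joined K s x y \<longleftrightarrow> fst y = over K i \<and> Q (d * snd y * ?v)" if y: "y \<in> half_strands K" for y
    proof (cases "fst y = over K i")
      case True
      have "area (tangent K y) (tangent K x) = d * snd y * ?v"
        using area_tangent[of "over K i" "snd y" "under K i" d] True pd(1) 3(3)
        by (metis mult.commute prod.collapse)
      moreover have "joined K s x y \<longleftrightarrow> joined K s y x" using joined_sym by blast
      ultimately show ?thesis
        using joined_over[of i y s x] pd 3 True by (cases "s i") (auto simp: Q_def)
    next
      case False
      have "\<not> joined K s x y"
      proof
        assume jo: "joined K s x y"
        moreover have "smoothed s (fst x)" using 3 pd by (auto simp: smoothed_def)
        ultimately obtain k x' y' where k: "k < ncross K" "{x, y} = {x', y'}" "fst x' = over K k" "fst y' = under K k"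
          unfolding joined_def smoothed_def by blast
        have "x \<noteq> x'" using over_neq_under(1)[OF k(1) 3(1)] pd 3 k(3) by auto
        then have "x = y'" "y = x'" using k(2) by (auto simp: doubleton_eq_iff)
        moreover have "i = k" using crossing_distinct[OF 3(1) k(1), of "fst x"] 3 pd k(4) \<open>x = y'\<close> by auto
        ultimately show False using False k by simp
      qed
      then show ?thesis using False by simp
    qed
    have "Q = (\<lambda>u. u < 0) \<or> Q = (\<lambda>u. u > 0)" by (simp add: Q_def)
    from sgn[OF crossing(5)[OF 3(1)] pd(3) this]
    obtain d' where d': "d' \<in> {1, -1}" "Q (d * d' * ?v)" "\<And>d''. d'' \<in> {1, -1} \<Longrightarrow> Q (d * d'' * ?v) \<Longrightarrow> d'' = d'"
      by blast
    let ?y = "(over K i, d')"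
    have y: "?y \<in> half_strands K" using d'(1) over_under_cut[OF 3(1)] by (simp add: half_strands_def)
    moreover have "joined K s x ?y" using d'(2) by (simp add: j[OF y])
    moreover have "?y \<noteq> x" using crossing(3)[OF 3(1)] pd(1) 3(3) by auto
    moreover have "z = ?y" if z: "z \<in> half_strands K" "joined K s x z" for z
      using z d'(3)[of "snd z"] unfolding j[OF z(1)] by (auto simp: half_strands_def prod_eq_iff)
    ultimately show ?thesis by blast
  qed
qed

lemma partner_eqI:
  assumes "x \<in> half_strands K" "y \<in> half_strands K" "joined K s x y"
  shows "partner K s x = y"
proof -
  obtain w where w: "\<And>z. z \<in> half_strands K \<Longrightarrow> joined K s x z \<Longrightarrow> z = w"
    using joined_exists1[OF assms(1), of s] by blast
  show ?thesis
    unfolding partner_def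
  proof (rule the_equality)
    fix z assume "z \<in> half_strands K \<and> joined K s x z"
    then show "z = y" using w[of z] w[OF assms(2,3)] by simp
  qed (use assms in simp)
qed

lemma partner_joined:
  assumes "x \<in> half_strands K"
  shows "partner K s x \<in> half_strands K" "joined K s x (partner K s x)" "partner K s x \<noteq> x"
  using joined_exists1[OF assms, of s] partner_eqI[OF assms] by metis+

lemma partner_involution: "fpf_involution (half_strands K) (partner K s)"
  unfolding fpf_involution_def using partner_joined partner_eqI joined_sym by metis

sublocale matching_pair "half_strands K" "far_end K" "partner K s" for s
  by unfold_locales (rule finite_half_strands far_end_involution partner_involution)+

lemma components_eq: "components K s = loops (half_strands K) (far_end K) (partner K s)"
  unfolding components_def loops_def loop_of_def steps_def quotient_def by auto

end

section \<open>Existence of orientations\<close>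

context matching_pair
begin

text \<open>Every loop is directed along the N-orbit of a chosen representative. The choice depends
  on the loop as a set, so all its members agree on it, and \<open>N_neq_f_N\<close> excludes edges
  directed both ways.\<close>

lemma orientation_exists: "\<exists>D\<subseteq>H. (\<forall>x\<in>H. x \<in> D \<longleftrightarrow> f x \<notin> D) \<and> (\<forall>x\<in>D. N x \<in> D)"
proof -
  define r where "r x = (SOME z. z \<in> loop_of H f p x)" for x
  define D where "D = {x \<in> H. \<exists>m. x = (N ^^ m) (r x)}"
  have r: "r x \<in> loop_of H f p x" if "x \<in> H" for x
    unfolding r_def using loop_of_self[OF that] by (rule someI)
  have rH: "r x \<in> H" if "x \<in> H" for x using r[OF that] by (simp add: loop_of_def)
  have same: "r y = r x" if "x \<in> H" "y \<in> loop_of H f p x" for x y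
    using loop_of_eq[OF that] by (simp add: r_def)
  have fl: "f x \<in> loop_of H f p x" and Nl: "N x \<in> loop_of H f p x" if "x \<in> H" for x
    using that by (auto simp: loop_of_def N_apply intro: steps_f1 steps_p)
  have "x \<in> D \<longleftrightarrow> f x \<notin> D" if x: "x \<in> H" for x
  proof -
    have "x \<in> loop_of H f p (r x)" using loop_of_eq[OF x r[OF x]] loop_of_self[OF x] by simp
    moreover obtain n where "loop_of H f p (r x)
        = (\<lambda>m. (N ^^ m) (r x)) ` {..<n} \<union> (\<lambda>m. f ((N ^^ m) (r x))) ` {..<n}"
      by (rule loop_structure[OF rH[OF x]])
    ultimately consider m where "x = (N ^^ m) (r x)" | m where "x = f ((N ^^ m) (r x))" by auto
    then show ?thesis
    proof cases
      case (1 m)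
      then have "x \<in> D" using x by (auto simp: D_def)
      moreover have "f x \<noteq> (N ^^ k) (r x)" for k
        using N_neq_f_N[OF rH[OF x], of k m] 1 by metis
      ultimately show ?thesis using same[OF x fl[OF x]] by (auto simp: D_def)
    next
      case (2 m)
      then have "f x = (N ^^ m) (r x)" using rH[OF x] by (metis N_in f_f)
      then have "f x \<in> D" using x f_in[OF x] same[OF x fl[OF x]] by (auto simp: D_def)
      moreover have "x \<noteq> (N ^^ k) (r x)" for k
        using N_neq_f_N[OF rH[OF x], of k m] 2 by metis
      ultimately show ?thesis by (auto simp: D_def)
    qed
  qed
  moreover have "N x \<in> D" if "x \<in> D" for x
  proof -
    from that obtain m where x: "x \<in> H" "x = (N ^^ m) (r x)" by (auto simp: D_def)
    then have "N x = (N ^^ Suc m) (r (N x))" using same[OF x(1) Nl[OF x(1)]] by simp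
    then show ?thesis using x(1) unfolding D_def by (auto simp del: funpow.simps)
  qed
  ultimately show ?thesis by (intro exI[of _ D]) (auto simp: D_def)
qed

end

section \<open>Oriented arcs\<close>

lemma trace_ordered_prod_funpow:
  assumes "(\<sigma> ^^ n) x = x"
  shows "trace (ordered_prod (\<lambda>m. h ((\<sigma> ^^ m) ((\<sigma> ^^ k) x))) n) = trace (ordered_prod (\<lambda>m. h ((\<sigma> ^^ m) x)) n)"
proof (induction k)
  case (Suc k)
  let ?z = "(\<sigma> ^^ k) x"
  have per: "(\<sigma> ^^ n) ?z = ?z" using assms by (metis add.commute comp_apply funpow_add)
  have "trace (ordered_prod (\<lambda>m. h ((\<sigma> ^^ m) (\<sigma> ?z))) n) = trace (ordered_prod (\<lambda>m. h ((\<sigma> ^^ Suc m) ?z)) n)"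
    by (simp add: funpow_swap1)
  also have "\<dots> = trace (ordered_prod (\<lambda>m. h ((\<sigma> ^^ m) ?z)) n)"
    by (rule trace_ordered_prod_rotate) (use per in simp)
  finally show ?case using Suc by simp
qed simp

lemma funpow_in_period: "0 < n \<Longrightarrow> (\<sigma> ^^ n) x = x \<Longrightarrow> (\<sigma> ^^ m) x \<in> (\<lambda>m. (\<sigma> ^^ m) x) ` {..<n}"
  by (rule image_eqI[of _ _ "m mod n"]) (simp_all add: funpow_mod_eq)

locale oriented_diagram = diagram K for K :: link_diagram +
  fixes s :: "nat \<Rightarrow> smoothing" and D :: "half_strand set"
  assumes ori: "orientation K s D"
begin

abbreviation "H \<equiv> half_strands K"
abbreviation "nx \<equiv> next_edge K s"
abbreviation "ap \<equiv> active_passages K s"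
abbreviation "edge_arc \<equiv> arc_of K s D"
abbreviation "\<sigma> \<equiv> next_arc K s D"

lemma nx_N: "N s = nx"
  by (simp add: N_def next_edge_def fun_eq_iff)

lemmas ori' = ori[unfolded orientation_def]

lemma D_H: "x \<in> D \<Longrightarrow> x \<in> H"
  by (rule subsetD[OF conjunct1[OF ori']])

lemma D_far: "x \<in> H \<Longrightarrow> x \<in> D \<longleftrightarrow> far_end K x \<notin> D"
  by (rule bspec[OF conjunct1[OF conjunct2[OF ori']]])

lemma nx_D [simp]: "x \<in> D \<Longrightarrow> nx x \<in> D"
  by (rule bspec[OF conjunct2[OF conjunct2[OF ori']]])

lemma finite_D: "finite D"
  using finite_subset[OF _ finite_half_strands] D_H by blast

lemma nx_inj: "inj_on nx D"
  using N_inj[of s] D_H unfolding nx_N by (auto simp: inj_on_def)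

lemma nx_surj: "nx ` D = D"
  by (rule endo_inj_surj[OF finite_D _ nx_inj]) auto

lemma nx_pow_D [simp]: "x \<in> D \<Longrightarrow> (nx ^^ m) x \<in> D"
  by (induction m) auto

lemma far_notin: "x \<in> D \<Longrightarrow> far_end K x \<notin> D"
  using D_far D_H by blast

text \<open>If the partner of x were in D, it would be the successor of some z in D, and x would be
  the far end of z, the reversal of an edge of D.\<close>

lemma partner_notin:
  assumes "x \<in> D"
  shows "partner K s x \<notin> D"
proof
  assume "partner K s x \<in> D"
  then obtain z where z: "z \<in> D" "partner K s x = nx z" using nx_surj by (metis imageE)
  have "x = partner K s (partner K s x)" using p_p[of x s] D_H[OF assms] by simp
  also have "\<dots> = far_end K z" using z D_H by (simp add: next_edge_def)
  finally show False using far_notin[OF z(1)] assms by simp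
qed

lemma ap_cut: "p \<in> ap \<Longrightarrow> p \<in> cut_points K"
  using over_under_cut by (auto simp: active_passages_def)

lemma ap_not_smoothed:
  assumes "p \<in> ap"
  shows "\<not> smoothed s p"
proof -
  obtain i where "i < ncross K" "s i = Active" "p \<in> {over K i, under K i}"
    using assms unfolding active_passages_def by blast
  then show ?thesis using smoothed_iff by metis
qed

lemma partner_pass:
  assumes x: "x \<in> H" and "\<not> smoothed t (fst x)"
  shows "partner K t x = (fst x, - snd x)"
proof (rule partner_eqI[OF x])
  show "(fst x, - snd x) \<in> H" using x by (auto simp: half_strands_def)
  show "joined K t x (fst x, - snd x)" using joined_pass[OF assms(2)] by simp
qed

text \<open>The strand goes straight through an active passage, so its two half-strands there are
  partners, and exactly one of them is directed outwards.\<close>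

lemma out_edge_unique:
  assumes p: "p \<in> ap"
  shows "\<exists>!x. x \<in> D \<and> fst x = p"
proof -
  let ?x = "(p, 1 :: real)"
  have x: "?x \<in> H" using ap_cut[OF p] by (simp add: half_strands_def)
  have px: "partner K s y = (p, - snd y)" if "y \<in> H" "fst y = p" for y
    using partner_pass[OF that(1)] ap_not_smoothed[OF p] that by simp
  have "\<exists>x. x \<in> D \<and> fst x = p"
  proof (cases "?x \<in> D")
    case False
    then have "far_end K ?x \<in> D" using D_far[OF x] by simp
    then have "nx (far_end K ?x) \<in> D" by simp
    moreover have "nx (far_end K ?x) = (p, - 1)" using x px[OF x] by (simp add: next_edge_def)
    ultimately show ?thesis by (intro exI[of _ "(p, - 1)"]) simp
  next
    case True
    then have "?x \<in> D \<and> fst ?x = p" by simp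
    then show ?thesis by blast
  qed
  moreover have "x = y" if xy: "x \<in> D" "fst x = p" "y \<in> D" "fst y = p" for x y
  proof (rule ccontr)
    assume "x \<noteq> y"
    then have "snd x = - snd y" using xy D_H[of x] D_H[of y] by (auto simp: half_strands_def prod_eq_iff)
    then have "partner K s x = y" using px[OF D_H[OF xy(1)] xy(2)] xy(4) by (simp add: prod_eq_iff)
    then show False using partner_notin[OF xy(1)] xy(3) by simp
  qed
  ultimately show ?thesis by blast
qed

lemma out_edge: "p \<in> ap \<Longrightarrow> out_edge D p \<in> D" "p \<in> ap \<Longrightarrow> fst (out_edge D p) = p"
  unfolding out_edge_def using theI'[OF out_edge_unique] by auto

lemma out_edge_eq: "x \<in> D \<Longrightarrow> fst x \<in> ap \<Longrightarrow> out_edge D (fst x) = x"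
  unfolding out_edge_def using out_edge_unique[of "fst x"] by (intro the1_equality) auto

lemma in_edge_unique:
  assumes p: "p \<in> ap"
  shows "\<exists>!x. x \<in> D \<and> fst (nx x) = p"
proof -
  obtain z where z: "z \<in> D" "out_edge D p = nx z" using out_edge(1)[OF p] nx_surj by (metis imageE)
  have "x = z" if "x \<in> D" "fst (nx x) = p" for x
  proof -
    have "nx x = nx z" using out_edge_eq[of "nx x"] that p z by simp
    then show ?thesis using nx_inj that(1) z(1) by (simp add: inj_on_def)
  qed
  moreover have "z \<in> D \<and> fst (nx z) = p" using z(1) out_edge(2)[OF p] unfolding z(2) by simp
  ultimately show ?thesis by (intro ex1I[of _ z]) simp_all
qed

definition in_edge :: "passage \<Rightarrow> half_strand" where
  "in_edge p = (THE x. x \<in> D \<and> fst (nx x) = p)"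

lemma in_edge: 
  assumes p: "p \<in> ap"
  shows "in_edge p \<in> D" "nx (in_edge p) = out_edge D p"
proof -
  have *: "in_edge p \<in> D \<and> fst (nx (in_edge p)) = p"
    unfolding in_edge_def by (rule theI'[OF in_edge_unique[OF p]])
  then show "in_edge p \<in> D" by simp
  show "nx (in_edge p) = out_edge D p" using out_edge_eq[of "nx (in_edge p)"] * p by simp
qed

lemma in_edge_eq: "x \<in> D \<Longrightarrow> fst (nx x) \<in> ap \<Longrightarrow> in_edge (fst (nx x)) = x"
  unfolding in_edge_def using in_edge_unique[of "fst (nx x)"] by (intro the1_equality) auto

lemma in_arc_eq: "in_arc K s D p = edge_arc (in_edge p)"
  by (simp add: in_arc_def in_edge_def)

definition same_arc :: "half_strand rel" where
  "same_arc = {(y, nx y) | y. y \<in> D \<and> fst (nx y) \<notin> ap}"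

lemma arc_eq: "edge_arc x = {y. (x, y) \<in> (same_arc \<union> same_arc\<inverse>)\<^sup>*}"
  by (simp add: arc_of_def same_arc_def Let_def)

lemma arc_self [simp]: "x \<in> edge_arc x"
  by (simp add: arc_eq)

lemma arc_same:
  assumes "y \<in> edge_arc x"
  shows "edge_arc y = edge_arc x"
proof -
  have "sym ((same_arc \<union> same_arc\<inverse>)\<^sup>*)" by (intro sym_rtrancl sym_Un_converse)
  then have "(y, x) \<in> (same_arc \<union> same_arc\<inverse>)\<^sup>*" using assms by (auto simp: arc_eq dest: symD)
  then show ?thesis using assms unfolding arc_eq by (auto intro: rtrancl_trans)
qed

lemma arc_nx:
  assumes "y \<in> D" "fst (nx y) \<notin> ap"
  shows "edge_arc (nx y) = edge_arc y"
proof (rule arc_same)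
  have "(y, nx y) \<in> same_arc" using assms unfolding same_arc_def by blast
  then show "nx y \<in> edge_arc y" by (simp add: arc_eq r_into_rtrancl)
qed

lemma arc_induct [consumes 1, case_names self forward backward]:
  assumes "y \<in> edge_arc x" "P x" 
    and "\<And>y. y \<in> D \<Longrightarrow> fst (nx y) \<notin> ap \<Longrightarrow> P y \<Longrightarrow> P (nx y)"
    and "\<And>y. y \<in> D \<Longrightarrow> fst (nx y) \<notin> ap \<Longrightarrow> P (nx y) \<Longrightarrow> P y"
  shows "P y"
proof -
  have "(x, y) \<in> (same_arc \<union> same_arc\<inverse>)\<^sup>*" using assms(1) by (simp add: arc_eq)
  then show ?thesis
    by (induction rule: rtrancl_induct) (use assms(2-4) in \<open>auto simp: same_arc_def\<close>)
qed

lemma arc_D: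
  assumes "x \<in> D" "y \<in> edge_arc x"
  shows "y \<in> D"
  using assms(2) by (induction rule: arc_induct) (use assms(1) in auto)

lemma nx_period:
  assumes "x \<in> D"
  obtains n where "0 < n" "(nx ^^ n) x = x" "inj_on (\<lambda>m. (nx ^^ m) x) {..<n}"
    "\<forall>m. (nx ^^ m) x = (nx ^^ (m mod n)) x"
  by (rule period[OF finite_D _ nx_inj assms]) (simp_all add: nx_surj)

text \<open>An open arc starts at its only edge leaving an active passage; a closed arc has no such edge.\<close>

lemma arc_structure_at:
  assumes x: "x \<in> D" and start: "fst x \<in> ap \<or> (\<forall>y\<in>edge_arc x. fst y \<notin> ap)"
  shows "\<exists>k. edge_arc x = (\<lambda>m. (nx ^^ m) x) ` {..<k} \<and> card (edge_arc x) = k \<and> 0 < k \<and>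
    (\<forall>m. 0 < m \<longrightarrow> m < k \<longrightarrow> fst ((nx ^^ m) x) \<notin> ap) \<and>
    (if fst x \<in> ap then fst ((nx ^^ k) x) \<in> ap else (nx ^^ k) x = x)"
proof -
  obtain n where n: "0 < n" "(nx ^^ n) x = x" "inj_on (\<lambda>m. (nx ^^ m) x) {..<n}"
    and md: "\<forall>m. (nx ^^ m) x = (nx ^^ (m mod n)) x" by (rule nx_period[OF x])
  show ?thesis
  proof (cases "fst x \<in> ap")
    case True
    define k where "k = (LEAST k. 0 < k \<and> fst ((nx ^^ k) x) \<in> ap)"
    have ex: "0 < n \<and> fst ((nx ^^ n) x) \<in> ap" using n True by simp
    have k: "0 < k" "fst ((nx ^^ k) x) \<in> ap" using LeastI[of "\<lambda>k. 0 < k \<and> fst ((nx ^^ k) x) \<in> ap", OF ex]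
      by (auto simp: k_def)
    have kn: "k \<le> n" unfolding k_def by (rule Least_le) (rule ex)
    have min: "fst ((nx ^^ m) x) \<notin> ap" if "0 < m" "m < k" for m
      using not_less_Least[of m "\<lambda>k. 0 < k \<and> fst ((nx ^^ k) x) \<in> ap"] that by (auto simp: k_def)
    have in_arc: "(nx ^^ m) x \<in> edge_arc x" if "m < k" for m
      using that
    proof (induction m)
      case (Suc m)
      have "edge_arc ((nx ^^ Suc m) x) = edge_arc ((nx ^^ m) x)"
        using arc_nx[of "(nx ^^ m) x"] min[of "Suc m"] Suc.prems x by simp
      also have "\<dots> = edge_arc x" using arc_same Suc by simp
      finally show ?case by (metis arc_self)
    qed simp
    have "y \<in> (\<lambda>m. (nx ^^ m) x) ` {..<k}" if "y \<in> edge_arc x" for y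
      using that
    proof (induction rule: arc_induct)
      case self
      show ?case using k by (intro image_eqI[of _ _ 0]) auto
    next
      case (forward y)
      then obtain m where m: "m < k" "y = (nx ^^ m) x" by auto
      have "Suc m \<noteq> k" using forward(2) m k by auto
      then show ?case using m by (intro image_eqI[of _ _ "Suc m"]) auto
    next
      case (backward y)
      then obtain m where m: "m < k" "nx y = (nx ^^ m) x" by auto
      have "m \<noteq> 0"
      proof
        assume "m = 0"
        then have "nx y = x" using m(2) by simp
        then show False using backward(2) True by simp
      qed
      then obtain m' where m': "m = Suc m'" by (cases m) auto
      then have "nx y = nx ((nx ^^ m') x)" using m by simp
      then have "y = (nx ^^ m') x" using nx_inj backward(1) x by (simp add: inj_on_def)
      then show ?case using m m' by auto
    qed
    then have eq: "edge_arc x = (\<lambda>m. (nx ^^ m) x) ` {..<k}" using in_arc by blast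
    have "inj_on (\<lambda>m. (nx ^^ m) x) {..<k}" using inj_on_subset[OF n(3), of "{..<k}"] kn by auto
    then have "card (edge_arc x) = k" unfolding eq by (simp add: card_image)
    then show ?thesis using eq k min True by (intro exI[of _ k]) simp
  next
    case False
    then have no: "\<And>y. y \<in> edge_arc x \<Longrightarrow> fst y \<notin> ap" using start by blast
    \<comment> \<open>The induction goes backwards from \<open>(nx ^^ n) x = x\<close>: that the
      successor lies on the arc excludes an active passage between the two edges, as
      \<open>arc_nx\<close> requires.\<close>
    have pred: "(nx ^^ (n - j)) x \<in> edge_arc x" if "j \<le> n" for j
      using that
    proof (induction j)
      case 0 then show ?case using n by simp
    next
      case (Suc j)
      let ?z = "(nx ^^ (n - Suc j)) x"
      have "n - j = Suc (n - Suc j)" using Suc.prems by simp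
      then have nz: "nx ?z = (nx ^^ (n - j)) x" by simp
      then have "nx ?z \<in> edge_arc x" using Suc by simp
      then have "edge_arc ?z = edge_arc (nx ?z)" using arc_nx[of ?z] no x by simp
      also have "\<dots> = edge_arc x" by (rule arc_same) fact
      finally show ?case by (metis arc_self)
    qed
    have in_arc: "(nx ^^ m) x \<in> edge_arc x" for m
      using pred[of "n - m mod n"] md[THEN spec, of m] mod_less_divisor[OF n(1), of m] by simp
    have "y \<in> (\<lambda>m. (nx ^^ m) x) ` {..<n}" if "y \<in> edge_arc x" for y
    proof -
      have "\<exists>m. y = (nx ^^ m) x"
        using that
      proof (induction rule: arc_induct)
        case self
        show ?case by (intro exI[of _ 0]) simp
      next
        case (forward y)
        then obtain m where "y = (nx ^^ m) x" by auto
        then show ?case by (intro exI[of _ "Suc m"]) simp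
      next
        case (backward y)
        then obtain m where "nx y = (nx ^^ m) x" by auto
        also have "\<dots> = (nx ^^ (m + n)) x" using n(2) by (simp add: funpow_add)
        also have "\<dots> = nx ((nx ^^ (m + n - 1)) x)" using n(1)
          by (cases "m + n") auto
        finally have "y = (nx ^^ (m + n - 1)) x" using nx_inj backward(1) x by (simp add: inj_on_def)
        then show ?case by blast
      qed
      then show ?thesis using funpow_in_period[OF n(1,2)] by blast
    qed
    then have eq: "edge_arc x = (\<lambda>m. (nx ^^ m) x) ` {..<n}" using in_arc by blast
    have "card (edge_arc x) = n" unfolding eq using n(3) by (simp add: card_image)
    then show ?thesis using eq n False no in_arc by (intro exI[of _ n]) simp
  qed
qed

abbreviation "\<A> \<equiv> arcs K s D"
abbreviation "fe \<equiv> first_edge K s"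

lemma finite_arcs: "finite \<A>"
  by (simp add: arcs_def finite_D)

lemma arc_arcs [simp]: "x \<in> D \<Longrightarrow> edge_arc x \<in> \<A>"
  by (simp add: arcs_def)

lemma first_edge:
  assumes "l \<in> \<A>"
  shows "fe l \<in> l" "\<exists>y\<in>l. fst y \<in> ap \<Longrightarrow> fst (fe l) \<in> ap"
proof -
  obtain x where x: "x \<in> D" "l = edge_arc x" using assms by (auto simp: arcs_def)
  have "\<exists>z. z \<in> l \<and> ((\<exists>y\<in>l. fst y \<in> ap) \<longrightarrow> fst z \<in> ap)"
    using x(2) arc_self[of x] by blast
  from someI_ex[OF this]
  show "fe l \<in> l" "\<exists>y\<in>l. fst y \<in> ap \<Longrightarrow> fst (fe l) \<in> ap"
    by (simp_all add: first_edge_def)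
qed

lemma arc_first_edge:
  assumes "l \<in> \<A>"
  shows "edge_arc (fe l) = l" "fe l \<in> D"
proof -
  obtain x where x: "x \<in> D" "l = edge_arc x" using assms by (auto simp: arcs_def)
  show "edge_arc (fe l) = l" using arc_same first_edge(1)[OF assms] x by simp
  show "fe l \<in> D" using arc_D first_edge(1)[OF assms] x by simp
qed

lemma arc_structure:
  assumes l: "l \<in> \<A>"
  shows "l = (\<lambda>m. (nx ^^ m) (fe l)) ` {..<card l}" "0 < card l"
    "\<And>m. 0 < m \<Longrightarrow> m < card l \<Longrightarrow> fst ((nx ^^ m) (fe l)) \<notin> ap"
    "fst (fe l) \<in> ap \<Longrightarrow> fst ((nx ^^ card l) (fe l)) \<in> ap"
    "fst (fe l) \<notin> ap \<Longrightarrow> (nx ^^ card l) (fe l) = fe l"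
proof -
  have "fst (fe l) \<in> ap \<or> (\<forall>y\<in>l. fst y \<notin> ap)" using first_edge(2)[OF l] by blast
  from arc_structure_at[OF arc_first_edge(2)[OF l], unfolded arc_first_edge(1)[OF l], OF this]
  show "l = (\<lambda>m. (nx ^^ m) (fe l)) ` {..<card l}" "0 < card l"
    "\<And>m. 0 < m \<Longrightarrow> m < card l \<Longrightarrow> fst ((nx ^^ m) (fe l)) \<notin> ap"
    "fst (fe l) \<in> ap \<Longrightarrow> fst ((nx ^^ card l) (fe l)) \<in> ap"
    "fst (fe l) \<notin> ap \<Longrightarrow> (nx ^^ card l) (fe l) = fe l"
    by auto
qed

lemma first_edge_unique:
  assumes "l \<in> \<A>" "y \<in> l" "fst y \<in> ap"
  shows "fe l = y"
proof -
  obtain m where m: "m < card l" "y = (nx ^^ m) (fe l)" using arc_structure(1)[OF assms(1)] assms(2) by auto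
  then have "m = 0" using arc_structure(3)[OF assms(1), of m] assms(3) by auto
  then show ?thesis using m by simp
qed

lemma out_arc: "p \<in> ap \<Longrightarrow> out_arc K s D p \<in> \<A>" "p \<in> ap \<Longrightarrow> fe (out_arc K s D p) = out_edge D p"
proof -
  assume p: "p \<in> ap"
  show l: "out_arc K s D p \<in> \<A>" using out_edge[OF p] by (simp add: out_arc_def)
  show "fe (out_arc K s D p) = out_edge D p"
    by (rule first_edge_unique[OF l]) (use out_edge[OF p] p in \<open>simp_all add: out_arc_def\<close>)
qed

lemma in_arc:
  assumes p: "p \<in> ap"
  shows "in_arc K s D p \<in> \<A>" "(nx ^^ card (in_arc K s D p)) (fe (in_arc K s D p)) = out_edge D p"
    "fst (fe (in_arc K s D p)) \<in> ap"
proof -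
  let ?l = "in_arc K s D p"
  show l: "?l \<in> \<A>" using in_edge[OF p] by (simp add: in_arc_eq)
  have "in_edge p \<in> ?l" by (simp add: in_arc_eq)
  then obtain m where m: "m < card ?l" "in_edge p = (nx ^^ m) (fe ?l)" using arc_structure(1)[OF l] by auto
  then have e: "(nx ^^ Suc m) (fe ?l) = out_edge D p" using in_edge(2)[OF p] by simp
  then have "fst ((nx ^^ Suc m) (fe ?l)) \<in> ap" using out_edge(2)[OF p] p by simp
  then have "Suc m = card ?l" using arc_structure(3)[OF l, of "Suc m"] m by (cases "Suc m < card ?l") auto
  then show e': "(nx ^^ card ?l) (fe ?l) = out_edge D p" using e by metis
  show "fst (fe ?l) \<in> ap" using arc_structure(5)[OF l] e' out_edge(2)[OF p] p by (metis)
qed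

lemma in_arc_of_open:
  assumes l: "l \<in> \<A>" and o: "fst (fe l) \<in> ap"
  shows "in_arc K s D (fst ((nx ^^ card l) (fe l))) = l"
proof -
  obtain m where m: "card l = Suc m" using arc_structure(2)[OF l] by (cases "card l") auto
  let ?z = "(nx ^^ m) (fe l)"
  have z: "?z \<in> D" "?z \<in> l" using arc_first_edge(2)[OF l] m arc_structure(1)[OF l] by auto
  have e: "(nx ^^ card l) (fe l) = nx ?z" using m by simp
  have "in_edge (fst (nx ?z)) = ?z" using in_edge_eq[OF z(1)] arc_structure(4)[OF l o] e by simp
  then have "in_arc K s D (fst (nx ?z)) = edge_arc ?z" by (simp add: in_arc_eq)
  also have "\<dots> = l" using arc_same[of ?z "fe l"] z(2) arc_first_edge(1)[OF l] by simp
  finally show ?thesis using e by simp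
qed

text \<open>An arc ends at one passage only, since the edge following its last one determines p; the
  description in \<open>next_arc\<close> is therefore definite.\<close>

lemma next_arc_in_arc:
  assumes p: "p \<in> ap"
  shows "\<sigma> (in_arc K s D p) = out_arc K s D p"
proof -
  have "(THE p'. p' \<in> ap \<and> in_arc K s D p' = in_arc K s D p) = p"
  proof (rule the_equality)
    fix p' assume p': "p' \<in> ap \<and> in_arc K s D p' = in_arc K s D p"
    then have "out_edge D p' = out_edge D p" using in_arc(2)[OF p] in_arc(2)[of p'] by simp
    then show "p' = p" using out_edge(2) p p' by metis
  qed (use p in simp)
  then show ?thesis using p by (auto simp: next_arc_def)
qed

text \<open>A closed arc is its own successor and returns to its first edge after
  \<open>card l\<close> steps, so one formula covers open and closed arcs.\<close>

lemma next_arc: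
  assumes l: "l \<in> \<A>"
  shows "\<sigma> l \<in> \<A>" "fe (\<sigma> l) = (nx ^^ card l) (fe l)"
proof -
  have "\<sigma> l \<in> \<A> \<and> fe (\<sigma> l) = (nx ^^ card l) (fe l)"
  proof (cases "fst (fe l) \<in> ap")
    case True
    let ?p = "fst ((nx ^^ card l) (fe l))"
    have p: "?p \<in> ap" using arc_structure(4)[OF l True] .
    have il: "in_arc K s D ?p = l" by (rule in_arc_of_open[OF l True])
    have "\<sigma> l = out_arc K s D ?p" using next_arc_in_arc[OF p] il by simp
    then show ?thesis using out_arc[OF p] in_arc(2)[OF p] il by simp
  next
    case False
    then have "\<nexists>p. p \<in> ap \<and> in_arc K s D p = l" using in_arc(3) by blast
    then have "\<sigma> l = l" by (auto simp: next_arc_def)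
    then show ?thesis using l arc_structure(5)[OF l False] by simp
  qed
  then show "\<sigma> l \<in> \<A>" "fe (\<sigma> l) = (nx ^^ card l) (fe l)" by auto
qed

lemma next_arc_pow: "l \<in> \<A> \<Longrightarrow> (\<sigma> ^^ m) l \<in> \<A>"
  by (induction m) (auto intro: next_arc)

lemma next_arc_inj: "inj_on \<sigma> \<A>"
proof (rule inj_onI)
  fix l l' assume l: "l \<in> \<A>" "l' \<in> \<A>" and eq: "\<sigma> l = \<sigma> l'"
  have e: "(nx ^^ card l) (fe l) = (nx ^^ card l') (fe l')"
    using next_arc(2)[OF l(1)] next_arc(2)[OF l(2)] eq by simp
  have iff: "fst ((nx ^^ card k) (fe k)) \<in> ap \<longleftrightarrow> fst (fe k) \<in> ap" if "k \<in> \<A>" for k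
    using arc_structure(4,5)[OF that] by (cases "fst (fe k) \<in> ap") auto
  show "l = l'"
  proof (cases "fst (fe l) \<in> ap")
    case True
    then have "fst (fe l') \<in> ap" using iff[OF l(1)] iff[OF l(2)] unfolding e by simp
    then have l': "in_arc K s D (fst ((nx ^^ card l') (fe l'))) = l'" by (rule in_arc_of_open[OF l(2)])
    have "in_arc K s D (fst ((nx ^^ card l) (fe l))) = l" by (rule in_arc_of_open[OF l(1) True])
    then show ?thesis unfolding e l' by simp
  next
    case False
    then have "fst (fe l') \<notin> ap" using iff[OF l(1)] iff[OF l(2)] unfolding e by simp
    then have l': "(nx ^^ card l') (fe l') = fe l'" by (rule arc_structure(5)[OF l(2)])
    have "(nx ^^ card l) (fe l) = fe l" by (rule arc_structure(5)[OF l(1) False])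
    then have "fe l = fe l'" unfolding e l' by simp
    then have "edge_arc (fe l) = edge_arc (fe l')" by (rule arg_cong)
    then show ?thesis unfolding arc_first_edge(1)[OF l(1)] arc_first_edge(1)[OF l(2)] .
  qed
qed

lemma arc_nx_next_arc:
  assumes x: "x \<in> D"
  shows "edge_arc (nx x) = edge_arc x \<or> edge_arc (nx x) = \<sigma> (edge_arc x)"
proof (cases "fst (nx x) \<in> ap")
  case True
  have "in_arc K s D (fst (nx x)) = edge_arc x" using in_edge_eq[OF x True] by (simp add: in_arc_eq)
  moreover have "out_arc K s D (fst (nx x)) = edge_arc (nx x)" using out_edge_eq[of "nx x"] x True by (simp add: out_arc_def)
  ultimately show ?thesis using next_arc_in_arc[OF True] by simp
qed (simp add: arc_nx x)

subsection \<open>The arcs of a component\<close>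

abbreviation "comp_arcs C \<equiv> {l \<in> \<A>. l \<subseteq> C}"
abbreviation "cls \<equiv> loop_of H (far_end K) (partner K s)"

text \<open>D contains one of the two directed orbits of the loop; the other is its reversal and
  avoids D.\<close>

lemma component_D:
  assumes x: "x \<in> D"
  shows "cls x \<inter> D = range (\<lambda>m. (nx ^^ m) x)" "card (cls x \<inter> D) = card (cls x) div 2"
    "(nx ^^ card (cls x \<inter> D)) x = x"
proof -
  obtain n where n: "0 < n" "(nx ^^ n) x = x" "inj_on (\<lambda>m. (nx ^^ m) x) {..<n}"
    "cls x = (\<lambda>m. (nx ^^ m) x) ` {..<n} \<union> (\<lambda>m. far_end K ((nx ^^ m) x)) ` {..<n}"
    "card (cls x) = 2 * n"
    by (rule loop_structure[OF D_H[OF x], of s, unfolded nx_N])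
  have "far_end K ((nx ^^ m) x) \<notin> D" for m using far_notin x by simp
  then have eq: "cls x \<inter> D = (\<lambda>m. (nx ^^ m) x) ` {..<n}" using n(4) x by auto
  have "(nx ^^ m) x \<in> (\<lambda>m. (nx ^^ m) x) ` {..<n}" for m
    by (rule funpow_in_period[OF n(1,2)])
  then show "cls x \<inter> D = range (\<lambda>m. (nx ^^ m) x)" unfolding eq by auto
  have "card (cls x \<inter> D) = n" unfolding eq using n(3) by (simp add: card_image)
  then show "card (cls x \<inter> D) = card (cls x) div 2" "(nx ^^ card (cls x \<inter> D)) x = x" using n by auto
qed

lemma arc_subset_component:
  assumes x: "x \<in> D"
  shows "edge_arc x \<subseteq> cls x"
proof -
  have l: "edge_arc x \<in> \<A>" using x by simp
  let ?x = "fe (edge_arc x)"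
  have "edge_arc x \<subseteq> cls ?x"
    using arc_structure(1)[OF l] component_D(1)[OF arc_first_edge(2)[OF l]] by blast
  moreover have "x \<in> edge_arc x" by simp
  ultimately have "cls x = cls ?x" by (intro loop_of_eq[OF D_H[OF arc_first_edge(2)[OF l]]]) blast
  then show ?thesis using \<open>edge_arc x \<subseteq> cls ?x\<close> by simp
qed

lemma arc_in_component_iff:
  assumes x: "x \<in> D" and l: "l \<in> \<A>" and y: "y \<in> l"
  shows "l \<subseteq> cls x \<longleftrightarrow> y \<in> cls x"
proof
  assume "y \<in> cls x"
  moreover have "y \<in> D" "edge_arc y = l" using arc_D arc_same y arc_first_edge[OF l] by metis+
  ultimately show "l \<subseteq> cls x"
    using arc_subset_component[of y] loop_of_eq[OF D_H[OF x], of y] by auto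
qed (use y in auto)

text \<open>A step along the edges stays on the arc or enters the next one, so the arcs of a
  component are all reached from l and form a single cycle.\<close>

lemma comp_arcs_orbit:
  assumes l: "l \<in> \<A>"
  obtains n where "0 < n" "(\<sigma> ^^ n) l = l" "inj_on (\<lambda>m. (\<sigma> ^^ m) l) {..<n}"
    "comp_arcs (cls (fe l)) = (\<lambda>m. (\<sigma> ^^ m) l) ` {..<n}" "card (comp_arcs (cls (fe l))) = n"
proof -
  have "\<sigma> ` \<A> \<subseteq> \<A>" using next_arc(1) by blast
  then obtain n where n: "0 < n" "(\<sigma> ^^ n) l = l" "inj_on (\<lambda>m. (\<sigma> ^^ m) l) {..<n}"
    and md: "\<forall>m. (\<sigma> ^^ m) l = (\<sigma> ^^ (m mod n)) l" by (rule period[OF finite_arcs _ next_arc_inj l])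
  let ?x = "fe l"
  have x: "?x \<in> D" "edge_arc ?x = l" using arc_first_edge[OF l] by auto
  have sub: "(\<sigma> ^^ m) l \<in> comp_arcs (cls ?x)" for m
  proof -
    have a: "(\<sigma> ^^ m) l \<in> \<A>" by (rule next_arc_pow[OF l])
    have "\<exists>k. fe ((\<sigma> ^^ m) l) = (nx ^^ k) ?x"
    proof (induction m)
      case 0 show ?case by (intro exI[of _ 0]) simp
    next
      case (Suc m)
      then obtain k where "fe ((\<sigma> ^^ m) l) = (nx ^^ k) ?x" by blast
      then have "fe ((\<sigma> ^^ Suc m) l) = (nx ^^ (card ((\<sigma> ^^ m) l) + k)) ?x"
        using next_arc(2)[OF next_arc_pow[OF l]] by (simp add: funpow_add)
      then show ?case by blast
    qed
    then have "fe ((\<sigma> ^^ m) l) \<in> cls ?x" using component_D(1)[OF x(1)] by blast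
    then show ?thesis using arc_in_component_iff[OF x(1) a first_edge(1)[OF a]] a by simp
  qed
  have orbit: "\<exists>m. l' = (\<sigma> ^^ m) l" if l': "l' \<in> comp_arcs (cls ?x)" for l'
  proof -
    have a: "l' \<in> \<A>" and "fe l' \<in> cls ?x \<inter> D" using l' first_edge(1) arc_first_edge(2) by auto
    then obtain k where k: "fe l' = (nx ^^ k) ?x" using component_D(1)[OF x(1)] by auto
    have "\<exists>m. edge_arc ((nx ^^ k) ?x) = (\<sigma> ^^ m) l" for k
    proof (induction k)
      case 0 show ?case using x by (intro exI[of _ 0]) simp
    next
      case (Suc k)
      then obtain m where "edge_arc ((nx ^^ k) ?x) = (\<sigma> ^^ m) l" by blast
      then have "edge_arc ((nx ^^ Suc k) ?x) = (\<sigma> ^^ m) l \<or> edge_arc ((nx ^^ Suc k) ?x) = (\<sigma> ^^ Suc m) l"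
        using arc_nx_next_arc[of "(nx ^^ k) ?x"] x by auto
      then show ?case by blast
    qed
    from this[of k] show ?thesis unfolding k[symmetric] arc_first_edge(1)[OF a] .
  qed
  have eq: "comp_arcs (cls ?x) = (\<lambda>m. (\<sigma> ^^ m) l) ` {..<n}"
  proof (intro subset_antisym subsetI)
    fix l' assume "l' \<in> comp_arcs (cls ?x)"
    from orbit[OF this] obtain m where "l' = (\<sigma> ^^ (m mod n)) l" using md by auto
    then show "l' \<in> (\<lambda>m. (\<sigma> ^^ m) l) ` {..<n}" using n(1) by simp
  qed (use sub in blast)
  have "card (comp_arcs (cls ?x)) = n" unfolding eq using n(3) by (simp add: card_image)
  then show ?thesis using that n eq by blast
qed

lemma component_arc:
  assumes C: "C \<in> components K s"
  obtains l where "l \<in> \<A>" "C = cls (fe l)" "l \<in> comp_arcs C"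
proof -
  obtain y where y: "y \<in> H" "C = cls y" using C by (auto simp: components_eq loops_def)
  have "\<exists>x\<in>D. C = cls x"
  proof (cases "y \<in> D")
    case False
    then have "far_end K y \<in> D" using D_far y by blast
    moreover have "far_end K y \<in> cls y" using y by (auto simp: loop_of_def intro: steps_f1)
    ultimately show ?thesis using loop_of_eq y by metis
  qed (use y in auto)
  then obtain x where x: "x \<in> D" "C = cls x" by blast
  have l: "edge_arc x \<in> \<A>" using x by simp
  have "fe (edge_arc x) \<in> cls x" using arc_subset_component[OF x(1)] first_edge(1)[OF l] by blast
  then have "C = cls (fe (edge_arc x))" using loop_of_eq[OF D_H[OF x(1)]] x by simp
  then show ?thesis using that l arc_subset_component[OF x(1)] x by blast
qed

lemma component_of_arc:
  assumes "l \<in> \<A>"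
  shows "cls (fe l) \<in> components K s"
  using D_H[OF arc_first_edge(2)[OF assms]] by (simp add: components_eq loops_def)

lemma finite_components: "finite (components K s)"
  by (simp add: components_eq finite_loops)

lemma component_eq:
  assumes "C \<in> components K s" "y \<in> C"
  shows "C = cls y"
proof -
  obtain x where "x \<in> H" "C = cls x" using assms(1) unfolding components_eq loops_def by blast
  then show ?thesis using loop_of_eq assms(2) by metis
qed

lemma comp_arcs_disjoint:
  assumes C: "C \<in> components K s" "C' \<in> components K s" "C \<noteq> C'" and l: "l \<in> comp_arcs C" "l' \<in> comp_arcs C'"
  shows "l \<noteq> l'"
proof
  assume "l = l'"
  then have "fe l \<in> C" "fe l \<in> C'" using l first_edge(1) by auto
  then have "C = C'" using component_eq[OF C(1)] component_eq[OF C(2)] by metis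
  then show False using C(3) by simp
qed

subsection \<open>Wilson loops\<close>

definition arc_trace :: "nat \<Rightarrow> arc \<Rightarrow> (arc \<Rightarrow> complex^2^2) \<Rightarrow> complex" where
  "arc_trace n l h = trace (ordered_prod (\<lambda>m. h ((\<sigma> ^^ m) l)) n)"

text \<open>\<open>wilson\<close> starts each product at an arbitrary arc; as the arcs form one
  cycle, the trace allows any other starting arc.\<close>

lemma wilson_eq:
  assumes "\<And>C. C \<in> components K s \<Longrightarrow> r C \<in> comp_arcs C"
  shows "wilson K s D h = (\<Prod>C\<in>components K s. arc_trace (card (comp_arcs C)) (r C) h)"
  unfolding wilson_def
proof (rule prod.cong[OF refl])
  fix C assume C: "C \<in> components K s"
  let ?l = "SOME l. l \<in> comp_arcs C"
  have l: "?l \<in> comp_arcs C" using assms[OF C] by (rule someI)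
  then have a: "?l \<in> \<A>" and "fe ?l \<in> C" using first_edge(1) by auto
  then have Cl: "C = cls (fe ?l)" using C component_eq by simp
  obtain n where n: "(\<sigma> ^^ n) ?l = ?l" "comp_arcs C = (\<lambda>m. (\<sigma> ^^ m) ?l) ` {..<n}" "card (comp_arcs C) = n"
    by (rule comp_arcs_orbit[OF a, unfolded Cl[symmetric]])
  obtain k where "r C = (\<sigma> ^^ k) ?l" using n(2) assms[OF C] by auto
  then show "(let Ls = comp_arcs C in trace (ordered_prod (\<lambda>m. h ((\<sigma> ^^ m) (SOME l. l \<in> Ls))) (card Ls)))
      = arc_trace (card (comp_arcs C)) (r C) h"
    using trace_ordered_prod_funpow[OF n(1), of h k] n(3) by (simp add: Let_def arc_trace_def)
qed

text \<open>Isolates the loop through l. The cofactor c reads only arcs off that loop, because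
  distinct components share no arc.\<close>

lemma wilson_factor:
  assumes l: "l \<in> \<A>"
  obtains n c where "0 < n" "(\<sigma> ^^ n) l = l" "inj_on (\<lambda>m. (\<sigma> ^^ m) l) {..<n}"
    "\<forall>h. wilson K s D h = arc_trace n l h * c h"
    "\<forall>h h'. (\<forall>l'. (\<forall>m. l' \<noteq> (\<sigma> ^^ m) l) \<longrightarrow> h l' = h' l') \<longrightarrow> c h = c h'"
proof -
  let ?C = "cls (fe l)"
  obtain n where n: "0 < n" "(\<sigma> ^^ n) l = l" "inj_on (\<lambda>m. (\<sigma> ^^ m) l) {..<n}"
    "comp_arcs ?C = (\<lambda>m. (\<sigma> ^^ m) l) ` {..<n}" "card (comp_arcs ?C) = n"
    by (rule comp_arcs_orbit[OF l])
  define r where "r C = (if C = ?C then l else SOME l'. l' \<in> comp_arcs C)" for C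
  have r: "r C \<in> comp_arcs C" if C: "C \<in> components K s" for C
  proof (cases "C = ?C")
    case True
    have "l \<in> comp_arcs ?C" unfolding n(4) using n(1) by (intro image_eqI[of _ _ 0]) auto
    then show ?thesis using True by (simp add: r_def)
  next
    case False
    obtain l' where "l' \<in> comp_arcs C" by (rule component_arc[OF C])
    then have "(SOME l'. l' \<in> comp_arcs C) \<in> comp_arcs C" by (rule someI)
    then show ?thesis unfolding r_def using False by simp
  qed
  define c where "c h = (\<Prod>C\<in>components K s - {?C}. arc_trace (card (comp_arcs C)) (r C) h)" for h
  have "wilson K s D h = arc_trace n l h * c h" for h
  proof -
    have "wilson K s D h = (\<Prod>C\<in>components K s. arc_trace (card (comp_arcs C)) (r C) h)"
      by (rule wilson_eq) (rule r)
    also have "\<dots> = arc_trace (card (comp_arcs ?C)) (r ?C) h * c h"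
      unfolding c_def by (rule prod.remove[OF finite_components component_of_arc[OF l]])
    finally show ?thesis using n(5) by (simp add: r_def)
  qed
  moreover have "c h = c h'" if same: "\<forall>l'. (\<forall>m. l' \<noteq> (\<sigma> ^^ m) l) \<longrightarrow> h l' = h' l'" for h h'
    unfolding c_def
  proof (rule prod.cong[OF refl])
    fix C assume C: "C \<in> components K s - {?C}"
    have "h ((\<sigma> ^^ k) (r C)) = h' ((\<sigma> ^^ k) (r C))" for k
    proof (rule same[rule_format])
      fix m
      have rC: "r C \<in> comp_arcs C" using r C by simp
      then have ra: "r C \<in> \<A>" and "fe (r C) \<in> C" using first_edge(1) by auto
      then have Cr: "C = cls (fe (r C))" using C component_eq by simp
      have "(\<sigma> ^^ k) (r C) \<in> comp_arcs C"
      proof -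
        obtain n' where n': "0 < n'" "(\<sigma> ^^ n') (r C) = r C"
          "comp_arcs C = (\<lambda>m. (\<sigma> ^^ m) (r C)) ` {..<n'}"
          by (rule comp_arcs_orbit[OF ra, unfolded Cr[symmetric]])
        show ?thesis unfolding n'(3) by (rule funpow_in_period[OF n'(1,2)])
      qed
      moreover have "(\<sigma> ^^ m) l \<in> comp_arcs ?C"
        unfolding n(4) by (rule funpow_in_period[OF n(1,2)])
      ultimately show "(\<sigma> ^^ k) (r C) \<noteq> (\<sigma> ^^ m) l"
        using comp_arcs_disjoint[of C ?C] C component_of_arc[OF l] by simp
    qed
    then show "arc_trace (card (comp_arcs C)) (r C) h = arc_trace (card (comp_arcs C)) (r C) h'"
      by (simp add: arc_trace_def)
  qed
  ultimately show ?thesis by (intro that[OF n(1-3), of c]) blast+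
qed

text \<open>An arc occurs exactly once in its loop and in no other one. The remaining loops are
  absorbed into M as a scalar matrix.\<close>

lemma wilson_linear:
  assumes l: "l \<in> \<A>"
  shows "\<exists>M. \<forall>X. wilson K s D (h(l := X)) = trace (X ** M)"
proof -
  obtain n c where n: "0 < n" "(\<sigma> ^^ n) l = l" "inj_on (\<lambda>m. (\<sigma> ^^ m) l) {..<n}"
    and W: "\<forall>h. wilson K s D h = arc_trace n l h * c h"
    and c: "\<forall>h h'. (\<forall>l'. (\<forall>m. l' \<noteq> (\<sigma> ^^ m) l) \<longrightarrow> h l' = h' l') \<longrightarrow> c h = c h'"
    by (rule wilson_factor[OF l])
  obtain k where k: "n = Suc k" using n(1) by (cases n) auto
  let ?R = "ordered_prod (\<lambda>m. h ((\<sigma> ^^ Suc m) l)) k"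
  have "wilson K s D (h(l := X)) = trace (X ** (?R ** mat (c h)))" for X
  proof -
    have "c (h(l := X)) = c h"
    proof (rule c[rule_format])
      fix l' assume "\<And>m. l' \<noteq> (\<sigma> ^^ m) l"
      from this[of 0] show "(h(l := X)) l' = h l'" by simp
    qed
    moreover have "ordered_prod (\<lambda>m. (h(l := X)) ((\<sigma> ^^ Suc m) l)) k = ?R"
    proof (rule ordered_prod_cong)
      fix m assume "m < k"
      then have "(\<sigma> ^^ Suc m) l \<noteq> l" using inj_onD[OF n(3), of "Suc m" 0] k by auto
      then show "(h(l := X)) ((\<sigma> ^^ Suc m) l) = h ((\<sigma> ^^ Suc m) l)" by simp
    qed
    ultimately have "wilson K s D (h(l := X)) = trace (X ** ?R) * c h"
      unfolding W[rule_format] arc_trace_def k by (subst ordered_prod_front) simp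
    also have "\<dots> = trace (mat (c h) ** (X ** ?R))" by (simp only: trace_mat_mult mult.commute)
    also have "\<dots> = trace (X ** (?R ** mat (c h)))"
      using trace_mult_commute[of "mat (c h)" "X ** ?R"] by (simp only: matrix_mul_assoc)
    finally show ?thesis .
  qed
  then show ?thesis by blast
qed

text \<open>Consecutive arcs are adjacent factors, so a matrix at the end of the incoming arc may
  stand at the start of the outgoing one. It then suffices to record insertions on the outgoing
  side.\<close>

lemma wilson_slide:
  assumes p: "p \<in> ap"
  defines "l \<equiv> in_arc K s D p" and "l' \<equiv> out_arc K s D p"
  shows "wilson K s D (h(l := h l ** X)) = wilson K s D (h(l' := X ** h l'))"
proof -
  have l: "l \<in> \<A>" and l': "\<sigma> l = l'" using in_arc(1)[OF p] next_arc_in_arc[OF p] by (simp_all add: l_def l'_def)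
  obtain n c where n: "0 < n" "(\<sigma> ^^ n) l = l" "inj_on (\<lambda>m. (\<sigma> ^^ m) l) {..<n}"
    and W: "\<forall>h. wilson K s D h = arc_trace n l h * c h"
    and c: "\<forall>h h'. (\<forall>l'. (\<forall>m. l' \<noteq> (\<sigma> ^^ m) l) \<longrightarrow> h l' = h' l') \<longrightarrow> c h = c h'"
    by (rule wilson_factor[OF l])
  have cc: "c (h(l := h l ** X)) = c (h(l' := X ** h l'))"
  proof (rule c[rule_format])
    fix l1 assume ne: "\<And>m. l1 \<noteq> (\<sigma> ^^ m) l"
    from ne[of 0] ne[of 1] show "(h(l := h l ** X)) l1 = (h(l' := X ** h l')) l1" using l' by simp
  qed
  obtain k where k: "n = Suc k" using n(1) by (cases n) auto
  show ?thesis
  proof (cases k)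
    \<comment> \<open>The loop is a single arc, its own successor, and cyclicity of the trace moves
      X around it.\<close>
    case 0
    then have "l' = l" using n(2) k l' by simp
    then show ?thesis
      unfolding W[rule_format] cc using k 0 by (simp add: arc_trace_def trace_mult_commute)
  next
    case (Suc j)
    have ne: "l' \<noteq> l" using inj_onD[OF n(3), of 1 0] k Suc l' by auto
    have rest: "ordered_prod (\<lambda>m. h' ((\<sigma> ^^ Suc (Suc m)) l)) j = ordered_prod (\<lambda>m. h ((\<sigma> ^^ Suc (Suc m)) l)) j"
      if "\<And>l1. l1 \<noteq> l \<Longrightarrow> l1 \<noteq> l' \<Longrightarrow> h' l1 = h l1" for h'
    proof (rule ordered_prod_cong, rule that)
      fix m assume "m < j"
      then show "(\<sigma> ^^ Suc (Suc m)) l \<noteq> l" "(\<sigma> ^^ Suc (Suc m)) l \<noteq> l'"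
        using inj_onD[OF n(3), of "Suc (Suc m)" 0] inj_onD[OF n(3), of "Suc (Suc m)" 1] k Suc l' by auto
    qed
    have tr: "arc_trace n l h' = trace (h' l ** (h' l' ** ordered_prod (\<lambda>m. h ((\<sigma> ^^ Suc (Suc m)) l)) j))"
      if same: "\<And>l1. l1 \<noteq> l \<Longrightarrow> l1 \<noteq> l' \<Longrightarrow> h' l1 = h l1" for h'
    proof -
      have "arc_trace n l h' = trace (h' l ** (h' l' ** ordered_prod (\<lambda>m. h' ((\<sigma> ^^ Suc (Suc m)) l)) j))"
        unfolding arc_trace_def k Suc ordered_prod_front using l' by simp
      also have "ordered_prod (\<lambda>m. h' ((\<sigma> ^^ Suc (Suc m)) l)) j = ordered_prod (\<lambda>m. h ((\<sigma> ^^ Suc (Suc m)) l)) j"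
        by (rule rest) (rule same)
      finally show ?thesis .
    qed
    have "arc_trace n l (h(l := h l ** X)) = arc_trace n l (h(l' := X ** h l'))"
      by (subst (1 2) tr) (use ne in \<open>simp_all add: matrix_mul_assoc\<close>)
    then show ?thesis unfolding W[rule_format] cc by simp
  qed
qed

lemma polyfun_sum_finite: "finite I \<Longrightarrow> (\<And>i. i \<in> I \<Longrightarrow> F i \<in> polyfun S) \<Longrightarrow> (\<lambda>h. \<Sum>i\<in>I. F i h) \<in> polyfun S"
  by (induction I rule: finite_induct) (auto intro: polyfun.intros)

lemma polyfun_prod_finite: "finite I \<Longrightarrow> (\<And>i. i \<in> I \<Longrightarrow> F i \<in> polyfun S) \<Longrightarrow> (\<lambda>h. \<Prod>i\<in>I. F i h) \<in> polyfun S"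
  by (induction I rule: finite_induct) (auto intro: polyfun.intros)

lemma wilson_polyfun: "wilson K s D \<in> polyfun \<A>"
proof -
  define r where "r C = (SOME l'. l' \<in> comp_arcs C)" for C
  have r: "r C \<in> comp_arcs C" if C: "C \<in> components K s" for C
  proof -
    obtain l' where "l' \<in> comp_arcs C" by (rule component_arc[OF C])
    then show ?thesis unfolding r_def by (rule someI)
  qed
  have "(\<lambda>h. arc_trace n l h) \<in> polyfun \<A>" if l: "l \<in> \<A>" for n l
  proof -
    have "(\<lambda>h. ordered_prod (\<lambda>m. h ((\<sigma> ^^ m) l)) n $ i $ j) \<in> polyfun \<A>" for i j
    proof (induction n arbitrary: i j)
      case 0 show ?case by (simp add: polyfun.const)
    next
      case (Suc n)
      show ?case
        by (simp add: matrix_matrix_mult_def)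
          (intro polyfun_sum_finite polyfun.mult Suc polyfun.var next_arc_pow[OF l], simp)
    qed
    then show ?thesis unfolding arc_trace_def trace_def by (intro polyfun_sum_finite) simp_all
  qed
  then have "(\<lambda>h. \<Prod>C\<in>components K s. arc_trace (card (comp_arcs C)) (r C) h) \<in> polyfun \<A>"
    using r by (intro polyfun_prod_finite finite_components) auto
  moreover have "wilson K s D = (\<lambda>h. \<Prod>C\<in>components K s. arc_trace (card (comp_arcs C)) (r C) h)"
    using wilson_eq[of r] r by (intro ext) blast
  ultimately show ?thesis by simp
qed

end

section \<open>The crossing operators\<close>

lemma mat_mult_component: "(mat z ** M) $ i $ j = z * (M :: complex^2^2) $ i $ j"
  using exhaust_2[of i] by (auto simp: matrix2_expand)

lemma half_scaleR: "(1 / 2) *\<^sub>R M = mat (1 / 2) ** (M :: complex^2^2)"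
  by (simp add: vec_eq_iff mat_mult_component) (simp add: scaleR_conv_of_real)

section \<open>Linear operators and derivations on polynomial functions\<close>

lemma polyfun_cong:
  assumes "f \<in> polyfun S" "\<And>l. l \<in> S \<Longrightarrow> h l = h' l"
  shows "f h = f h'"
  using assms(1) by induction (simp_all add: assms(2))

lemma polyfun_left_mult:
  assumes "f \<in> polyfun S"
  shows "(\<lambda>h. f (\<lambda>l. Y l ** h l)) \<in> polyfun S"
  using assms
proof induction
  case (var l i j)
  then show ?case
    by (simp add: matrix_matrix_mult_def sum_2) (intro polyfun.add polyfun.mult polyfun.const polyfun.var)
qed (auto intro: polyfun.intros)

text \<open>Linearity is confined to \<open>polyfun S\<close> because a derivation chosen by
  \<open>derivation_with_values\<close> is constrained only there.\<close>

definition linear_on_polyfun :: "'l set \<Rightarrow> ((('l \<Rightarrow> complex^2^2) \<Rightarrow> complex) \<Rightarrow> (('l \<Rightarrow> complex^2^2) \<Rightarrow> complex)) \<Rightarrow> bool" where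
  "linear_on_polyfun S T \<longleftrightarrow> (\<forall>f\<in>polyfun S. T f \<in> polyfun S) \<and>
     (\<forall>f\<in>polyfun S. \<forall>g\<in>polyfun S. T (\<lambda>h. f h + g h) = (\<lambda>h. T f h + T g h)) \<and>
     (\<forall>f\<in>polyfun S. \<forall>c. T (\<lambda>h. c * f h) = (\<lambda>h. c * T f h))"

lemma linear_on_polyfunD:
  assumes "linear_on_polyfun S T" "f \<in> polyfun S"
  shows "T f \<in> polyfun S" "g \<in> polyfun S \<Longrightarrow> T (\<lambda>h. f h + g h) = (\<lambda>h. T f h + T g h)"
    "T (\<lambda>h. c * f h) = (\<lambda>h. c * T f h)"
  using assms by (simp_all add: linear_on_polyfun_def)

lemma derivation_linear: "derivation_on (polyfun S) T \<Longrightarrow> linear_on_polyfun S T"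
  by (simp add: derivation_on_def linear_on_polyfun_def)

lemma derivation_mult:
  "derivation_on P T \<Longrightarrow> f \<in> P \<Longrightarrow> g \<in> P \<Longrightarrow> T (\<lambda>h. f h * g h) = (\<lambda>h. T f h * g h + f h * T g h)"
  by (simp add: derivation_on_def)

lemma linear_on_polyfun_sum:
  assumes T: "linear_on_polyfun S T" and I: "finite I" "\<And>i. i \<in> I \<Longrightarrow> F i \<in> polyfun S"
  shows "(\<lambda>h. \<Sum>i\<in>I. F i h) \<in> polyfun S \<and> T (\<lambda>h. \<Sum>i\<in>I. F i h) = (\<lambda>h. \<Sum>i\<in>I. T (F i) h)"
  using I
proof (induction I rule: finite_induct)
  case empty
  \<comment> \<open>Homogeneity with the scalar 0 shows that T annihilates the zero
    function.\<close>
  have "T (\<lambda>h. 0 * 0) = (\<lambda>h. 0 * T (\<lambda>h. 0) h)"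
    by (rule linear_on_polyfunD(3)[OF T polyfun.const])
  then show ?case by (simp add: polyfun.const)
next
  case (insert j I)
  then have IH: "(\<lambda>h. \<Sum>i\<in>I. F i h) \<in> polyfun S" "T (\<lambda>h. \<Sum>i\<in>I. F i h) = (\<lambda>h. \<Sum>i\<in>I. T (F i) h)"
    and Fj: "F j \<in> polyfun S" by auto
  show ?case
    using linear_on_polyfunD(2)[OF T Fj IH(1)] polyfun.add[OF Fj IH(1)] IH(2) insert.hyps by simp
qed

lemma linear_on_polyfun_comb:
  fixes F :: "'n::finite \<Rightarrow> 'n \<Rightarrow> ('l \<Rightarrow> complex^2^2) \<Rightarrow> complex"
  assumes T: "linear_on_polyfun S T" and F: "\<And>\<alpha> \<beta>. F \<alpha> \<beta> \<in> polyfun S"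
  shows "(\<lambda>h. \<Sum>\<alpha>\<in>UNIV. \<Sum>\<beta>\<in>UNIV. w \<alpha> \<beta> * F \<alpha> \<beta> h) \<in> polyfun S"
    and "T (\<lambda>h. \<Sum>\<alpha>\<in>UNIV. \<Sum>\<beta>\<in>UNIV. w \<alpha> \<beta> * F \<alpha> \<beta> h)
      = (\<lambda>h. \<Sum>\<alpha>\<in>UNIV. \<Sum>\<beta>\<in>UNIV. w \<alpha> \<beta> * T (F \<alpha> \<beta>) h)"
proof -
  have 1: "(\<lambda>h. w \<alpha> \<beta> * F \<alpha> \<beta> h) \<in> polyfun S" for \<alpha> \<beta> by (intro polyfun.mult polyfun.const F)
  have 2: "(\<lambda>h. \<Sum>\<beta>\<in>UNIV. w \<alpha> \<beta> * F \<alpha> \<beta> h) \<in> polyfun S \<and>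
      T (\<lambda>h. \<Sum>\<beta>\<in>UNIV. w \<alpha> \<beta> * F \<alpha> \<beta> h) = (\<lambda>h. \<Sum>\<beta>\<in>UNIV. T (\<lambda>h. w \<alpha> \<beta> * F \<alpha> \<beta> h) h)" for \<alpha>
    by (rule linear_on_polyfun_sum[OF T]) (simp_all add: 1)
  have 3: "(\<lambda>h. \<Sum>\<alpha>\<in>UNIV. \<Sum>\<beta>\<in>UNIV. w \<alpha> \<beta> * F \<alpha> \<beta> h) \<in> polyfun S \<and>
      T (\<lambda>h. \<Sum>\<alpha>\<in>UNIV. \<Sum>\<beta>\<in>UNIV. w \<alpha> \<beta> * F \<alpha> \<beta> h)
      = (\<lambda>h. \<Sum>\<alpha>\<in>UNIV. T (\<lambda>h. \<Sum>\<beta>\<in>UNIV. w \<alpha> \<beta> * F \<alpha> \<beta> h) h)"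
    by (rule linear_on_polyfun_sum[OF T]) (simp_all add: 2)
  then show "(\<lambda>h. \<Sum>\<alpha>\<in>UNIV. \<Sum>\<beta>\<in>UNIV. w \<alpha> \<beta> * F \<alpha> \<beta> h) \<in> polyfun S" by simp
  have "T (\<lambda>h. w \<alpha> \<beta> * F \<alpha> \<beta> h) = (\<lambda>h. w \<alpha> \<beta> * T (F \<alpha> \<beta>) h)" for \<alpha> \<beta>
    by (rule linear_on_polyfunD(3)[OF T F])
  then show "T (\<lambda>h. \<Sum>\<alpha>\<in>UNIV. \<Sum>\<beta>\<in>UNIV. w \<alpha> \<beta> * F \<alpha> \<beta> h)
      = (\<lambda>h. \<Sum>\<alpha>\<in>UNIV. \<Sum>\<beta>\<in>UNIV. w \<alpha> \<beta> * T (F \<alpha> \<beta>) h)"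
    using 2 3 by simp
qed

lemma derivation_with_values:
  assumes V: "\<And>l i j. l \<in> S \<Longrightarrow> (\<lambda>h. V l h $ i $ j) \<in> polyfun S"
  shows "derivation_on (polyfun S) (derivation_with_values S V)" "has_values S V (derivation_with_values S V)"
  using someI_ex[OF derivation_exists[of S V]] V unfolding derivation_with_values_def by auto

text \<open>The derivation is given by algebraic conditions only. As a derivative along V, its value
  can be read off as the coefficient of z.\<close>

lemma derivation_with_values_deriv:
  assumes V: "\<And>l i j. l \<in> S \<Longrightarrow> (\<lambda>h. V l h $ i $ j) \<in> polyfun S" and f: "f \<in> polyfun S"
  shows "((\<lambda>z. f (\<lambda>l. h l + mat z ** V l h)) has_field_derivative derivation_with_values S V f h) (at 0)"
proof -
  let ?\<delta> = "derivation_with_values S V"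
  have d: "derivation_on (polyfun S) ?\<delta>" and v: "has_values S V ?\<delta>"
    by (rule derivation_with_values, rule V, assumption)+
  have mat0: "mat 0 ** M = (0 :: complex^2^2)" for M by (simp add: matrix2_expand)
  show ?thesis
    using f
  proof induction
    case (const c)
    have "?\<delta> (\<lambda>h. c * 1) = (\<lambda>h. c * ?\<delta> (\<lambda>h. 1) h)"
      by (rule linear_on_polyfunD(3)[OF derivation_linear[OF d] polyfun.const])
    moreover have "?\<delta> (\<lambda>h. 1 * 1) = (\<lambda>h. ?\<delta> (\<lambda>h. 1) h * 1 + 1 * ?\<delta> (\<lambda>h. 1) h)"
      by (rule derivation_mult[OF d polyfun.const polyfun.const])
    ultimately have "?\<delta> (\<lambda>h. c) = (\<lambda>h. 0)" by (auto simp: fun_eq_iff)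
    then show ?case by simp
  next
    case (var l i j)
    then have "?\<delta> (\<lambda>h. h l $ i $ j) = (\<lambda>h. V l h $ i $ j)" using v by (simp add: has_values_def)
    then show ?case by (auto simp: mat_mult_component intro!: derivative_eq_intros)
  next
    case (add f g)
    have "?\<delta> (\<lambda>h. f h + g h) = (\<lambda>h. ?\<delta> f h + ?\<delta> g h)"
      by (rule linear_on_polyfunD(2)[OF derivation_linear[OF d] add(1,2)])
    then show ?case using DERIV_add[OF add.IH] by simp
  next
    case (mult f g)
    have "?\<delta> (\<lambda>h. f h * g h) = (\<lambda>h. ?\<delta> f h * g h + f h * ?\<delta> g h)"
      by (rule derivation_mult[OF d mult(1,2)])
    then show ?case using DERIV_mult[OF mult.IH] by (simp add: mat0 mult.commute)
  qed
qed

text \<open>T squares to 3 on F, so its powers on F are combinations of \<open>r3 ^ n\<close> and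
  \<open>(- r3) ^ n\<close>, and the series splits into the exponentials of r3 * \<beta> and - r3 *
  \<beta>.\<close>

lemma exp_operator_square:
  assumes T: "linear_on_polyfun S T" and F: "F \<in> polyfun S" and sq: "T (T F) = (\<lambda>h. 3 * F h)"
  defines "r3 \<equiv> complex_of_real (sqrt 3)"
  shows "exp_operator \<beta> T F = (\<lambda>h. cosh (r3 * \<beta>) * F h + sinh (r3 * \<beta>) / r3 * T F h)"
proof
  fix h
  have r3: "r3 * r3 = 3" "r3 \<noteq> 0" unfolding r3_def by (simp_all flip: of_real_mult)
  have TF: "T F \<in> polyfun S" by (rule linear_on_polyfunD(1)[OF T F])
  have pow: "(T ^^ n) F = (\<lambda>h. (r3 ^ n + (- r3) ^ n) / 2 * F h + (r3 ^ n - (- r3) ^ n) / (2 * r3) * T F h)" for n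
  proof (induction n)
    case 0 then show ?case by simp
  next
    case (Suc n)
    let ?a = "(r3 ^ n + (- r3) ^ n) / 2" and ?b = "(r3 ^ n - (- r3) ^ n) / (2 * r3)"
    have "(T ^^ Suc n) F = T (\<lambda>h. ?a * F h + ?b * T F h)" using Suc by simp
    also have "\<dots> = (\<lambda>h. T (\<lambda>h. ?a * F h) h + T (\<lambda>h. ?b * T F h) h)"
      by (rule linear_on_polyfunD(2)[OF T]) (intro polyfun.mult polyfun.const F TF)+
    also have "\<dots> = (\<lambda>h. ?a * T F h + ?b * (3 * F h))"
      using linear_on_polyfunD(3)[OF T F, of ?a] linear_on_polyfunD(3)[OF T TF, of ?b] sq by (simp add: fun_eq_iff)
    also have "\<dots> = (\<lambda>h. (r3 ^ Suc n + (- r3) ^ Suc n) / 2 * F h + (r3 ^ Suc n - (- r3) ^ Suc n) / (2 * r3) * T F h)"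
    proof
      fix h
      have "?b * 3 = (r3 ^ Suc n + (- r3) ^ Suc n) / 2"
        unfolding r3(1)[symmetric] using r3(2) by (simp add: field_simps)
      moreover have "?a = (r3 ^ Suc n - (- r3) ^ Suc n) / (2 * r3)" using r3(2) by (simp add: field_simps)
      ultimately show "?a * T F h + ?b * (3 * F h)
          = (r3 ^ Suc n + (- r3) ^ Suc n) / 2 * F h + (r3 ^ Suc n - (- r3) ^ Suc n) / (2 * r3) * T F h"
        by (metis add.commute mult.assoc)
    qed
    finally show ?case .
  qed
  have ex: "(\<lambda>n. z ^ n / fact n) sums exp z" for z :: complex
    using exp_converges[of z] by (simp add: scaleR_conv_of_real field_simps)
  have "(\<lambda>n. ((r3 * \<beta>) ^ n / fact n + (- (r3 * \<beta>)) ^ n / fact n) * (F h / 2)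
      + ((r3 * \<beta>) ^ n / fact n - (- (r3 * \<beta>)) ^ n / fact n) * (T F h / (2 * r3)))
    sums ((exp (r3 * \<beta>) + exp (- (r3 * \<beta>))) * (F h / 2) + (exp (r3 * \<beta>) - exp (- (r3 * \<beta>))) * (T F h / (2 * r3)))"
    by (intro sums_add sums_mult2 sums_diff ex)
  also have "(\<lambda>n. ((r3 * \<beta>) ^ n / fact n + (- (r3 * \<beta>)) ^ n / fact n) * (F h / 2)
      + ((r3 * \<beta>) ^ n / fact n - (- (r3 * \<beta>)) ^ n / fact n) * (T F h / (2 * r3)))
    = (\<lambda>n. \<beta> ^ n / fact n * (T ^^ n) F h)"
  proof
    fix n
    have m: "(- (r3 * \<beta>)) ^ n = (- r3) ^ n * \<beta> ^ n" by (metis minus_mult_left power_mult_distrib)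
    show "((r3 * \<beta>) ^ n / fact n + (- (r3 * \<beta>)) ^ n / fact n) * (F h / 2)
      + ((r3 * \<beta>) ^ n / fact n - (- (r3 * \<beta>)) ^ n / fact n) * (T F h / (2 * r3)) = \<beta> ^ n / fact n * (T ^^ n) F h"
      unfolding pow m power_mult_distrib using r3(2) by (simp add: field_simps)
  qed
  finally have "exp_operator \<beta> T F h = (exp (r3 * \<beta>) + exp (- (r3 * \<beta>))) * (F h / 2) + (exp (r3 * \<beta>) - exp (- (r3 * \<beta>))) * (T F h / (2 * r3))"
    unfolding exp_operator_def by (simp add: sums_iff)
  then show "exp_operator \<beta> T F h = cosh (r3 * \<beta>) * F h + sinh (r3 * \<beta>) / r3 * T F h"
    by (simp add: cosh_def sinh_def scaleR_conv_of_real field_simps)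
qed

section \<open>Wilson loops with matrices inserted at the passages\<close>

context oriented_diagram
begin

text \<open>X is indexed by passages and acts where an arc leaves its passage. A closed arc reads X
  at a cut point that is not active, where X is the identity in the state sum.\<close>

definition loops_with :: "(passage \<Rightarrow> complex^2^2) \<Rightarrow> (arc \<Rightarrow> complex^2^2) \<Rightarrow> complex" where
  "loops_with X h = wilson K s D (\<lambda>l. X (fst (fe l)) ** h l)"

lemma loops_with_polyfun: "loops_with X \<in> polyfun \<A>"
  unfolding loops_with_def[abs_def] by (rule polyfun_left_mult[OF wilson_polyfun])

lemma loops_with_upd:
  assumes p: "p \<in> ap"
  shows "loops_with (X(p := Z)) h
    = wilson K s D ((\<lambda>l. X (fst (fe l)) ** h l)(out_arc K s D p := Z ** h (out_arc K s D p)))"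
  unfolding loops_with_def
proof (rule polyfun_cong[OF wilson_polyfun])
  let ?l = "out_arc K s D p"
  fix l assume l: "l \<in> \<A>"
  have e: "fe ?l = out_edge D p" by (rule out_arc(2)[OF p])
  show "(X(p := Z)) (fst (fe l)) ** h l = ((\<lambda>l. X (fst (fe l)) ** h l)(?l := Z ** h ?l)) l"
  proof (cases "l = ?l")
    case True
    then show ?thesis using e out_edge(2)[OF p] by simp
  next
    case False
    have "fst (fe l) \<noteq> p"
    proof
      assume "fst (fe l) = p"
      then have "fe l = out_edge D p" using out_edge_eq[OF arc_first_edge(2)[OF l]] p by simp
      then have "edge_arc (fe l) = edge_arc (fe ?l)" using e by simp
      then show False using False arc_first_edge(1)[OF l] arc_first_edge(1)[OF out_arc(1)[OF p]] by simp
    qed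
    then show ?thesis using False by simp
  qed
qed

lemma loops_with_linear:
  assumes p: "p \<in> ap"
  shows "\<exists>M. \<forall>Z. loops_with (X(p := Z)) h = trace (Z ** M)"
proof -
  obtain M where "\<And>Z. wilson K s D ((\<lambda>l. X (fst (fe l)) ** h l)(out_arc K s D p := Z)) = trace (Z ** M)"
    using wilson_linear[OF out_arc(1)[OF p]] by blast
  then have "loops_with (X(p := Z)) h = trace (Z ** (h (out_arc K s D p) ** M))" for Z
    by (simp add: loops_with_upd[OF p] matrix_mul_assoc)
  then show ?thesis by blast
qed

lemma matrix_add_distrib2: "(M + N) ** R = M ** R + N ** (R :: complex^2^2)" for M N :: "complex^2^2"
  by (simp add: matrix2_expand algebra_simps)

text \<open>The half of an insertion on the incoming arc puts Y to the left of a matrix already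
  present at the passage, the half on the outgoing arc puts it to the right.\<close>

definition anti :: "complex^2^2 \<Rightarrow> complex^2^2 \<Rightarrow> complex^2^2" where
  "anti Y Z = (1 / 2) *\<^sub>R (Y ** Z + Z ** Y)"

lemma insertion_values_polyfun:
  assumes "l \<in> \<A>"
  shows "(\<lambda>h. ((if l = l1 then (1/2) *\<^sub>R (h l ** X) else 0) +
            (if l = l2 then (1/2) *\<^sub>R (X ** h l) else 0)) $ i $ j) \<in> polyfun \<A>"
proof -
  have 1: "(\<lambda>h. ((1/2) *\<^sub>R (h l ** X)) $ i $ j) \<in> polyfun \<A>"
    using assms by (simp add: matrix_matrix_mult_def sum_2 scaleR_conv_of_real)
      (intro polyfun.intros)
  have 2: "(\<lambda>h. ((1/2) *\<^sub>R (X ** h l)) $ i $ j) \<in> polyfun \<A>"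
    using assms by (simp add: matrix_matrix_mult_def sum_2 scaleR_conv_of_real)
      (intro polyfun.intros)
  have 0: "(\<lambda>h. 0 $ i $ j) \<in> polyfun \<A>" by (simp add: polyfun.const)
  show ?thesis
    by (cases "l = l1"; cases "l = l2") (use polyfun.add[OF 1 2] 1 2 0 in \<open>simp_all\<close>)
qed

lemma insertion_linear: "linear_on_polyfun \<A> (insertion K s D p Y)"
  unfolding insertion_def
  by (intro derivation_linear derivation_with_values insertion_values_polyfun)

text \<open>Along the line h + z V the value is a polynomial of degree at most two in z, whose
  linear coefficient is the derivative sought. \<open>wilson_linear\<close> for the outgoing arc and
  \<open>wilson_slide\<close> reduce both halves of the insertion to one linear functional.\<close>

lemma insertion_loops_with:
  assumes p: "p \<in> ap"
  shows "insertion K s D p Y (loops_with X) = loops_with (X(p := anti Y (X p)))"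
proof
  fix h :: "arc \<Rightarrow> complex^2^2"
  let ?l1 = "in_arc K s D p" and ?l2 = "out_arc K s D p" and ?g = "\<lambda>l. X (fst (fe l)) ** h l"
  let ?V = "\<lambda>l h. (if l = ?l1 then (1/2) *\<^sub>R (h l ** Y) else 0) + (if l = ?l2 then (1/2) *\<^sub>R (Y ** h l) else 0)"
  have D: "((\<lambda>z. loops_with X (\<lambda>l. h l + mat z ** ?V l h)) has_field_derivative
      insertion K s D p Y (loops_with X) h) (at 0)"
    unfolding insertion_def
    by (rule derivation_with_values_deriv[OF insertion_values_polyfun loops_with_polyfun])
  have M': "\<exists>M'. \<forall>Z. wilson K s D (?g(?l2 := Z)) = trace (Z ** M')"
    by (rule wilson_linear[OF out_arc(1)[OF p]])
  then obtain M' where M': "\<And>Z. wilson K s D (?g(?l2 := Z)) = trace (Z ** M')" by blast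
  have st: "fst (fe ?l2) = p" using out_arc(2)[OF p] out_edge(2)[OF p] by simp
  have MM: "loops_with (X(p := Z)) h = trace (Z ** (h ?l2 ** M'))" for Z
    using M' by (simp add: loops_with_upd[OF p] matrix_mul_assoc)
  let ?R = "h ?l2 ** M'"
  have "\<exists>t2. \<forall>z. loops_with X (\<lambda>l. h l + mat z ** ?V l h)
      = trace (X p ** ?R) + z * trace (anti Y (X p) ** ?R) + z\<^sup>2 * t2"
  proof (cases "?l1 = ?l2")
    \<comment> \<open>Here one arc both ends and starts at p. Its variable receives both terms, so
      the value is affine in z and there is no quadratic term.\<close>
    case True
    have Z: "wilson K s D (?g(?l2 := U ** Y)) = wilson K s D (?g(?l2 := Y ** U))" for U
      using wilson_slide[OF p, of "?g(?l2 := U)" Y] True by simp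
    have "loops_with X (\<lambda>l. h l + mat z ** ?V l h) = trace (X p ** ?R) + z * trace (anti Y (X p) ** ?R)" for z
    proof -
      have "loops_with X (\<lambda>l. h l + mat z ** ?V l h)
          = wilson K s D (?g(?l2 := X p ** (h ?l2 + mat z ** ((1/2) *\<^sub>R (h ?l2 ** Y) + (1/2) *\<^sub>R (Y ** h ?l2)))))"
        unfolding loops_with_def using st True
        by (intro arg_cong[of _ _ "wilson K s D"]) (auto simp: fun_eq_iff)
      also have "\<dots> = trace (X p ** ?R) + z / 2 * trace ((X p ** h ?l2 ** Y) ** M') + z / 2 * trace (X p ** Y ** ?R)"
        unfolding M' half_scaleR by (simp add: matrix2_expand algebra_simps)
      also have "trace ((X p ** h ?l2 ** Y) ** M') = trace (Y ** (X p ** h ?l2) ** M')"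
        using Z[of "X p ** h ?l2"] unfolding M' .
      finally show ?thesis
        unfolding anti_def half_scaleR by (simp add: matrix2_expand algebra_simps)
    qed
    then show ?thesis by (intro exI[of _ 0]) simp
  next
    case False
    let ?t = "trace (Y ** X p ** Y ** ?R) / 4"
    have "loops_with X (\<lambda>l. h l + mat z ** ?V l h) = trace (X p ** ?R) + z * trace (anti Y (X p) ** ?R) + z\<^sup>2 * ?t" for z
    proof -
      \<comment> \<open>The perturbation multiplies by the same factor, on the right of the incoming
        arc and on the left of the outgoing one; sliding the first across p leaves a change in one
        arc only.\<close>
      let ?E = "mat 1 + mat (z / 2) ** Y"
      have E1: "h ?l1 + mat z ** ((1/2) *\<^sub>R (h ?l1 ** Y)) = h ?l1 ** ?E"
        unfolding half_scaleR by (simp add: matrix2_expand algebra_simps)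
      have E2: "h ?l2 + mat z ** ((1/2) *\<^sub>R (Y ** h ?l2)) = ?E ** h ?l2"
        unfolding half_scaleR by (simp add: matrix2_expand algebra_simps)
      let ?g' = "?g(?l2 := X p ** ?E ** h ?l2)"
      have mz: "mat z ** (0 :: complex^2^2) = 0" by (simp add: matrix2_expand)
      have "loops_with X (\<lambda>l. h l + mat z ** ?V l h) = wilson K s D (?g'(?l1 := ?g' ?l1 ** ?E))"
        unfolding loops_with_def using st False E1 E2 mz
        by (intro arg_cong[of _ _ "wilson K s D"]) (auto simp: fun_eq_iff matrix_mul_assoc[symmetric])
      also have "\<dots> = wilson K s D (?g'(?l2 := ?E ** ?g' ?l2))" by (rule wilson_slide[OF p])
      also have "\<dots> = trace (?E ** (X p ** ?E ** h ?l2) ** M')" using M' by simp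
      also have "\<dots> = trace (X p ** ?R) + z * trace (anti Y (X p) ** ?R) + z\<^sup>2 * ?t"
      proof -
        have "trace ((mat 1 + mat c ** Y) ** (P ** (mat 1 + mat c ** Y)) ** Q)
            = trace (P ** Q) + c * (trace (Y ** P ** Q) + trace (P ** Y ** Q)) + c\<^sup>2 * trace (Y ** P ** Y ** Q)" for P Q c
          by (simp add: matrix2_expand algebra_simps power2_eq_square)
        from this[of "z / 2" "X p" ?R]
        have "trace (?E ** (X p ** ?E ** h ?l2) ** M')
            = trace (X p ** ?R) + z / 2 * (trace (Y ** X p ** ?R) + trace (X p ** Y ** ?R)) + (z / 2)\<^sup>2 * trace (Y ** X p ** Y ** ?R)"
          by (simp only: matrix_mul_assoc)
        moreover have "trace (anti Y (X p) ** ?R) = (trace (Y ** X p ** ?R) + trace (X p ** Y ** ?R)) / 2"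
          by (simp add: anti_def half_scaleR matrix_mul_assoc[symmetric] trace_mat_mult matrix_add_distrib2 trace_add)
        ultimately show ?thesis by (simp add: power2_eq_square)
      qed
      finally show ?thesis .
    qed
    then show ?thesis by blast
  qed
  then obtain t2 where t2: "\<And>z. loops_with X (\<lambda>l. h l + mat z ** ?V l h)
      = trace (X p ** ?R) + z * trace (anti Y (X p) ** ?R) + z\<^sup>2 * t2" by blast
  have "((\<lambda>z. loops_with X (\<lambda>l. h l + mat z ** ?V l h)) has_field_derivative trace (anti Y (X p) ** ?R)) (at 0)"
    unfolding t2 by (auto intro!: derivative_eq_intros)
  from DERIV_unique[OF D this] show "insertion K s D p Y (loops_with X) h = loops_with (X(p := anti Y (X p))) h"
    using MM by simp
qed

end

context oriented_diagram
begin

abbreviation "pp \<equiv> plus_passage K D"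
abbreviation "pm \<equiv> minus_passage K D"
abbreviation "active i \<equiv> i < ncross K \<and> s i = Active"

lemma plus_minus: "{pp i, pm i} = {over K i, under K i}"
  by (auto simp: plus_passage_def minus_passage_def)

lemma plus_minus_ap:
  assumes "active i"
  shows "pp i \<in> ap" "pm i \<in> ap" "pp i \<noteq> pm i"
proof -
  have "{pp i, pm i} \<subseteq> ap" unfolding plus_minus using assms by (auto simp: active_passages_def)
  then show "pp i \<in> ap" "pm i \<in> ap" by auto
  show "pp i \<noteq> pm i" using crossing(3)[of i] assms by (auto simp: plus_passage_def minus_passage_def)
qed

lemma plus_minus_distinct:
  assumes "i < ncross K" "j < ncross K" "i \<noteq> j"
  shows "{pp i, pm i} \<inter> {pp j, pm j} = {}"
  unfolding plus_minus using crossing_distinct[OF assms(1,2)] assms(3) by blast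

end

section \<open>Exponentials of the crossing operators\<close>

locale wilson_expectation = oriented_diagram K s D + su2_basis e
  for K s D and e :: "'n::finite \<Rightarrow> complex^2^2" +
  fixes bt :: complex
begin

abbreviation "T \<equiv> crossing_operator e K s D"
abbreviation "sg \<equiv> crossing_sign K D"

text \<open>The coefficients of the identity and of the Casimir insertion in the exponential at one
  crossing; \<open>2 * sg i\<close> in the second is the prefactor of the crossing operator.\<close>

definition unit_weight :: complex where "unit_weight = cosh (of_real (sqrt 3) * bt)"
definition casimir_weight :: "nat \<Rightarrow> complex" where "casimir_weight i = sinh (of_real (sqrt 3) * bt) / of_real (sqrt 3) * (2 * sg i)"

lemma sg_square: "sg i * sg i = 1"
  by (simp add: crossing_sign_def)

lemma linear_compose_comb:
  fixes A B :: "'n \<Rightarrow> (('l \<Rightarrow> complex^2^2) \<Rightarrow> complex) \<Rightarrow> ('l \<Rightarrow> complex^2^2) \<Rightarrow> complex"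
  assumes A: "\<And>\<alpha>. linear_on_polyfun S (A \<alpha>)" and B: "\<And>\<beta>. linear_on_polyfun S (B \<beta>)"
  shows "linear_on_polyfun S (\<lambda>f h. c * (\<Sum>\<alpha>\<in>UNIV. \<Sum>\<beta>\<in>UNIV. w \<alpha> \<beta> * A \<alpha> (B \<beta> f) h))"
proof -
  have P: "A \<alpha> (B \<beta> f) \<in> polyfun S" if "f \<in> polyfun S" for f \<alpha> \<beta>
    by (intro linear_on_polyfunD(1)[OF A] linear_on_polyfunD(1)[OF B] that)
  show ?thesis
    unfolding linear_on_polyfun_def
  proof (intro conjI ballI allI)
    fix f assume f: "f \<in> polyfun S"
    show "(\<lambda>h. c * (\<Sum>\<alpha>\<in>UNIV. \<Sum>\<beta>\<in>UNIV. w \<alpha> \<beta> * A \<alpha> (B \<beta> f) h)) \<in> polyfun S"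
      by (intro polyfun.mult polyfun.const linear_on_polyfun_comb(1)[OF A[of undefined]] P f)
    fix k
    show "(\<lambda>h. c * (\<Sum>\<alpha>\<in>UNIV. \<Sum>\<beta>\<in>UNIV. w \<alpha> \<beta> * A \<alpha> (B \<beta> (\<lambda>h. k * f h)) h))
      = (\<lambda>h. k * (c * (\<Sum>\<alpha>\<in>UNIV. \<Sum>\<beta>\<in>UNIV. w \<alpha> \<beta> * A \<alpha> (B \<beta> f) h)))"
      by (simp add: linear_on_polyfunD(3)[OF B f] linear_on_polyfunD(3)[OF A linear_on_polyfunD(1)[OF B f]]
          sum_distrib_left mult_ac)
  next
    fix f g assume f: "f \<in> polyfun S" and g: "g \<in> polyfun S"
    show "(\<lambda>h. c * (\<Sum>\<alpha>\<in>UNIV. \<Sum>\<beta>\<in>UNIV. w \<alpha> \<beta> * A \<alpha> (B \<beta> (\<lambda>h. f h + g h)) h))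
      = (\<lambda>h. c * (\<Sum>\<alpha>\<in>UNIV. \<Sum>\<beta>\<in>UNIV. w \<alpha> \<beta> * A \<alpha> (B \<beta> f) h)
          + c * (\<Sum>\<alpha>\<in>UNIV. \<Sum>\<beta>\<in>UNIV. w \<alpha> \<beta> * A \<alpha> (B \<beta> g) h))"
      by (simp add: linear_on_polyfunD(2)[OF B f g]
          linear_on_polyfunD(2)[OF A linear_on_polyfunD(1)[OF B f] linear_on_polyfunD(1)[OF B g]]
          distrib_left sum.distrib)
  qed
qed

lemma T_linear: "linear_on_polyfun \<A> (T i)"
  unfolding crossing_operator_def[abs_def] by (rule linear_compose_comb) (rule insertion_linear)+

text \<open>Closed form of the iterated exponentials: each listed crossing contributes either
  nothing or a Casimir pair at its passages. Keeping X as a parameter lets the insertions of one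
  crossing pass through the others.\<close>

primrec expanded :: "nat list \<Rightarrow> (passage \<Rightarrow> complex^2^2) \<Rightarrow> (arc \<Rightarrow> complex^2^2) \<Rightarrow> complex" where
  "expanded [] X = loops_with X"
| "expanded (i # L) X = (\<lambda>h. unit_weight * expanded L X h + casimir_weight i *
     (\<Sum>\<alpha>\<in>UNIV. \<Sum>\<beta>\<in>UNIV. G \<alpha> \<beta> * expanded L (X(pm i := e \<beta>, pp i := e \<alpha>)) h))"

lemma expanded_polyfun: "expanded L X \<in> polyfun \<A>"
proof (induction L arbitrary: X)
  case Nil show ?case by (simp add: loops_with_polyfun)
next
  case (Cons i L)
  show ?case
    unfolding expanded.simps
    by (intro polyfun.add polyfun.mult polyfun.const Cons linear_on_polyfun_comb(1)[OF T_linear])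
qed

text \<open>Wilson loops are linear in the matrix at p, and the crossings of L do not overwrite
  it.\<close>

lemma expanded_scale:
  assumes "p \<in> ap" "\<forall>i\<in>set L. p \<notin> {pp i, pm i}"
  shows "expanded L (X(p := mat c)) h = c * expanded L (X(p := mat 1)) h"
  using assms(2)
proof (induction L arbitrary: X)
  case Nil
  obtain M where "\<And>Z. loops_with (X(p := Z)) h = trace (Z ** M)" using loops_with_linear[OF assms(1)] by blast
  then show ?case unfolding expanded.simps using trace_mat_mult[of c M] by (simp del: fun_upd_apply)
next
  case (Cons i L)
  then have p: "p \<noteq> pm i" "p \<noteq> pp i" by auto
  have tw: "X(p := Z, pm i := U, pp i := V) = X(pm i := U, pp i := V, p := Z)" for Z U V
    using p by (auto simp: fun_eq_iff)
  have IH: "expanded L (X(p := mat c)) h = c * expanded L (X(p := mat 1)) h" for X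
    by (rule Cons.IH) (use Cons.prems in simp)
  show ?case
    unfolding expanded.simps tw IH[of X] IH[of "X(pm i := _, pp i := _)"]
    by (simp add: distrib_left sum_distrib_left mult_ac del: fun_upd_apply)
qed

text \<open>No crossing of L touches p, so its updates commute with the one at p, and linearity
  carries the derivation through the sums.\<close>

lemma insertion_expanded:
  assumes "p \<in> ap" "\<forall>i\<in>set L. p \<notin> {pp i, pm i}"
  shows "insertion K s D p Y (expanded L X) = expanded L (X(p := anti Y (X p)))"
  using assms(2)
proof (induction L arbitrary: X)
  case Nil show ?case unfolding expanded.simps by (rule insertion_loops_with[OF assms(1)])
next
  case (Cons i L)
  let ?I = "insertion K s D p Y"
  let ?F = "\<lambda>X \<alpha> \<beta>. expanded L (X(pm i := e \<beta>, pp i := e \<alpha>))"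
  have p: "p \<noteq> pm i" "p \<noteq> pp i" using Cons.prems by auto
  have lin: "linear_on_polyfun \<A> ?I" by (rule insertion_linear)
  have S: "(\<lambda>h. \<Sum>\<alpha>\<in>UNIV. \<Sum>\<beta>\<in>UNIV. G \<alpha> \<beta> * ?F X \<alpha> \<beta> h) \<in> polyfun \<A>"
    by (rule linear_on_polyfun_comb(1)[OF lin]) (rule expanded_polyfun)
  have "?I (expanded (i # L) X) = (\<lambda>h. ?I (\<lambda>h. unit_weight * expanded L X h) h
      + ?I (\<lambda>h. casimir_weight i * (\<Sum>\<alpha>\<in>UNIV. \<Sum>\<beta>\<in>UNIV. G \<alpha> \<beta> * ?F X \<alpha> \<beta> h)) h)"
    unfolding expanded.simps
    by (rule linear_on_polyfunD(2)[OF lin]) (intro polyfun.mult polyfun.const expanded_polyfun S)+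
  also have "\<dots> = (\<lambda>h. unit_weight * ?I (expanded L X) h + casimir_weight i * (\<Sum>\<alpha>\<in>UNIV. \<Sum>\<beta>\<in>UNIV. G \<alpha> \<beta> * ?I (?F X \<alpha> \<beta>) h))"
    unfolding linear_on_polyfunD(3)[OF lin expanded_polyfun] linear_on_polyfunD(3)[OF lin S]
      linear_on_polyfun_comb(2)[OF lin expanded_polyfun] ..
  also have "\<dots> = expanded (i # L) (X(p := anti Y (X p)))"
  proof -
    have "X(p := anti Y (X p), pm i := U, pp i := V) = (X(pm i := U, pp i := V))(p := anti Y ((X(pm i := U, pp i := V)) p))" for U V
      using p by (auto simp: fun_eq_iff)
    moreover have "?I (expanded L X) = expanded L (X(p := anti Y (X p)))" for X
      by (rule Cons.IH) (use Cons.prems in simp)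
    ultimately show ?thesis unfolding expanded.simps by simp
  qed
  finally show ?case .
qed

context
  fixes i L
  assumes i: "active i" and L: "\<forall>j\<in>set L. active j" "i \<notin> set L"
begin

lemma not_in_list: "\<forall>j\<in>set L. pp i \<notin> {pp j, pm j}" "\<forall>j\<in>set L. pm i \<notin> {pp j, pm j}"
  using plus_minus_distinct[of i] i L by (metis Int_iff emptyE insertCI)+

lemma T_expanded:
  "T i (expanded L X) = (\<lambda>h. 2 * sg i * (\<Sum>\<alpha>\<in>UNIV. \<Sum>\<beta>\<in>UNIV. G \<alpha> \<beta> *
     expanded L (X(pm i := anti (e \<beta>) (X (pm i)), pp i := anti (e \<alpha>) (X (pp i)))) h))"
proof -
  note pm = plus_minus_ap[OF i]
  have "(X(pm i := U)) (pp i) = X (pp i)" for U using pm(3) by simp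
  then show ?thesis
    unfolding crossing_operator_def insertion_expanded[OF pm(2) not_in_list(2)]
      insertion_expanded[OF pm(1) not_in_list(1)] by simp
qed

lemma anti_one: "anti Y (mat 1) = Y"
  by (simp add: anti_def flip: scaleR_2)

lemma anti_basis: "anti (e \<alpha>) (e \<beta>) = mat (g \<alpha> \<beta> / 2)"
  unfolding anti_def half_scaleR traceless_anticommutator[OF trace_e trace_e]
  by (simp add: matrix2_expand)

lemma T_expanded_one:
  assumes X: "X (pp i) = mat 1" "X (pm i) = mat 1"
  shows "T i (expanded L X) = (\<lambda>h. 2 * sg i * (\<Sum>\<alpha>\<in>UNIV. \<Sum>\<beta>\<in>UNIV. G \<alpha> \<beta> *
     expanded L (X(pm i := e \<beta>, pp i := e \<alpha>)) h))"
  unfolding T_expanded X anti_one ..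

text \<open>The first application puts basis elements at the two passages, the second turns them
  into the scalars g / 2. The two prefactors \<open>2 * sg i\<close> cancel the halves, and the
  contraction of G g G g counts the basis elements.\<close>

lemma T_square:
  assumes X: "X (pp i) = mat 1" "X (pm i) = mat 1"
  shows "T i (T i (expanded L X)) = (\<lambda>h. 3 * expanded L X h)"
proof
  fix h
  note pm = plus_minus_ap[OF i]
  let ?F = "\<lambda>\<alpha> \<beta>. expanded L (X(pm i := e \<beta>, pp i := e \<alpha>))"
  let ?E = "expanded L X h"
  have sc: "expanded L (X(pm i := mat c, pp i := mat d)) h = c * d * ?E" for c d
  proof -
    have tw: "X(pm i := mat c, pp i := mat 1) = X(pp i := mat 1, pm i := mat c)"
      by (rule fun_upd_twist) (use pm(3) in simp)
    have "expanded L (X(pm i := mat c, pp i := mat d)) h = d * expanded L (X(pp i := mat 1, pm i := mat c)) h"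
      unfolding expanded_scale[OF pm(1) not_in_list(1), of "X(pm i := mat c)" d h] tw ..
    also have "\<dots> = d * (c * expanded L (X(pp i := mat 1, pm i := mat 1)) h)"
      unfolding expanded_scale[OF pm(2) not_in_list(2), of "X(pp i := mat 1)" c h] ..
    also have "X(pp i := mat 1, pm i := mat 1) = X" using X by (auto simp: fun_eq_iff)
    finally show ?thesis by (simp only: mult_ac)
  qed
  have TF: "T i (?F \<alpha> \<beta>) h = 2 * sg i * (\<Sum>\<gamma>\<in>UNIV. \<Sum>\<delta>\<in>UNIV. G \<gamma> \<delta> * (g \<delta> \<beta> / 2 * (g \<gamma> \<alpha> / 2) * ?E))" for \<alpha> \<beta>
  proof -
    have *: "(X(pm i := e \<beta>, pp i := e \<alpha>))(pm i := anti (e \<delta>) ((X(pm i := e \<beta>, pp i := e \<alpha>)) (pm i)),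
        pp i := anti (e \<gamma>) ((X(pm i := e \<beta>, pp i := e \<alpha>)) (pp i))) = X(pm i := mat (g \<delta> \<beta> / 2), pp i := mat (g \<gamma> \<alpha> / 2))" for \<gamma> \<delta>
      using pm(3) by (auto simp: fun_eq_iff anti_basis)
    show ?thesis unfolding T_expanded * sc ..
  qed
  have comb: "(\<lambda>h. \<Sum>\<alpha>\<in>UNIV. \<Sum>\<beta>\<in>UNIV. G \<alpha> \<beta> * ?F \<alpha> \<beta> h) \<in> polyfun \<A>"
    "T i (\<lambda>h. \<Sum>\<alpha>\<in>UNIV. \<Sum>\<beta>\<in>UNIV. G \<alpha> \<beta> * ?F \<alpha> \<beta> h) = (\<lambda>h. \<Sum>\<alpha>\<in>UNIV. \<Sum>\<beta>\<in>UNIV. G \<alpha> \<beta> * T i (?F \<alpha> \<beta>) h)"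
    by (rule linear_on_polyfun_comb[OF T_linear expanded_polyfun])+
  have "T i (T i (expanded L X)) h = 2 * sg i * (\<Sum>\<alpha>\<in>UNIV. \<Sum>\<beta>\<in>UNIV. G \<alpha> \<beta> * T i (?F \<alpha> \<beta>) h)"
    unfolding T_expanded_one[OF X] linear_on_polyfunD(3)[OF T_linear comb(1)] comb(2) ..
  also have "\<dots> = 2 * sg i * (\<Sum>\<alpha>\<in>UNIV. \<Sum>\<beta>\<in>UNIV. G \<alpha> \<beta> *
      (2 * sg i * (\<Sum>\<gamma>\<in>UNIV. \<Sum>\<delta>\<in>UNIV. G \<gamma> \<delta> * (g \<delta> \<beta> / 2 * (g \<gamma> \<alpha> / 2) * ?E))))"
    unfolding TF ..
  also have "\<dots> = (\<Sum>\<alpha>\<in>UNIV. \<Sum>\<beta>\<in>UNIV. \<Sum>\<gamma>\<in>UNIV. \<Sum>\<delta>\<in>UNIV. (G \<alpha> \<beta> * g \<beta> \<delta>) * (G \<gamma> \<delta> * g \<gamma> \<alpha>)) * ?E"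
  proof -
    have "2 * sg i * (G \<alpha> \<beta> * (2 * sg i * (G \<gamma> \<delta> * (g \<delta> \<beta> / 2 * (g \<gamma> \<alpha> / 2) * ?E))))
        = (G \<alpha> \<beta> * g \<beta> \<delta>) * (G \<gamma> \<delta> * g \<gamma> \<alpha>) * ?E" for \<alpha> \<beta> \<gamma> \<delta>
    proof -
      have "2 * sg i * (G \<alpha> \<beta> * (2 * sg i * (G \<gamma> \<delta> * (g \<delta> \<beta> / 2 * (g \<gamma> \<alpha> / 2) * ?E))))
        = (sg i * sg i) * ((G \<alpha> \<beta> * g \<delta> \<beta>) * (G \<gamma> \<delta> * g \<gamma> \<alpha>) * ?E)" by (simp add: field_simps)
      then show ?thesis by (simp add: sg_square trace_mult_commute[of "e \<delta>" "e \<beta>"])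
    qed
    then show ?thesis unfolding sum_distrib_left sum_distrib_right by (intro sum.cong refl)
  qed
  \<comment> \<open>The sum over \<beta> is moved innermost, where \<open>G_left\<close> evaluates
    it to a Kronecker delta.\<close>
  also have "(\<Sum>\<alpha>\<in>UNIV. \<Sum>\<beta>\<in>UNIV. \<Sum>\<gamma>\<in>UNIV. \<Sum>\<delta>\<in>UNIV. (G \<alpha> \<beta> * g \<beta> \<delta>) * (G \<gamma> \<delta> * g \<gamma> \<alpha>))
      = (\<Sum>\<alpha>\<in>UNIV. \<Sum>\<gamma>\<in>UNIV. \<Sum>\<delta>\<in>UNIV. (\<Sum>\<beta>\<in>UNIV. G \<alpha> \<beta> * g \<beta> \<delta>) * (G \<gamma> \<delta> * g \<gamma> \<alpha>))"
  proof (rule sum.cong[OF refl])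
    fix \<alpha>
    have "(\<Sum>\<beta>\<in>UNIV. \<Sum>\<gamma>\<in>UNIV. \<Sum>\<delta>\<in>UNIV. (G \<alpha> \<beta> * g \<beta> \<delta>) * (G \<gamma> \<delta> * g \<gamma> \<alpha>))
        = (\<Sum>\<gamma>\<in>UNIV. \<Sum>\<beta>\<in>UNIV. \<Sum>\<delta>\<in>UNIV. (G \<alpha> \<beta> * g \<beta> \<delta>) * (G \<gamma> \<delta> * g \<gamma> \<alpha>))"
      by (rule sum.swap)
    also have "\<dots> = (\<Sum>\<gamma>\<in>UNIV. \<Sum>\<delta>\<in>UNIV. \<Sum>\<beta>\<in>UNIV. (G \<alpha> \<beta> * g \<beta> \<delta>) * (G \<gamma> \<delta> * g \<gamma> \<alpha>))"
      by (intro sum.cong refl sum.swap)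
    finally show "(\<Sum>\<beta>\<in>UNIV. \<Sum>\<gamma>\<in>UNIV. \<Sum>\<delta>\<in>UNIV. (G \<alpha> \<beta> * g \<beta> \<delta>) * (G \<gamma> \<delta> * g \<gamma> \<alpha>))
        = (\<Sum>\<gamma>\<in>UNIV. \<Sum>\<delta>\<in>UNIV. (\<Sum>\<beta>\<in>UNIV. G \<alpha> \<beta> * g \<beta> \<delta>) * (G \<gamma> \<delta> * g \<gamma> \<alpha>))"
      by (simp add: sum_distrib_right)
  qed
  also have "\<dots> = (\<Sum>\<alpha>\<in>UNIV. \<Sum>\<gamma>\<in>UNIV. g \<alpha> \<gamma> * G \<gamma> \<alpha>)"
  proof (intro sum.cong refl)
    fix \<alpha> \<gamma>
    have "(\<Sum>\<delta>\<in>UNIV. (\<Sum>\<beta>\<in>UNIV. G \<alpha> \<beta> * g \<beta> \<delta>) * (G \<gamma> \<delta> * g \<gamma> \<alpha>))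
      = (\<Sum>\<delta>\<in>UNIV. if \<alpha> = \<delta> then G \<gamma> \<delta> * g \<gamma> \<alpha> else 0)"
      unfolding G_left by (intro sum.cong) auto
    then show "(\<Sum>\<delta>\<in>UNIV. (\<Sum>\<beta>\<in>UNIV. G \<alpha> \<beta> * g \<beta> \<delta>) * (G \<gamma> \<delta> * g \<gamma> \<alpha>)) = g \<alpha> \<gamma> * G \<gamma> \<alpha>"
      by (simp add: trace_mult_commute[of "e \<gamma>" "e \<alpha>"])
  qed
  also have "\<dots> = 3" unfolding G_right using card_basis by simp
  finally show "T i (T i (expanded L X)) h = 3 * ?E" .
qed

lemma exp_expanded:
  assumes X: "X (pp i) = mat 1" "X (pm i) = mat 1"
  shows "exp_operator bt (T i) (expanded L X) = expanded (i # L) X"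
  unfolding exp_operator_square[OF T_linear expanded_polyfun T_square[OF X]] T_expanded_one[OF X]
  by (simp add: unit_weight_def casimir_weight_def mult.assoc)

end

lemma foldr_exp:
  "\<forall>j\<in>set L. active j \<Longrightarrow> distinct L \<Longrightarrow>
    foldr (\<lambda>i. exp_operator bt (T i)) L (wilson K s D) = expanded L (\<lambda>p. mat 1)"
proof (induction L)
  case Nil show ?case by (simp add: loops_with_def[abs_def])
next
  case (Cons i L)
  then show ?case using exp_expanded[of i L "\<lambda>p. mat 1"] by simp
qed

lemma expectation_expanded:
  "expectation bt e K s D = expanded (filter (\<lambda>i. s i = Active) [0..<ncross K]) (\<lambda>p. mat 1)"
  unfolding expectation_def by (rule foldr_exp) auto

end

section \<open>The state sum\<close>

context oriented_diagram
begin

text \<open>Counterpart of \<open>loops_with\<close> for half-strands: edges along D carry X at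
  their start, and \<open>insert_matrices\<close> gives their reversals the adjugate at the
  end.\<close>

definition inserted :: "(half_strand \<Rightarrow> complex^2^2) \<Rightarrow> (passage \<Rightarrow> complex^2^2) \<Rightarrow> half_strand \<Rightarrow> complex^2^2" where
  "inserted w X = insert_matrices (far_end K) (\<lambda>v. if v \<in> D then X (fst v) else mat 1) w"

lemma inserted_one [simp]: "inserted w (\<lambda>p. mat 1) = w"
  by (simp add: inserted_def)

lemma inserted_D: "v \<in> D \<Longrightarrow> inserted w X v = X (fst v) ** w v"
  using far_notin by (simp add: inserted_def insert_matrices_def)

lemma inserted_reversible: "reversible H (far_end K) w \<Longrightarrow> reversible H (far_end K) (inserted w X)"
  unfolding inserted_def by (rule reversible_insert[OF far_end_involution])

lemma first_edge_pow:
  assumes l: "l \<in> \<A>"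
  shows "fe ((\<sigma> ^^ m) l) = (nx ^^ (\<Sum>j<m. card ((\<sigma> ^^ j) l))) (fe l)"
proof (induction m)
  case (Suc m)
  have "fe ((\<sigma> ^^ Suc m) l) = (nx ^^ card ((\<sigma> ^^ m) l)) (fe ((\<sigma> ^^ m) l))"
    using next_arc(2)[OF next_arc_pow[OF l]] by simp
  then show ?case unfolding Suc by (simp add: add.commute[of "sum _ _"] funpow_add)
qed simp

lemma ordered_prod_arcs:
  assumes l: "l \<in> \<A>"
  shows "ordered_prod (\<lambda>m. ordered_prod (\<lambda>k. w ((nx ^^ k) (fe ((\<sigma> ^^ m) l)))) (card ((\<sigma> ^^ m) l))) n
    = ordered_prod (\<lambda>k. w ((nx ^^ k) (fe l))) (\<Sum>m<n. card ((\<sigma> ^^ m) l))"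
proof (induction n)
  case (Suc n)
  let ?S = "\<Sum>m<n. card ((\<sigma> ^^ m) l)"
  have "(nx ^^ k) (fe ((\<sigma> ^^ n) l)) = (nx ^^ (?S + k)) (fe l)" for k
    unfolding first_edge_pow[OF l] by (simp add: add.commute[of ?S] funpow_add)
  then show ?case using Suc by (simp add: ordered_prod_append)
qed simp

text \<open>Only the first edge of an arc can leave an active passage, and elsewhere X is the
  identity.\<close>

lemma arc_holonomy_inserted:
  assumes l: "l \<in> \<A>" and X: "\<And>p. p \<notin> ap \<Longrightarrow> X p = mat 1"
  shows "X (fst (fe l)) ** arc_holonomy K s A l
    = ordered_prod (\<lambda>k. inserted (edge_holonomy K A) X ((nx ^^ k) (fe l))) (card l)"
proof -
  let ?h = "edge_holonomy K A"
  obtain j where j: "card l = Suc j" using arc_structure(2)[OF l] by (cases "card l") auto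
  have x: "fe l \<in> D" by (rule arc_first_edge(2)[OF l])
  have "inserted ?h X ((nx ^^ Suc m) (fe l)) = ?h ((nx ^^ Suc m) (fe l))" if "m < j" for m
    using inserted_D[OF nx_pow_D[OF x], of ?h X "Suc m"] X arc_structure(3)[OF l, of "Suc m"] that j by simp
  then have "ordered_prod (\<lambda>m. inserted ?h X ((nx ^^ Suc m) (fe l))) j = ordered_prod (\<lambda>m. ?h ((nx ^^ Suc m) (fe l))) j"
    by (intro ordered_prod_cong)
  then show ?thesis
    unfolding arc_holonomy_def j ordered_prod_front using inserted_D[OF x, of ?h X] by (simp add: matrix_mul_assoc)
qed

text \<open>The arcs inside a component partition its edges along D, which are half of its
  half-strands.\<close>

lemma comp_arcs_card:
  assumes l: "l \<in> \<A>" and n: "inj_on (\<lambda>m. (\<sigma> ^^ m) l) {..<n}" "comp_arcs (cls (fe l)) = (\<lambda>m. (\<sigma> ^^ m) l) ` {..<n}"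
  shows "(\<Sum>m<n. card ((\<sigma> ^^ m) l)) = card (cls (fe l)) div 2"
proof -
  let ?C = "cls (fe l)"
  have x: "fe l \<in> D" by (rule arc_first_edge(2)[OF l])
  have sub: "l' \<subseteq> D" if "l' \<in> \<A>" for l'
    using arc_D[OF arc_first_edge(2)[OF that]] arc_first_edge(1)[OF that] by blast
  have "(\<Sum>m<n. card ((\<sigma> ^^ m) l)) = (\<Sum>l'\<in>comp_arcs ?C. card l')"
    unfolding n(2) by (simp add: sum.reindex[OF n(1)])
  also have "\<dots> = card (\<Union> (comp_arcs ?C))"
  proof (rule card_Union_disjoint[symmetric])
    show "pairwise disjnt (comp_arcs ?C)"
    proof (rule pairwiseI)
      fix k k' assume k: "k \<in> comp_arcs ?C" "k' \<in> comp_arcs ?C" "k \<noteq> k'"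
      show "disjnt k k'"
        unfolding disjnt_iff
      proof (intro allI notI)
        fix v assume "v \<in> k \<and> v \<in> k'"
        then have "edge_arc v = k" "edge_arc v = k'"
          using arc_same[of v "fe k"] arc_same[of v "fe k'"] arc_first_edge(1) k by auto
        then show False using k(3) by simp
      qed
    qed
    show "finite k" if "k \<in> comp_arcs ?C" for k using that finite_subset[OF sub finite_D] by blast
  qed
  also have "\<Union> (comp_arcs ?C) = ?C \<inter> D"
  proof
    show "\<Union> (comp_arcs ?C) \<subseteq> ?C \<inter> D" using sub by blast
    show "?C \<inter> D \<subseteq> \<Union> (comp_arcs ?C)"
    proof
      fix v assume v: "v \<in> ?C \<inter> D"
      have "edge_arc v \<subseteq> ?C" using arc_in_component_iff[OF x _ arc_self, of v] v by simp
      then have "edge_arc v \<in> comp_arcs ?C" using v by simp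
      then show "v \<in> \<Union> (comp_arcs ?C)" using arc_self[of v] by (rule UnionI)
    qed
  qed
  also have "card (?C \<inter> D) = card ?C div 2" by (rule component_D(2)[OF x])
  finally show ?thesis .
qed

text \<open>The factor (-1)^j is distributed over the components as the sign in
  \<open>loop_value\<close>, and the product over arcs unrolls into one over edges. For X
  identically 1 the right-hand side no longer refers to D.\<close>

lemma loops_with_state_value:
  assumes A: "is_connection A" and X: "\<And>p. p \<notin> ap \<Longrightarrow> X p = mat 1"
  shows "(-1) ^ jnum K s * loops_with X (arc_holonomy K s A)
    = state_value H (far_end K) (partner K s) (inserted (edge_holonomy K A) X)"
proof -
  let ?w = "inserted (edge_holonomy K A) X" and ?h = "\<lambda>l. X (fst (fe l)) ** arc_holonomy K s A l"
  define r where "r C = (SOME l. l \<in> comp_arcs C)" for C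
  have r: "r C \<in> comp_arcs C" if C: "C \<in> components K s" for C
  proof -
    obtain l where "l \<in> comp_arcs C" by (rule component_arc[OF C])
    then show ?thesis unfolding r_def by (rule someI)
  qed
  have rev: "reversible H (far_end K) ?w"
    by (rule inserted_reversible[OF edge_holonomy_reversible[OF A]])
  have "loop_value (far_end K) (partner K s) ?w C = - arc_trace (card (comp_arcs C)) (r C) ?h"
    if C: "C \<in> components K s" for C
  proof -
    let ?l = "r C"
    have l: "?l \<in> \<A>" and "fe ?l \<in> C" using r[OF C] first_edge(1) by auto
    then have Cl: "C = cls (fe ?l)" using component_eq[OF C] by simp
    obtain n where n: "inj_on (\<lambda>m. (\<sigma> ^^ m) ?l) {..<n}" "comp_arcs C = (\<lambda>m. (\<sigma> ^^ m) ?l) ` {..<n}"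
      "card (comp_arcs C) = n"
      by (rule comp_arcs_orbit[OF l, unfolded Cl[symmetric]])
    have "ordered_prod (\<lambda>m. ?h ((\<sigma> ^^ m) ?l)) n
      = ordered_prod (\<lambda>m. ordered_prod (\<lambda>k. ?w ((nx ^^ k) (fe ((\<sigma> ^^ m) ?l)))) (card ((\<sigma> ^^ m) ?l))) n"
      by (intro ordered_prod_cong arc_holonomy_inserted next_arc_pow l X)
    also have "\<dots> = ordered_prod (\<lambda>k. ?w ((nx ^^ k) (fe ?l))) (card C div 2)"
      using ordered_prod_arcs[OF l, of ?w n] comp_arcs_card[OF l n(1)] n(2) Cl by simp
    finally have "arc_trace (card (comp_arcs C)) ?l ?h = trace (ordered_prod (\<lambda>k. ?w ((nx ^^ k) (fe ?l))) (card C div 2))"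
      by (simp add: arc_trace_def n(3))
    also have "\<dots> = loop_trace (far_end K) (partner K s) ?w (card C div 2) (fe ?l)"
      by (simp add: loop_trace_eq nx_N)
    finally show ?thesis
      using loop_value_eq[where s = s, OF D_H[OF arc_first_edge(2)[OF l]] rev, folded Cl] by simp
  qed
  then have "state_value H (far_end K) (partner K s) ?w
      = (\<Prod>C\<in>components K s. (-1) * arc_trace (card (comp_arcs C)) (r C) ?h)"
    unfolding state_value_def components_eq[symmetric] by (intro prod.cong) simp_all
  also have "\<dots> = (-1) ^ card (components K s) * (\<Prod>C\<in>components K s. arc_trace (card (comp_arcs C)) (r C) ?h)"
    by (simp only: prod.distrib prod_constant)
  also have "\<dots> = (-1) ^ jnum K s * loops_with X (arc_holonomy K s A)"
    unfolding jnum_def loops_with_def by (subst wilson_eq[OF r]) simp_all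
  finally show ?thesis by simp
qed

end

section \<open>Summation over smoothings\<close>

context diagram
begin

text \<open>If L lists all active crossings of t, this is Kauffman's state sum with weights a and b,
  each loop valued by minus the trace of its holonomy.\<close>

primrec state_sum :: "complex \<Rightarrow> complex \<Rightarrow> nat list \<Rightarrow> (nat \<Rightarrow> smoothing) \<Rightarrow>
    (half_strand \<Rightarrow> complex^2^2) \<Rightarrow> complex" where
  "state_sum a b [] t w = state_value (half_strands K) (far_end K) (partner K t) w"
| "state_sum a b (i # L) t w =
     a * state_sum a b L (t(i := SmoothA)) w + b * state_sum a b L (t(i := SmoothB)) w"

text \<open>Smoothings at different crossings commute, so any listed crossing can be resolved first;
  this is the skein relation at the level of state sums.\<close>

lemma state_sum_append:
  assumes "i \<notin> set L"
  shows "state_sum a b (L @ i # L') t w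
    = a * state_sum a b (L @ L') (t(i := SmoothA)) w + b * state_sum a b (L @ L') (t(i := SmoothB)) w"
  using assms
proof (induction L arbitrary: t)
  case (Cons j L)
  have tw: "t(j := S, i := S') = t(i := S', j := S)" for S S' using Cons.prems by (auto simp: fun_eq_iff)
  have "i \<notin> set L" using Cons.prems by simp
  note IH = Cons.IH[OF this]
  show ?case
    unfolding append_Cons state_sum.simps IH tw by (simp add: algebra_simps del: fun_upd_apply)
qed simp

lemma partner_update:
  assumes i: "i < ncross K" and v: "v \<in> half_strands K" "fst v \<notin> {over K i, under K i}"
  shows "partner K (t(i := S)) v = partner K t v"
proof (rule partner_eqI[OF v(1) partner_joined(1)[OF v(1)]])
  have "joined K t v (partner K t v)" by (rule partner_joined(2)[OF v(1)])
  then show "joined K (t(i := S)) v (partner K t v)"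
    unfolding joined_def
  proof (elim disjE exE conjE, goal_cases)
    case 1
    have "\<not> (\<exists>j<ncross K. (t(i := S)) j \<noteq> Active \<and> fst v \<in> {over K j, under K j})"
      using 1 v(2) by auto
    then show ?case using 1 by blast
  next
    case (2 j x' y')
    then have "fst v \<in> {over K j, under K j}" by (metis doubleton_eq_iff insertCI)
    then have "j \<noteq> i" using v(2) by auto
    then show ?case using 2 by (intro disjI2) (metis fun_upd_other)
  next
    case (3 j x' y')
    then have "fst v \<in> {over K j, under K j}" by (metis doubleton_eq_iff insertCI)
    then have "j \<noteq> i" using v(2) by auto
    then show ?case using 3 by (intro disjI2) (metis fun_upd_other)
  qed
qed

lemma partner_smoothed:
  assumes i: "i < ncross K" and o: "u \<in> half_strands K" "fst u = over K i"
    and v: "v \<in> half_strands K" "fst v = under K i"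
    and S: "S = SmoothA \<and> area (tangent K u) (tangent K v) < 0 \<or> S = SmoothB \<and> area (tangent K u) (tangent K v) > 0"
  shows "partner K (t(i := S)) u = v" "partner K (t(i := S)) v = u"
proof -
  have j: "joined K (t(i := S)) u v"
    using joined_over[OF i o(2), of "t(i := S)" v] S v(2) by auto
  show "partner K (t(i := S)) u = v" by (rule partner_eqI[OF o(1) v(1) j])
  show "partner K (t(i := S)) v = u" by (rule partner_eqI[OF v(1) o(1) joined_sym[OF j]])
qed

end

context wilson_expectation
begin

lemma plus_minus_cases:
  assumes i: "active i"
  defines "u \<equiv> out_edge D (over K i)" and "v \<equiv> out_edge D (under K i)"
  shows "area (tangent K u) (tangent K v) > 0 \<and> pp i = over K i \<and> pm i = under K i \<and> sg i = 1 \<or>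
    area (tangent K u) (tangent K v) < 0 \<and> pp i = under K i \<and> pm i = over K i \<and> sg i = -1"
proof -
  have ap: "over K i \<in> ap" "under K i \<in> ap" using i by (auto simp: active_passages_def)
  have d: "u \<in> H" "fst u = over K i" "v \<in> H" "fst v = under K i"
    using out_edge[OF ap(1)] out_edge[OF ap(2)] D_H by (simp_all add: u_def v_def)
  then have "snd u \<noteq> 0" "snd v \<noteq> 0" by (auto simp: half_strands_def)
  then have "area (tangent K u) (tangent K v) \<noteq> 0"
    using area_tangent[of "over K i" "snd u" "under K i" "snd v"] d(2,4) crossing(5)[of i] i
    by (metis mult_eq_0_iff prod.collapse)
  then show ?thesis
    using crossing(3)[of i] i
    by (auto simp: plus_passage_def minus_passage_def crossing_sign_def u_def[symmetric] v_def[symmetric])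
qed

text \<open>Let a and c be the half-strands leaving the plus and the minus passage, b and d those
  behind them. The smoothing compatible with the orientation joins a with d and b with c; it is the
  A-smoothing at a positive and the B-smoothing at a negative crossing. The factor
  \<open>sg i\<close> in the weights accounts for this exchange.\<close>

lemma skein_partner:
  assumes i: "active i" and t: "t i = Active"
    and w: "reversible H (far_end K) w"
  shows "unit_weight * state_value H (far_end K) (partner K t) w + casimir_weight i * (\<Sum>\<alpha>\<in>UNIV. \<Sum>\<beta>\<in>UNIV. G \<alpha> \<beta> *
      state_value H (far_end K) (partner K t) (insert_matrices (far_end K)
        ((\<lambda>v. mat 1)(out_edge D (pp i) := e \<alpha>, out_edge D (pm i) := e \<beta>)) w))
    = (- (casimir_weight i * sg i) / 2 - unit_weight) * state_value H (far_end K) (partner K (t(i := SmoothA))) w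
    + (casimir_weight i * sg i / 2 - unit_weight) * state_value H (far_end K) (partner K (t(i := SmoothB))) w"
proof -
  note pm = plus_minus_ap[OF i]
  have in_: "i < ncross K" using i by simp
  define a where "a = out_edge D (pp i)"
  define c where "c = out_edge D (pm i)"
  define b where "b = (pp i, - snd a)"
  define d where "d = (pm i, - snd c)"
  have aD: "a \<in> D" "fst a = pp i" "c \<in> D" "fst c = pm i"
    using out_edge[OF pm(1)] out_edge[OF pm(2)] by (simp_all add: a_def c_def)
  have aH: "a \<in> H" "c \<in> H" using aD D_H by auto
  have ns: "\<not> smoothed t (pp i)" "\<not> smoothed t (pm i)"
    using smoothed_iff[OF in_] t plus_minus[of i] by (metis insertCI)+
  have pa: "partner K t a = b" using partner_pass[OF aH(1), of t] ns aD by (simp add: b_def)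
  have pc: "partner K t c = d" using partner_pass[OF aH(2), of t] ns aD by (simp add: d_def)
  have bH: "b \<in> H" using p_in[OF aH(1), of t] pa by simp
  have dH: "d \<in> H" using p_in[OF aH(2), of t] pc by simp
  have sn: "snd a \<noteq> - snd a" "snd c \<noteq> - snd c" using aH by (auto simp: half_strands_def)
  have dist: "distinct [a, b, c, d]" using aD pm(3) sn by (auto simp: b_def d_def prod_eq_iff)
  have rest: "fst v \<notin> {over K i, under K i}" if v: "v \<in> H - {a, b, c, d}" for v
  proof
    assume "fst v \<in> {over K i, under K i}"
    then have f: "fst v \<in> {pp i, pm i}" using plus_minus[of i] by simp
    have "snd v \<in> {1, -1}" "snd a \<in> {1, -1}" "snd c \<in> {1, -1}" using v aH by (auto simp: half_strands_def)
    then have "(snd v = snd a \<or> snd v = - snd a) \<and> (snd v = snd c \<or> snd v = - snd c)" by auto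
    then have "v \<in> {a, b, c, d}" using f aD by (auto simp: b_def d_def prod_eq_iff)
    then show False using v by simp
  qed
  have up: "partner K (t(i := S)) v = partner K t v" if "v \<in> H - {a, b, c, d}" for S v
    using partner_update[OF in_, of v] rest[OF that] that by simp
  have tb: "tangent K b = - tangent K a" "tangent K d = - tangent K c"
    using aD by (simp_all add: b_def d_def tangent_def)
  have ar: "area (- p) q = - area p q" "area p (- q) = - area p q" for p q by (simp_all add: area_def)
  note skein = skein_state_value[OF finite_half_strands far_end_involution w partner_involution dist _ pa pc,
      where x = "casimir_weight i" and y = unit_weight]
  have sub: "{a, b, c, d} \<subseteq> H" using aH bH dH by simp
  let ?V = "\<lambda>p. state_value H (far_end K) p w"
  consider (pos) "area (tangent K a) (tangent K c) > 0" "pp i = over K i" "pm i = under K i" "sg i = 1"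
    | (neg) "area (tangent K c) (tangent K a) < 0" "pp i = under K i" "pm i = over K i" "sg i = -1"
    using plus_minus_cases[OF i] by (auto simp: a_def c_def)
  then show ?thesis
  proof cases
    case pos
    note A1 = partner_smoothed[OF in_ aH(1) _ dH, of SmoothA t]
    note A2 = partner_smoothed[OF in_ bH _ aH(2), of SmoothA t]
    note B1 = partner_smoothed[OF in_ aH(1) _ aH(2), of SmoothB t]
    note B2 = partner_smoothed[OF in_ bH _ dH, of SmoothB t]
    have fs: "fst a = over K i" "fst b = over K i" "fst c = under K i" "fst d = under K i"
      using aD pos by (simp_all add: b_def d_def)
    have sg: "SmoothA = SmoothA \<and> area (tangent K a) (tangent K d) < 0 \<or> SmoothA = SmoothB \<and> area (tangent K a) (tangent K d) > 0"
      "SmoothA = SmoothA \<and> area (tangent K b) (tangent K c) < 0 \<or> SmoothA = SmoothB \<and> area (tangent K b) (tangent K c) > 0"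
      "SmoothB = SmoothA \<and> area (tangent K a) (tangent K c) < 0 \<or> SmoothB = SmoothB \<and> area (tangent K a) (tangent K c) > 0"
      "SmoothB = SmoothA \<and> area (tangent K b) (tangent K d) < 0 \<or> SmoothB = SmoothB \<and> area (tangent K b) (tangent K d) > 0"
      using pos(1) by (simp_all add: tb ar)
    show ?thesis
      unfolding a_def[symmetric] c_def[symmetric]
      by (rule skein[OF sub]) (use A1[OF fs(1,4) sg(1)] A2[OF fs(2,3) sg(2)] B1[OF fs(1,3) sg(3)] B2[OF fs(2,4) sg(4)] up pos(4) in simp_all)
  next
    case neg
    note B1 = partner_smoothed[OF in_ dH _ aH(1), of SmoothB t]
    note B2 = partner_smoothed[OF in_ aH(2) _ bH, of SmoothB t]
    note A1 = partner_smoothed[OF in_ aH(2) _ aH(1), of SmoothA t]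
    note A2 = partner_smoothed[OF in_ dH _ bH, of SmoothA t]
    have fs: "fst a = under K i" "fst b = under K i" "fst c = over K i" "fst d = over K i"
      using aD neg by (simp_all add: b_def d_def)
    have sg: "SmoothB = SmoothA \<and> area (tangent K d) (tangent K a) < 0 \<or> SmoothB = SmoothB \<and> area (tangent K d) (tangent K a) > 0"
      "SmoothB = SmoothA \<and> area (tangent K c) (tangent K b) < 0 \<or> SmoothB = SmoothB \<and> area (tangent K c) (tangent K b) > 0"
      "SmoothA = SmoothA \<and> area (tangent K c) (tangent K a) < 0 \<or> SmoothA = SmoothB \<and> area (tangent K c) (tangent K a) > 0"
      "SmoothA = SmoothA \<and> area (tangent K d) (tangent K b) < 0 \<or> SmoothA = SmoothB \<and> area (tangent K d) (tangent K b) > 0"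
      using neg(1) by (simp_all add: tb ar)
    show ?thesis
      unfolding a_def[symmetric] c_def[symmetric]
      \<comment> \<open>At a negative crossing the A-smoothing is the third matching, so the
        summands change places.\<close>
      by (subst add.commute[of "_ * ?V (partner K (t(i := SmoothA)))"], rule skein[OF sub])
        (use A1[OF fs(3,1) sg(3)] A2[OF fs(4,2) sg(4)] B1[OF fs(4,1) sg(1)] B2[OF fs(3,2) sg(2)] up neg(4) in simp_all)
  qed
qed

lemma inserted_update:
  assumes i: "active i" and X: "X (pp i) = mat 1" "X (pm i) = mat 1"
  shows "inserted w (X(pm i := U, pp i := V))
    = insert_matrices (far_end K) ((\<lambda>v. mat 1)(out_edge D (pp i) := V, out_edge D (pm i) := U)) (inserted w X)"
proof -
  note pm = plus_minus_ap[OF i]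
  have o: "out_edge D (pp i) \<in> D" "out_edge D (pm i) \<in> D" "fst (out_edge D (pp i)) = pp i" "fst (out_edge D (pm i)) = pm i"
    using out_edge pm by auto
  have "(if v \<in> D then (X(pm i := U, pp i := V)) (fst v) else mat 1)
    = ((\<lambda>v. mat 1)(out_edge D (pp i) := V, out_edge D (pm i) := U)) v ** (if v \<in> D then X (fst v) else mat 1)" for v
  proof -
    consider "v = out_edge D (pp i)" | "v = out_edge D (pm i)" | "v \<notin> D"
      | "v \<in> D" "fst v \<noteq> pp i" "fst v \<noteq> pm i"
      using out_edge_eq[of v] pm by metis
    then show ?thesis
      by cases (use o X pm(3) in auto)
  qed
  then show ?thesis unfolding inserted_def insert_matrices_insert by (simp only:)
qed

text \<open>The local relation is linear in the state values and holds for every state of the other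
  crossings, so it survives their expansion.\<close>

lemma skein_state_sum:
  assumes i: "active i" and L: "i \<notin> set L" and t: "t i = Active" and w: "reversible H (far_end K) w"
    and X: "X (pp i) = mat 1" "X (pm i) = mat 1"
    and a: "a = - (casimir_weight i * sg i) / 2 - unit_weight" and b: "b = casimir_weight i * sg i / 2 - unit_weight"
  shows "unit_weight * state_sum a b L t (inserted w X) + casimir_weight i * (\<Sum>\<alpha>\<in>UNIV. \<Sum>\<beta>\<in>UNIV. G \<alpha> \<beta> *
      state_sum a b L t (inserted w (X(pm i := e \<beta>, pp i := e \<alpha>))))
    = a * state_sum a b L (t(i := SmoothA)) (inserted w X) + b * state_sum a b L (t(i := SmoothB)) (inserted w X)"
  using L t
proof (induction L arbitrary: t)
  case Nil
  show ?case
    unfolding state_sum.simps inserted_update[OF i X]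
    using skein_partner[where t = t and w = "inserted w X", OF i Nil(2) inserted_reversible[OF w]] unfolding a[symmetric] b[symmetric] .
next
  case (Cons j L)
  have ji: "j \<noteq> i" "i \<notin> set L" using Cons.prems by auto
  have tw: "t(i := S, j := S') = t(j := S', i := S)" for S S' using ji by (auto simp: fun_eq_iff)
  have "(t(j := S)) i = Active" for S using ji Cons.prems by simp
  note IH = Cons.IH[of "t(j := S)" for S, OF ji(2) this]
  have "unit_weight * state_sum a b (j # L) t (inserted w X) + casimir_weight i * (\<Sum>\<alpha>\<in>UNIV. \<Sum>\<beta>\<in>UNIV. G \<alpha> \<beta> *
      state_sum a b (j # L) t (inserted w (X(pm i := e \<beta>, pp i := e \<alpha>))))
    = a * (unit_weight * state_sum a b L (t(j := SmoothA)) (inserted w X) + casimir_weight i * (\<Sum>\<alpha>\<in>UNIV. \<Sum>\<beta>\<in>UNIV. G \<alpha> \<beta> *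
      state_sum a b L (t(j := SmoothA)) (inserted w (X(pm i := e \<beta>, pp i := e \<alpha>)))))
    + b * (unit_weight * state_sum a b L (t(j := SmoothB)) (inserted w X) + casimir_weight i * (\<Sum>\<alpha>\<in>UNIV. \<Sum>\<beta>\<in>UNIV. G \<alpha> \<beta> *
      state_sum a b L (t(j := SmoothB)) (inserted w (X(pm i := e \<beta>, pp i := e \<alpha>)))))"
    by (simp add: distrib_left sum.distrib sum_distrib_left mult_ac del: fun_upd_apply)
  also have "\<dots> = a * state_sum a b (j # L) (t(i := SmoothA)) (inserted w X)
      + b * state_sum a b (j # L) (t(i := SmoothB)) (inserted w X)"
    unfolding IH state_sum.simps tw by (simp add: algebra_simps del: fun_upd_apply)
  finally show ?case .
qed

text \<open>Crossings not yet in the list stay active and are passed straight, while the listed ones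
  are replaced by their smoothings. X is general because treating one crossing inserts basis
  elements that the induction hypothesis must admit.\<close>

lemma expanded_state_sum:
  assumes A: "is_connection A" and L: "\<forall>i\<in>set L. active i" "distinct L"
    and X: "\<And>p. p \<notin> ap \<Longrightarrow> X p = mat 1" "\<forall>i\<in>set L. X (pp i) = mat 1 \<and> X (pm i) = mat 1"
    and a: "\<forall>i\<in>set L. a = - (casimir_weight i * sg i) / 2 - unit_weight" and b: "\<forall>i\<in>set L. b = casimir_weight i * sg i / 2 - unit_weight"
  shows "(-1) ^ jnum K s * expanded L X (arc_holonomy K s A)
    = state_sum a b L s (inserted (edge_holonomy K A) X)"
  using L X a b
proof (induction L arbitrary: X)
  case Nil
  then show ?case using loops_with_state_value[OF A] by simp
next
  case (Cons i L)
  let ?h = "arc_holonomy K s A" and ?w = "edge_holonomy K A" and ?j = "(-1) ^ jnum K s :: complex"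
  have i: "active i" "i \<notin> set L" "X (pp i) = mat 1" "X (pm i) = mat 1"
    "a = - (casimir_weight i * sg i) / 2 - unit_weight" "b = casimir_weight i * sg i / 2 - unit_weight" using Cons.prems by auto
  have IH: "?j * expanded L X' ?h = state_sum a b L s (inserted ?w X')"
    if "\<And>p. p \<notin> ap \<Longrightarrow> X' p = mat 1" "\<forall>i\<in>set L. X' (pp i) = mat 1 \<and> X' (pm i) = mat 1" for X'
    using Cons.IH[of X'] Cons.prems that by auto
  have IH0: "?j * expanded L X ?h = state_sum a b L s (inserted ?w X)"
    by (rule IH) (use Cons.prems in auto)
  have IH1: "?j * expanded L (X(pm i := U, pp i := V)) ?h = state_sum a b L s (inserted ?w (X(pm i := U, pp i := V)))" for U V
  proof (rule IH)
    fix p assume "p \<notin> ap"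
    then show "(X(pm i := U, pp i := V)) p = mat 1" using Cons.prems(3) plus_minus_ap[OF i(1)] by auto
  next
    show "\<forall>j\<in>set L. (X(pm i := U, pp i := V)) (pp j) = mat 1 \<and> (X(pm i := U, pp i := V)) (pm j) = mat 1"
    proof
      fix j assume j: "j \<in> set L"
      have "{pp i, pm i} \<inter> {pp j, pm j} = {}"
        by (rule plus_minus_distinct) (use i j Cons.prems(1) in auto)
      then show "(X(pm i := U, pp i := V)) (pp j) = mat 1 \<and> (X(pm i := U, pp i := V)) (pm j) = mat 1"
        using Cons.prems(4) j by auto
    qed
  qed
  have "?j * expanded (i # L) X ?h = unit_weight * (?j * expanded L X ?h) + casimir_weight i * (\<Sum>\<alpha>\<in>UNIV. \<Sum>\<beta>\<in>UNIV. G \<alpha> \<beta> *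
      (?j * expanded L (X(pm i := e \<beta>, pp i := e \<alpha>)) ?h))"
    by (simp add: distrib_left sum_distrib_left mult_ac del: fun_upd_apply)
  also have "\<dots> = state_sum a b (i # L) s (inserted ?w X)"
    unfolding IH0 IH1 state_sum.simps
    by (rule skein_state_sum[OF i(1,2) _ edge_holonomy_reversible[OF A] i(3-6)]) (use i(1) in simp)
  finally show ?case .
qed

text \<open>The sign of the crossing enters squared. With it the last trace of the orientation
  disappears from the weights, which become a and b.\<close>

lemma casimir_weight_sign: "casimir_weight i * sg i = 2 * (sinh (of_real (sqrt 3) * bt) / of_real (sqrt 3))"
  using sg_square[of i] by (simp add: casimir_weight_def)

lemma normalized_expectation_state_sum:
  assumes A: "is_connection A"
    and a: "a = - cosh (of_real (sqrt 3) * bt) - 1 / of_real (sqrt 3) * sinh (of_real (sqrt 3) * bt)"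
    and b: "b = - cosh (of_real (sqrt 3) * bt) + 1 / of_real (sqrt 3) * sinh (of_real (sqrt 3) * bt)"
  shows "normalized_expectation bt r e K s D A
    = inverse (r ^ cnum K s) * state_sum a b (filter (\<lambda>i. s i = Active) [0..<ncross K]) s (edge_holonomy K A)"
proof -
  let ?L = "filter (\<lambda>i. s i = Active) [0..<ncross K]"
  have "(-1) ^ jnum K s * expanded ?L (\<lambda>p. mat 1) (arc_holonomy K s A)
    = state_sum a b ?L s (inserted (edge_holonomy K A) (\<lambda>p. mat 1))"
    by (rule expanded_state_sum[OF A]) (auto simp: casimir_weight_sign unit_weight_def a b)
  then show ?thesis
    unfolding normalized_expectation_def expectation_expanded inserted_one by (simp add: mult_ac)
qed

end

section \<open>Orientation independence and the skein relation of the bracket\<close>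

lemma (in diagram) orientation_ex: "\<exists>D. orientation K s D"
proof -
  obtain D where D: "D \<subseteq> half_strands K" "\<forall>x\<in>half_strands K. x \<in> D \<longleftrightarrow> far_end K x \<notin> D" "\<forall>x\<in>D. N s x \<in> D"
    using orientation_exists[of s] by blast
  have "\<forall>x\<in>D. next_edge K s x \<in> D" using D(3) by (simp add: N_apply next_edge_def)
  then have "orientation K s D" unfolding orientation_def by (intro conjI D)
  then show ?thesis by blast
qed

theorem mainTheorem2:
  fixes lam \<beta> a b r q :: complex
    and e :: "'n::finite \<Rightarrow> complex^2^2"
    and K :: link_diagram
    and s :: "nat \<Rightarrow> smoothing"
    and A :: "real^2 \<Rightarrow> real^2 \<Rightarrow> complex^2^2"
  assumes "lam \<noteq> 0"
    and "\<beta> = 1 / (2 * lam)"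
    and "a = - cosh (of_real (sqrt 3) * \<beta>) - 1 / of_real (sqrt 3) * sinh (of_real (sqrt 3) * \<beta>)"
    and "b = - cosh (of_real (sqrt 3) * \<beta>) + 1 / of_real (sqrt 3) * sinh (of_real (sqrt 3) * \<beta>)"
    and "a * b \<noteq> 0"
    and "r\<^sup>2 = a * b"
    and "q = a / r"
    and "is_su2_basis e"
    and "is_link_diagram K"
    and "is_connection A"
  shows "(\<forall>D D'. orientation K s D \<longrightarrow> orientation K s D' \<longrightarrow>
            normalized_expectation \<beta> r e K s D A = normalized_expectation \<beta> r e K s D' A) \<and>
         (\<forall>i<ncross K. s i = Active \<longrightarrow>
            bracket \<beta> r e K s A =
              q * bracket \<beta> r e K (s(i := SmoothA)) A + inverse q * bracket \<beta> r e K (s(i := SmoothB)) A)"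
proof -
  interpret diagram K by unfold_locales (rule assms(9))
  let ?L = "\<lambda>s. filter (\<lambda>i. s i = Active) [0..<ncross K]"
  let ?F = "\<lambda>s. inverse (r ^ cnum K s) * state_sum a b (?L s) s (edge_holonomy K A)"
  have F: "normalized_expectation \<beta> r e K s D A = ?F s" if "orientation K s D" for s D
  proof -
    interpret wilson_expectation K s D e \<beta>
      by unfold_locales (use that assms(8) in simp_all)
    show ?thesis by (rule normalized_expectation_state_sum[OF assms(10,3,4)])
  qed
  \<comment> \<open>The description in \<open>bracket\<close> requires some orientation to exist;
    its uniqueness is F, whose right-hand side does not involve D.\<close>
  have br: "bracket \<beta> r e K s A = ?F s" for s
    unfolding bracket_def
  proof (rule the_equality)
    show "\<exists>D. orientation K s D \<and> ?F s = normalized_expectation \<beta> r e K s D A"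
      using orientation_ex[of s] F by metis
  next
    fix z assume "\<exists>D. orientation K s D \<and> z = normalized_expectation \<beta> r e K s D A"
    then show "z = ?F s" using F by blast
  qed
  have "bracket \<beta> r e K s A =
      q * bracket \<beta> r e K (s(i := SmoothA)) A + inverse q * bracket \<beta> r e K (s(i := SmoothB)) A"
    if i: "i < ncross K" "s i = Active" for i
  proof -
    have r: "r \<noteq> 0" "a \<noteq> 0" using assms(5,6) by auto
    \<comment> \<open>From \<open>r\<^sup>2 = a * b\<close> the inverse r / a of q equals b /
      r.\<close>
    have qi: "inverse q = b / r"
      using assms(6) r by (simp add: assms(7) field_simps power2_eq_square)
    let ?L1 = "filter (\<lambda>j. s j = Active) [0..<i]" and ?L2 = "filter (\<lambda>j. s j = Active) [Suc i..<ncross K]"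
    have split: "[0..<ncross K] = [0..<i] @ i # [Suc i..<ncross K]"
      using upt_add_eq_append[of 0 i "ncross K - i"] upt_conv_Cons[OF i(1)] i(1) by simp
    have L: "?L s = ?L1 @ i # ?L2" unfolding split using i(2) by simp
    have L': "?L (s(i := S)) = ?L1 @ ?L2" if "S \<noteq> Active" for S
    proof -
      have "filter (\<lambda>j. (s(i := S)) j = Active) [0..<i] = ?L1"
        "filter (\<lambda>j. (s(i := S)) j = Active) [Suc i..<ncross K] = ?L2"
        by (rule filter_cong; auto)+
      then show ?thesis unfolding split using that by simp
    qed
    have c: "cnum K s = Suc (cnum K (s(i := S)))" if "S \<noteq> Active" for S
    proof -
      have "{j. j < ncross K \<and> s j = Active} = insert i {j. j < ncross K \<and> (s(i := S)) j = Active}"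
        using i that by auto
      then show ?thesis using that by (simp add: cnum_def)
    qed
    have "i \<notin> set ?L1" by simp
    from state_sum_append[OF this, of a b ?L2 s "edge_holonomy K A"]
    have ss: "state_sum a b (?L s) s (edge_holonomy K A) =
        a * state_sum a b (?L (s(i := SmoothA))) (s(i := SmoothA)) (edge_holonomy K A)
      + b * state_sum a b (?L (s(i := SmoothB))) (s(i := SmoothB)) (edge_holonomy K A)"
      unfolding L L'[OF smoothing.distinct(2)] L'[OF smoothing.distinct(4)] .
    have cA: "cnum K s = Suc (cnum K (s(i := SmoothA)))" by (rule c) simp
    have "cnum K s = Suc (cnum K (s(i := SmoothB)))" by (rule c) simp
    then have cB: "cnum K (s(i := SmoothB)) = cnum K (s(i := SmoothA))" using cA by simp
    \<comment> \<open>The additional active crossing contributes one more factor 1 / r, which turns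
      the weights a and b into q and its inverse.\<close>
    show ?thesis
      unfolding br ss qi cA cB unfolding assms(7) using r(1) by (simp add: field_simps del: fun_upd_apply)
  qed
  then show ?thesis using F by simp
qed

end
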